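(* Let $a\neq b$ be complex numbers and let $\mathcal{R}$ be a (finite or infinite) set of prime numbers. Let $P\in U(\mathcal{R})$ and $Q\in U_1(\mathcal{R})$, and put $p=P'$, $q=Q'$. Then the Abel equation $y'=p(x)y^3+q(x)y^2$ has a parametric center on $[a,b]$ if and only if $P$ and $Q$ satisfy the Composition Condition on $[a,b]$.
   Context: $\mathcal{P}$ is the space of complex polynomials vanishing at $a$ and $b$. $U(\mathcal{R})$ is the set of $P=\sum_{i=0}^N a_ix^i\in\mathcal{P}$ such that for every $i$ with $a_i\ne0$, the integer $i$ is either coprime with each $r\in\mathcal{R}$ or is a power of some $r\in\mathcal{R}$. $U_1(\mathcal{R})$ is the set of $Q=\sum_i b_ix^i\in\mathcal{P}$ such that for every $i$ with $b_i\neq 0$, all prime factors of $i$ belong to $\mathcal{R}$. The equation $y'=py^3+qy^2$ has a parametric center on $[a,b]$ if for every $\epsilon\in\mathbb{C}$ every solution of $y'=p y^3+\epsilon q y^2$ with $|y(a)|$ sufficiently small satisfies $y(b)=y(a)$ (continuation along the segment $[a,b]$). $P,Q$ satisfy the Composition Condition on $[a,b]$ if there exist polynomials $\widetilde P,\widetilde Q,W$ with $W(a)=W(b)$ such that $P=\widetilde P\circ W$ and $Q=\widetilde Q\circ W$. *)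

theory Defs
  imports "HOL-Analysis.Analysis" "HOL-Computational_Algebra.Computational_Algebra"
begin

definition vanish_space :: "complex \<Rightarrow> complex \<Rightarrow> complex poly set" where
  "vanish_space a b = {P. poly P a = 0 \<and> poly P b = 0}"

definition U_set :: "complex \<Rightarrow> complex \<Rightarrow> nat set \<Rightarrow> complex poly set" where
  "U_set a b R = {P \<in> vanish_space a b.
     \<forall>i. coeff P i \<noteq> 0 \<longrightarrow> ((\<forall>r\<in>R. coprime i r) \<or> (\<exists>r\<in>R. \<exists>k. i = r ^ k))}"

definition U1_set :: "complex \<Rightarrow> complex \<Rightarrow> nat set \<Rightarrow> complex poly set" where
  "U1_set a b R = {Q \<in> vanish_space a b.
     \<forall>i. coeff Q i \<noteq> 0 \<longrightarrow> prime_factors i \<subseteq> R}"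

definition parametric_center :: "complex poly \<Rightarrow> complex poly \<Rightarrow> complex \<Rightarrow> complex \<Rightarrow> bool" where
  "parametric_center p q a b \<longleftrightarrow>
     (\<forall>\<epsilon>::complex. \<exists>\<delta>>0. \<forall>y::complex \<Rightarrow> complex.
        ((\<forall>x\<in>closed_segment a b.
            (y has_field_derivative (poly p x * (y x)^3 + \<epsilon> * poly q x * (y x)^2))
              (at x within closed_segment a b))
         \<and> norm (y a) < \<delta>) \<longrightarrow> y b = y a)"

definition composition_condition :: "complex poly \<Rightarrow> complex poly \<Rightarrow> complex \<Rightarrow> complex \<Rightarrow> bool" where
  "composition_condition P Q a b \<longleftrightarrow>
     (\<exists>Pt Qt W :: complex poly. poly W a = poly W b \<and> P = pcompose Pt W \<and> Q = pcompose Qt W)"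

end

theory Submission
  imports Defs "HOL-Complex_Analysis.Complex_Analysis" "HOL-Real_Asymp.Real_Asymp" "HOL-Number_Theory.Cong"
begin

text \<open>
  Since a parametric center holds for every value of the parameter, the coefficients of the return
  map are polynomials in it that vanish identically; their value at \<open>0\<close> gives \<open>\<integral>\<^sub>a\<^sup>b P^k dQ = 0\<close> for all \<open>k\<close>.
  Expanding \<open>\<integral>\<^sub>a\<^sup>b Q P' / (P - t) dx = 0\<close> in partial fractions over the branches \<open>x\<^sub>s(t)\<close> of \<open>P\<^sup>-\<^sup>1\<close> and
  continuing from \<open>t = \<infinity>\<close> to \<open>t = 0\<close>, the coefficient of \<open>log t\<close> gives a linear relation
  \<open>\<Sum> f\<^sub>s Q(x\<^sub>s(t)) = 0\<close>: the mean of \<open>Q\<close> over the branches starting at \<open>a\<close> equals that over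
  the branches starting at \<open>b\<close>. By planarity the two families are not interlaced at
  infinity, so \<open>\<Sum> f\<^sub>s \<zeta>^s \<noteq> 0\<close> for a primitive \<open>n\<close>-th root of unity \<open>\<zeta>\<close>, \<open>n = deg P\<close>, and by irreducibility of the
  cyclotomic polynomial also \<open>\<Sum> f\<^sub>s \<zeta>^(l s) \<noteq> 0\<close> for \<open>l\<close> coprime to \<open>n\<close>. Hence the Puiseux expansion of \<open>Q\<close> in
  \<open>P^(1/n)\<close> at infinity has no exponent coprime to \<open>n\<close>. If \<open>n\<close> is coprime to all primes in \<open>R\<close>,
  the leading exponent \<open>deg Q\<close> contradicts this. If \<open>n\<close> is a power of \<open>r\<close>, all exponents are divisible by
  \<open>r\<close>, so \<open>P\<close> and \<open>Q\<close> have a common right factor (Lueroth), and one descends.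
\<close>

section \<open>Branches of the inverse of a polynomial\<close>

text \<open>Multiplying \<open>P\<close> by a unimodular constant moves its nonzero critical values
  off the positive ray, so the branches are holomorphic on a convex sector around that ray; there
  the identity theorem carries a relation from infinity to 0 and back. A branch starting at a root
  of multiplicity p leaves it like t^(1/p), so the logarithm of (b - x)/(a - x) contributes log t
  with a coefficient of size 1/p, of opposite signs at \<open>a\<close> and \<open>b\<close>: this
  is the weight f_s. Clearing the two denominators gives integers, as the conjugation of roots of
  unity demands. If both the sum of the f_s and the sum of the f_s zeta^s vanished, every real
  affine function of the points zeta^s would have weighted sum 0. Families that are not interlaced
  are separated by a line, and its equation gives a weighted sum of nonnegative terms. In the
  descent the endpoints become W(a) and W(b), so they vary in the induction; the new degree divides
  a power of r and is again one. For the converse, the equation is solved in the variable W, and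
  uniqueness of solutions transports the result back.\<close>

lemma separable_fibre:
  fixes P :: "complex poly"
  assumes "degree P > 0" and sep: "\<And>x. poly P x = t \<Longrightarrow> poly (pderiv P) x \<noteq> 0"
  shows "P - [:t:] = smult (lead_coeff P) (\<Prod>x | poly P x = t. [:-x, 1:])"
    and "finite {x. poly P x = t}" and "card {x. poly P x = t} = degree P"
proof -
  let ?F = "P - [:t:]"
  have dg: "degree ?F = degree P"
  proof -
    have "degree [:-t:] < degree P" using assms by simp
    from degree_add_eq_left[OF this] show ?thesis unfolding diff_conv_add_uminus by simp
  qed
  have lc: "lead_coeff ?F = lead_coeff P"
    unfolding dg using assms(1) by (simp add: coeff_pCons split: nat.splits)
  have nz: "?F \<noteq> 0" using dg assms by (metis degree_0 less_irrefl)
  have rs: "rsquarefree ?F"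
    unfolding rsquarefree_roots using sep by (auto simp: pderiv_diff pderiv_pCons)
  have R: "{x. poly ?F x = 0} = {x. poly P x = t}" by auto
  from complex_poly_decompose_rsquarefree[OF rs] lc R
  show 1: "?F = smult (lead_coeff P) (\<Prod>x | poly P x = t. [:-x, 1:])" by simp
  show fin: "finite {x. poly P x = t}" using poly_roots_finite[OF nz] R by simp
  have "degree ?F = degree (\<Prod>x | poly P x = t. [:-x, 1:])"
    using 1 assms(1) by (metis degree_0 degree_smult_eq leading_coeff_0_iff less_irrefl)
  also have "\<dots> = (\<Sum>x | poly P x = t. degree [:-x,1:])"
    by (rule degree_prod_eq_sum_degree) auto
  finally show "card {x. poly P x = t} = degree P" using dg by simp
qed

text \<open>The product of \<open>v\<close> with a holomorphic \<open>p\<close>-th root of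
  \<open>G v\<close>, obtained from a logarithm of \<open>G\<close>, has nonzero derivative at 0;
  \<open>\<phi>\<close> is its local inverse. The same construction serves the finite roots of a
  polynomial and the point at infinity.\<close>

lemma local_power_inverse:
  assumes holG: "G holomorphic_on ball 0 R" and "R > 0" and G0: "G 0 \<noteq> 0" and "p > 0"
  obtains r \<phi> where "r > 0" "\<phi> holomorphic_on ball 0 r" "\<phi> 0 = 0" "inj_on \<phi> (ball 0 r)"
    "\<phi> ` ball 0 r \<subseteq> ball 0 R" "open (\<phi> ` ball 0 r)" "deriv \<phi> 0 \<noteq> 0"
    "\<And>w. w \<in> ball 0 r \<Longrightarrow> (\<phi> w) ^ p * G (\<phi> w) = w ^ p"
proof -
  have "continuous_on (ball 0 R) G" using holG holomorphic_on_imp_continuous_on by blast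
  then obtain R1 where R1: "R1 > 0" "R1 \<le> R" and nz: "\<And>v. v \<in> ball 0 R1 \<Longrightarrow> G v \<noteq> 0"
  proof -
    have "open (ball (0::complex) R \<inter> G -` (- {0}))"
      using \<open>continuous_on (ball 0 R) G\<close> by (intro continuous_open_preimage) auto
    moreover have "0 \<in> ball (0::complex) R \<inter> G -` (- {0})" using G0 \<open>R>0\<close> by auto
    ultimately obtain e where e: "e > 0" "ball 0 e \<subseteq> ball (0::complex) R \<inter> G -` (- {0})"
      using openE by blast
    show ?thesis by (rule that[of "min e R"]) (use e \<open>R>0\<close> in auto)
  qed
  have "G holomorphic_on ball 0 R1" using holG R1 by (meson holomorphic_on_subset subset_ball)
  then obtain g where g: "g holomorphic_on ball 0 R1" "\<And>v. v \<in> ball 0 R1 \<Longrightarrow> G v = exp (g v)"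
    using nz convex_imp_simply_connected[of "ball (0::complex) R1"]
    by (metis convex_ball open_ball simply_connected_eq_holomorphic_log)
  define k where "k = (\<lambda>v. v * exp (g v / of_nat p))"
  have kp: "k v ^ p = v ^ p * G v" if "v \<in> ball 0 R1" for v
    using \<open>p>0\<close> g(2)[OF that] by (simp add: k_def power_mult_distrib exp_of_nat_mult[symmetric])
  have kh: "k holomorphic_on ball 0 R1" unfolding k_def by (intro holomorphic_intros g) (use \<open>p>0\<close> in auto)
  have k0: "k 0 = 0" by (simp add: k_def)
  define e where "e = (\<lambda>v. exp (g v / of_nat p))"
  have "e holomorphic_on ball 0 R1" unfolding e_def by (intro holomorphic_intros g) (use \<open>p>0\<close> in auto)
  then have "(e has_field_derivative deriv e 0) (at 0)" using R1(1)
    by (meson centre_in_ball holomorphic_derivI open_ball)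
  from DERIV_mult[OF DERIV_ident this]
  have "(k has_field_derivative e 0) (at 0)" by (simp add: k_def e_def)
  then have dk: "deriv k 0 \<noteq> 0" by (simp add: DERIV_imp_deriv e_def)
  have "0 \<in> ball (0::complex) R1" using R1(1) by simp
  from has_complex_derivative_locally_injective[OF kh this open_ball dk]
  obtain s where s: "s > 0" "ball 0 s \<subseteq> ball (0::complex) R1" "inj_on k (ball 0 s)" .
  have khs: "k holomorphic_on ball 0 s" using kh s(2) holomorphic_on_subset by blast
  obtain \<phi> where \<phi>: "\<phi> holomorphic_on k ` ball 0 s" "\<And>z. z \<in> ball 0 s \<Longrightarrow> \<phi> (k z) = z"
    using holomorphic_has_inverse[OF khs open_ball s(3)] by metis
  have opk: "open (k ` ball 0 s)" using open_mapping_thm3[OF khs open_ball s(3)] .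
  moreover have "0 \<in> k ` ball 0 s" using k0 s(1) by (metis centre_in_ball image_eqI)
  ultimately obtain r where r: "r > 0" "ball 0 r \<subseteq> k ` ball 0 s" using openE by blast
  have inv: "k (\<phi> w) = w \<and> \<phi> w \<in> ball 0 s" if "w \<in> ball 0 r" for w
    using r(2) that \<phi>(2) by force
  have hol: "\<phi> holomorphic_on ball 0 r" using \<phi>(1) r(2) holomorphic_on_subset by blast
  have inj: "inj_on \<phi> (ball 0 r)" by (metis inj_onI inv)
  show ?thesis
  proof (rule that[OF r(1) hol _ inj])
    show "\<phi> 0 = 0" using \<phi>(2)[of 0] s(1) k0 by simp
    show "\<phi> ` ball 0 r \<subseteq> ball 0 R" using inv s(2) R1(2) by force
    show "open (\<phi> ` ball 0 r)" using open_mapping_thm3[OF hol open_ball inj] .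
    show "deriv \<phi> 0 \<noteq> 0" using holomorphic_injective_imp_regular[OF hol open_ball inj] r(1) by simp
    show "(\<phi> w) ^ p * G (\<phi> w) = w ^ p" if "w \<in> ball 0 r" for w
      using kp[of "\<phi> w"] inv[OF that] s(2) by (metis subsetD)
  qed
qed

text \<open>Here \<open>G\<close> is the cofactor of the root, translated to 0, so that
  \<open>w\<close> becomes a local determination of the \<open>order c P\<close>-th root of
  \<open>P\<close>.\<close>

lemma local_root_parametrization:
  fixes P :: "complex poly"
  assumes "P \<noteq> 0" and Pc: "poly P c = 0"
  obtains r \<phi> where "r > 0" "\<phi> holomorphic_on ball 0 r" "\<phi> 0 = c" "inj_on \<phi> (ball 0 r)"
    "open (\<phi> ` ball 0 r)" "deriv \<phi> 0 \<noteq> 0"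
    "\<And>w. w \<in> ball 0 r \<Longrightarrow> poly P (\<phi> w) = w ^ order c P"
proof -
  obtain H where H: "P = [:-c, 1:] ^ order c P * H" "\<not> [:-c, 1:] dvd H"
    using order_decomp[OF \<open>P \<noteq> 0\<close>] by blast
  have p: "order c P > 0" using assms order_root by blast
  have "(\<lambda>v. poly H (c + v)) holomorphic_on ball 0 1" by (intro holomorphic_intros)
  moreover have "poly H (c + 0) \<noteq> 0" using H(2) by (simp add: poly_eq_0_iff_dvd)
  ultimately obtain r \<phi> where *: "r > 0" "\<phi> holomorphic_on ball 0 r" "\<phi> 0 = 0" "inj_on \<phi> (ball 0 r)"
    "open (\<phi> ` ball 0 r)" "deriv \<phi> 0 \<noteq> 0"
    "\<And>w. w \<in> ball 0 r \<Longrightarrow> (\<phi> w) ^ order c P * poly H (c + \<phi> w) = w ^ order c P"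
    using local_power_inverse[of "\<lambda>v. poly H (c + v)" 1 "order c P"] p by (smt (verit, best) zero_less_one)
  show ?thesis
  proof (rule that[of r "\<lambda>w. c + \<phi> w"])
    show "inj_on (\<lambda>w. c + \<phi> w) (ball 0 r)" using *(4) by (auto simp: inj_on_def)
    have "(\<lambda>w. c + \<phi> w) ` ball 0 r = (+) c ` (\<phi> ` ball 0 r)" by auto
    then show "open ((\<lambda>w. c + \<phi> w) ` ball 0 r)" using open_translation[OF *(5)] by simp
    show "deriv (\<lambda>w. c + \<phi> w) 0 \<noteq> 0"
      using *(1,2,6) holomorphic_on_imp_differentiable_at[OF *(2) open_ball, of 0]
      by (simp add: deriv_add)
    show "poly P (c + \<phi> w) = w ^ order c P" if "w \<in> ball 0 r" for w
    proof -
      have "poly P (c + \<phi> w) = poly ([:-c, 1:] ^ order c P * H) (c + \<phi> w)" using H(1) by simp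
      also have "\<dots> = (\<phi> w) ^ order c P * poly H (c + \<phi> w)" by (simp add: poly_power)
      finally show ?thesis using *(7)[OF that] by simp
    qed
  qed (use * in \<open>auto intro!: holomorphic_intros\<close>)
qed

text \<open>In the coordinate \<open>v = 1 / x\<close> the function \<open>1 / P\<close> is
  \<open>v ^ degree P / poly (reflect_poly P) v\<close>, which \<open>local_power_inverse\<close>
  uniformizes at 0. The resulting \<open>\<psi>\<close> has a simple pole at 0 with residue
  \<open>\<kappa>\<close>.\<close>

lemma root_at_infinity:
  fixes P :: "complex poly"
  assumes n: "degree P > 0"
  obtains r \<psi> \<kappa> where "r > 0" "\<psi> holomorphic_on ball 0 r - {0}" "inj_on \<psi> (ball 0 r - {0})"
    "\<kappa> \<noteq> 0" "((\<lambda>w. w * \<psi> w) \<longlongrightarrow> \<kappa>) (at 0)"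
    "\<And>w. w \<in> ball 0 r - {0} \<Longrightarrow> poly P (\<psi> w) = 1 / w ^ degree P"
proof -
  let ?R = "reflect_poly P"
  have lc: "poly ?R 0 \<noteq> 0" using n by auto
  have "isCont (poly ?R) 0" by simp
  then obtain R where R: "R > 0" "\<And>v. v \<in> ball 0 R \<Longrightarrow> poly ?R v \<noteq> 0"
    using continuous_at_avoid[of 0 "poly ?R" 0] lc by (auto simp: dist_commute)
  have "(\<lambda>v. 1 / poly ?R v) holomorphic_on ball 0 R" using R(2) by (intro holomorphic_intros) auto
  then obtain r \<eta> where *: "r > 0" "\<eta> holomorphic_on ball 0 r" "\<eta> 0 = 0" "inj_on \<eta> (ball 0 r)"
    "\<eta> ` ball 0 r \<subseteq> ball 0 R" "deriv \<eta> 0 \<noteq> 0"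
    "\<And>w. w \<in> ball 0 r \<Longrightarrow> (\<eta> w) ^ degree P * (1 / poly ?R (\<eta> w)) = w ^ degree P"
    using local_power_inverse[of "\<lambda>v. 1 / poly ?R v" R "degree P"] R(1) lc n by (smt (verit, best) divide_eq_0_iff zero_neq_one)
  have nz: "\<eta> w \<noteq> 0" if "w \<in> ball 0 r - {0}" for w
    using *(1,3,4) that by (metis DiffD1 DiffD2 centre_in_ball inj_onD insertCI)
  show ?thesis
  proof (rule that[of r "\<lambda>w. 1 / \<eta> w" "1 / deriv \<eta> 0"])
    show "(\<lambda>w. 1 / \<eta> w) holomorphic_on ball 0 r - {0}"
      using *(2) nz by (intro holomorphic_intros) (auto intro: holomorphic_on_subset)
    show "inj_on (\<lambda>w. 1 / \<eta> w) (ball 0 r - {0})"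
      using *(4) by (auto simp: inj_on_def)
    have "(\<eta> has_field_derivative deriv \<eta> 0) (at 0)"
      using *(1,2) by (meson centre_in_ball holomorphic_derivI open_ball)
    then have "((\<lambda>w. (\<eta> w - \<eta> 0) / (w - 0)) \<longlongrightarrow> deriv \<eta> 0) (at 0)"
      by (simp add: has_field_derivative_iff)
    then have "((\<lambda>w. 1 / (\<eta> w / w)) \<longlongrightarrow> 1 / deriv \<eta> 0) (at 0)"
      using *(3,6) by (intro tendsto_intros) auto
    then show "((\<lambda>w. w * (1 / \<eta> w)) \<longlongrightarrow> 1 / deriv \<eta> 0) (at 0)" by simp
    show "poly P (1 / \<eta> w) = 1 / w ^ degree P" if w: "w \<in> ball 0 r - {0}" for w
    proof -
      have "\<eta> w \<in> ball 0 R" using *(5) w by blast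
      then have Rn: "poly ?R (\<eta> w) \<noteq> 0" using R(2) by blast
      have "poly ?R (\<eta> w) = \<eta> w ^ degree P * poly P (inverse (\<eta> w))"
        by (rule poly_reflect_poly_nz[OF nz[OF w]])
      with *(7)[of w] w Rn nz[OF w] show ?thesis by (auto simp: field_simps)
    qed
  qed (use * in auto)
qed

text \<open>Around each point of a fibre \<open>P\<close> is injective on a ball, and these balls
  are disjoint. Over the intersection \<open>T\<close> of their images each ball supplies one
  preimage, which already makes \<open>degree P\<close> of them; by counting, no preimage lies
  outside the balls, so they are the sheets.\<close>

lemma covering_space_poly:
  fixes P :: "complex poly"
  assumes n: "degree P > 0" and U: "open U" and sep: "\<And>x. poly P x \<in> U \<Longrightarrow> poly (pderiv P) x \<noteq> 0"
  shows "covering_space (poly P -` U) (poly P) U"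
  unfolding covering_space_def
proof (intro conjI ballI)
  show "continuous_on (poly P -` U) (poly P)" by (intro continuous_intros)
  show "poly P ` (poly P -` U) = U"
  proof -
    have "\<exists>x. poly P x = t" for t
    proof -
      have "degree (P - [:t:]) > 0"
        using n degree_add_eq_left[of "[:-t:]" P] unfolding diff_conv_add_uminus by simp
      then obtain x where "poly (P - [:t:]) x = 0" using alg_closed_imp_poly_has_root by blast
      then show ?thesis by (intro exI[of _ x]) simp
    qed
    then show ?thesis by (simp add: surj_def image_vimage_eq) (metis inf_top_right rangeI surj_def top_unique)
  qed
  fix t assume t: "t \<in> U"
  define E where "E = {x. poly P x = t}"
  have E: "finite E" "card E = degree P"
    using separable_fibre[OF n, of t] sep t unfolding E_def by auto
  have hol: "poly P holomorphic_on S" for S by (intro holomorphic_intros)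
  have "\<exists>r>0. inj_on (poly P) (ball x r)" if "x \<in> E" for x
  proof -
    have "poly (pderiv P) x \<noteq> 0" using sep that t unfolding E_def by blast
    then have "deriv (poly P) x \<noteq> 0" using DERIV_imp_deriv[OF poly_DERIV[of P x]] by simp
    from has_complex_derivative_locally_injective[OF hol[of UNIV] UNIV_I open_UNIV this] show ?thesis by blast
  qed
  then obtain r0 where r0: "\<And>x. x \<in> E \<Longrightarrow> r0 x > 0 \<and> inj_on (poly P) (ball x (r0 x))" by metis
  obtain \<rho> where \<rho>: "\<rho> > 0" "\<And>x y. x \<in> E \<Longrightarrow> y \<in> E \<Longrightarrow> x \<noteq> y \<Longrightarrow> dist x y \<ge> 2 * \<rho>" "\<And>x. x \<in> E \<Longrightarrow> \<rho> \<le> r0 x"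
  proof -
    define S where "S = insert 1 (r0 ` E \<union> (\<lambda>(x,y). dist x y / 2) ` {(x,y). x \<in> E \<and> y \<in> E \<and> x \<noteq> y})"
    have "{(x,y). x \<in> E \<and> y \<in> E \<and> x \<noteq> y} \<subseteq> E \<times> E" by auto
    then have fS: "finite S" unfolding S_def using E(1) by (meson finite_SigmaI finite_UnI finite_imageI finite_insert finite_subset)
    have 1: "Min S > 0" using fS r0 by (subst Min_gr_iff) (auto simp: S_def)
    have 2: "Min S \<le> s" if "s \<in> S" for s using fS that by simp
    show ?thesis
    proof (rule that[OF 1])
      show "2 * Min S \<le> dist x y" if "x \<in> E" "y \<in> E" "x \<noteq> y" for x y
      proof -
        have "dist x y / 2 \<in> S" using that unfolding S_def by (auto simp: image_iff)
        from 2[OF this] show ?thesis by simp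
      qed
      show "Min S \<le> r0 x" if "x \<in> E" for x using 2 that by (simp add: S_def)
    qed
  qed
  have inj: "inj_on (poly P) (ball x \<rho>)" if "x \<in> E" for x
    using r0[OF that] \<rho>(3)[OF that] by (meson inj_on_subset subset_ball)
  define T where "T = U \<inter> (\<Inter>x\<in>E. poly P ` ball x \<rho>)"
  have opT: "open T" unfolding T_def using E(1)
    by (intro open_Int open_INT U) (auto intro!: open_mapping_thm3 hol inj)
  define V where "V = (\<lambda>x. ball x \<rho> \<inter> poly P -` T) ` E"
  have opV: "open (ball x \<rho> \<inter> poly P -` T)" for x
    using opT by (intro continuous_open_preimage) (auto intro!: continuous_intros)
  have opPU: "open (poly P -` U)"
    using U continuous_open_vimage[of U "poly P"] by (simp add: continuous_on_eq_continuous_at)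
  have disj: "ball x \<rho> \<inter> ball y \<rho> = {}" if "x \<in> E" "y \<in> E" "x \<noteq> y" for x y
    using \<rho>(2)[OF that] by (intro disjoint_ballI) auto
  have TU: "T \<subseteq> U" by (auto simp: T_def)
  have cover: "poly P -` T \<subseteq> (\<Union>x\<in>E. ball x \<rho>)"
  proof
    fix y assume y: "y \<in> poly P -` T"
    let ?Y = "{z. poly P z = poly P y}"
    have "poly P y \<in> U" using y TU by blast
    then have Y: "finite ?Y" "card ?Y = degree P"
      using separable_fibre[OF n, of "poly P y"] sep by metis+
    have "\<forall>x\<in>E. \<exists>z\<in>ball x \<rho>. poly P z = poly P y" using y unfolding T_def by (auto simp: image_iff) metis
    then obtain f where f: "\<And>x. x \<in> E \<Longrightarrow> f x \<in> ball x \<rho> \<and> poly P (f x) = poly P y" by metis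
    have "inj_on f E" by (rule inj_onI) (metis disj disjoint_iff f)
    then have "card (f ` E) = card ?Y" using E Y by (simp add: card_image)
    moreover have "f ` E \<subseteq> ?Y" using f by auto
    ultimately have "f ` E = ?Y" using Y(1) card_subset_eq by blast
    then have "y \<in> f ` E" by blast
    then show "y \<in> (\<Union>x\<in>E. ball x \<rho>)" using f by auto
  qed
  show "\<exists>T. t \<in> T \<and> openin (top_of_set U) T \<and>
         (\<exists>v. \<Union> v = poly P -` U \<inter> poly P -` T \<and> (\<forall>u\<in>v. openin (top_of_set (poly P -` U)) u) \<and>
              disjoint v \<and> (\<forall>u\<in>v. \<exists>q. homeomorphism u T (poly P) q))"
  proof (intro exI[of _ T] conjI exI[of _ V] ballI)
    show "t \<in> T" using t \<rho>(1) by (force simp: T_def E_def)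
    show "openin (top_of_set U) T" using opT TU U by (simp add: openin_open_eq)
    show "\<Union> V = poly P -` U \<inter> poly P -` T" using cover TU unfolding V_def by auto
    show "disjoint V" unfolding V_def disjoint_def using disj by blast
    fix u assume u: "u \<in> V"
    then obtain x where x: "x \<in> E" "u = ball x \<rho> \<inter> poly P -` T" by (auto simp: V_def)
    have opu: "open u" using opV x by simp
    then show "openin (top_of_set (poly P -` U)) u"
      using opPU x(2) TU by (subst openin_open_eq) auto
    have inju: "inj_on (poly P) u" using inj[OF x(1)] x(2) by (meson Int_lower1 inj_on_subset)
    have img: "poly P ` u = T"
    proof
      show "T \<subseteq> poly P ` u"
      proof
        fix t' assume t': "t' \<in> T"
        then have "t' \<in> poly P ` ball x \<rho>" using x(1) by (auto simp: T_def)
        then show "t' \<in> poly P ` u" using t' x(2) by blast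
      qed
    qed (use x(2) in auto)
    show "\<exists>q. homeomorphism u T (poly P) q"
    proof -
      have "continuous_on u (poly P)" by (intro continuous_intros)
      from invariance_of_domain_homeomorphism[OF opu this order_refl inju]
      obtain q where "homeomorphism u (poly P ` u) (poly P) q" .
      then show ?thesis using img by auto
    qed
  qed
qed

text \<open>Away from all the discs every linear factor is at least the radius of its disc, so the
  factorization bounds \<open>norm (poly P x)\<close> below by \<open>\<eta>\<close>.\<close>

lemma poly_small_imp_near_root:
  fixes P :: "complex poly"
  assumes "P \<noteq> 0" and \<delta>: "\<And>c. poly P c = 0 \<Longrightarrow> \<delta> c > 0"
  obtains \<eta> where "\<eta> > 0" "\<And>x. norm (poly P x) < \<eta> \<Longrightarrow> \<exists>c. poly P c = 0 \<and> norm (x - c) < \<delta> c"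
proof -
  let ?Z = "{z. poly P z = 0}"
  have fin: "finite ?Z" using poly_roots_finite[OF \<open>P \<noteq> 0\<close>] .
  define \<eta> where "\<eta> = norm (lead_coeff P) * (\<Prod>z\<in>?Z. \<delta> z ^ order z P)"
  show ?thesis
  proof (rule that[of \<eta>])
    show "\<eta> > 0" unfolding \<eta>_def using assms by (intro mult_pos_pos prod_pos) auto
    fix x assume x: "norm (poly P x) < \<eta>"
    show "\<exists>c. poly P c = 0 \<and> norm (x - c) < \<delta> c"
    proof (rule ccontr)
      assume "\<not> ?thesis"
      then have far: "norm (x - c) \<ge> \<delta> c" if "c \<in> ?Z" for c using that by force
      have "poly P x = poly (smult (lead_coeff P) (\<Prod>z\<in>?Z. [:-z,1:] ^ order z P)) x"
        using complex_poly_decompose[of P] by simp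
      also have "norm \<dots> = norm (lead_coeff P) * (\<Prod>z\<in>?Z. norm (x - z) ^ order z P)"
        by (simp add: poly_prod norm_mult prod_norm[symmetric] norm_power)
      also have "\<dots> \<ge> \<eta>" unfolding \<eta>_def
      proof (intro mult_left_mono prod_mono conjI)
        fix z assume z: "z \<in> ?Z"
        show "0 \<le> \<delta> z ^ order z P" using \<delta>[of z] z by simp
        show "\<delta> z ^ order z P \<le> norm (x - z) ^ order z P"
          using far[OF z] \<delta>[of z] z by (intro power_mono) auto
      qed auto
      finally show False using x by simp
    qed
  qed
qed

text \<open>At one small \<open>t2\<close> the lift is close to some root \<open>c\<close> and hence
  of the form \<open>\<phi> c v\<close>. Both \<open>v\<close> and the positive root of
  \<open>t2\<close> have the power \<open>t2\<close>, so their ratio \<open>\<omega>\<close> is a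
  root of unity; uniqueness of lifts then propagates the formula with this fixed
  \<open>\<omega>\<close> to the whole interval.\<close>

lemma branch_at_zero:
  fixes P :: "complex poly" and x :: "real \<Rightarrow> complex"
  assumes n: "degree P > 0" and U: "open U" and posU: "\<And>t::real. t > 0 \<Longrightarrow> of_real t \<in> U"
    and sep: "\<And>x. poly P x \<in> U \<Longrightarrow> poly (pderiv P) x \<noteq> 0"
    and cont: "continuous_on {0<..} x" and lift: "\<And>t. t > 0 \<Longrightarrow> poly P (x t) = of_real t"
  obtains c r \<phi> \<omega> where "poly P c = 0" "r > 0" "\<phi> holomorphic_on ball 0 r" "\<phi> 0 = c"
    "deriv \<phi> 0 \<noteq> 0" "inj_on \<phi> (ball 0 r)" "\<omega> ^ order c P = 1"
    "\<And>w. w \<in> ball 0 r \<Longrightarrow> poly P (\<phi> w) = w ^ order c P"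
    "\<And>t. 0 < t \<Longrightarrow> t < r ^ order c P \<Longrightarrow> x t = \<phi> (\<omega> * of_real (root (order c P) t))"
proof -
  have P0: "P \<noteq> 0" using n by auto
  have "\<exists>r \<phi>. r > 0 \<and> \<phi> holomorphic_on ball 0 r \<and> \<phi> 0 = c \<and> inj_on \<phi> (ball 0 r) \<and>
    open (\<phi> ` ball 0 r) \<and> deriv \<phi> 0 \<noteq> 0 \<and> (\<forall>w. w \<in> ball 0 r \<longrightarrow> poly P (\<phi> w) = w ^ order c P)"
    if c: "poly P c = 0" for c
    by (rule local_root_parametrization[OF P0 c]) blast
  then obtain r \<phi> where *: "\<And>c. poly P c = 0 \<Longrightarrow> r c > 0 \<and> \<phi> c holomorphic_on ball 0 (r c) \<and> \<phi> c 0 = c \<and>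
    inj_on (\<phi> c) (ball 0 (r c)) \<and> open (\<phi> c ` ball 0 (r c)) \<and> deriv (\<phi> c) 0 \<noteq> 0 \<and>
    (\<forall>w. w \<in> ball 0 (r c) \<longrightarrow> poly P (\<phi> c w) = w ^ order c P)" by metis
  have "\<exists>\<delta>>0. ball c \<delta> \<subseteq> \<phi> c ` ball 0 (r c)" if "poly P c = 0" for c
  proof -
    have "c \<in> \<phi> c ` ball 0 (r c)" using *[OF that] by (metis centre_in_ball image_eqI)
    then show ?thesis using *[OF that] openE by metis
  qed
  then obtain \<delta> where \<delta>: "\<And>c. poly P c = 0 \<Longrightarrow> \<delta> c > 0 \<and> ball c (\<delta> c) \<subseteq> \<phi> c ` ball 0 (r c)" by metis
  obtain \<eta> where \<eta>: "\<eta> > 0" "\<And>x. norm (poly P x) < \<eta> \<Longrightarrow> \<exists>c. poly P c = 0 \<and> norm (x - c) < \<delta> c"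
    using poly_small_imp_near_root[OF P0, of \<delta>] \<delta> by metis
  define t2 where "t2 = \<eta> / 2"
  have t2: "t2 > 0" "norm (poly P (x t2)) < \<eta>" using \<eta>(1) by (auto simp: t2_def lift)
  obtain c where c: "poly P c = 0" "norm (x t2 - c) < \<delta> c" using \<eta>(2)[OF t2(2)] by blast
  have "x t2 \<in> ball c (\<delta> c)" using c(2) by (simp add: dist_norm norm_minus_commute)
  then obtain v where v: "v \<in> ball 0 (r c)" "x t2 = \<phi> c v" using \<delta>[OF c(1)] by blast
  let ?p = "order c P"
  have p: "?p > 0" using c(1) P0 order_root by blast
  have vp: "v ^ ?p = of_real t2" using *[OF c(1)] v lift[OF t2(1)] by metis
  define \<omega> where "\<omega> = v / of_real (root ?p t2)"
  have rp: "root ?p t > 0" "root ?p t ^ ?p = t" if "t > 0" for t using that p by (auto simp: real_root_pow_pos)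
  have "of_real (root ?p t2) ^ ?p = (of_real t2 :: complex)"
    using rp(2)[OF t2(1)] by (metis of_real_power)
  then have \<omega>p: "\<omega> ^ ?p = 1" using vp t2(1) by (simp add: \<omega>_def power_divide)
  then have n\<omega>: "norm \<omega> = 1" using p
    by (metis norm_ge_zero norm_one norm_power power_eq_imp_eq_base power_one zero_le_one)
  let ?g = "\<lambda>t. \<phi> c (\<omega> * of_real (root ?p t))"
  let ?T = "{0<..<r c ^ ?p}"
  have rpos: "r c > 0" using *[OF c(1)] by blast
  have inb: "\<omega> * of_real (root ?p t) \<in> ball 0 (r c)" if "t \<in> ?T" for t
  proof -
    have "root ?p t < root ?p (r c ^ ?p)" using that p by simp
    then have "root ?p t < r c" using rpos p by (simp add: real_root_power_cancel)
    then show ?thesis using that rp(1)[of t] by (simp add: norm_mult n\<omega>)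
  qed
  have t2T: "t2 \<in> ?T"
  proof -
    have "norm v < r c" using v(1) by simp
    then have "norm v ^ ?p < r c ^ ?p" using p by (intro power_strict_mono) auto
    then show ?thesis using vp t2(1) by (metis greaterThanLessThan_iff norm_of_real norm_power abs_of_pos)
  qed
  have eq: "x t = ?g t" if t: "t \<in> ?T" for t
  proof (rule covering_space_lift_unique[OF covering_space_poly[OF n U sep], of x t2 ?g ?T of_real t])
    have "v = \<omega> * of_real (root ?p t2)" using rp(1)[OF t2(1)] by (simp add: \<omega>_def)
    then show "x t2 = ?g t2" using v(2) by simp
    show "continuous_on ?T (of_real :: real \<Rightarrow> complex)" by (intro continuous_intros)
    show "of_real \<in> ?T \<rightarrow> U" using posU by auto
    show "continuous_on ?T x" by (rule continuous_on_subset[OF cont]) auto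
    show "x \<in> ?T \<rightarrow> poly P -` U" using lift posU by auto
    show "of_real t = poly P (x t)" if "t \<in> ?T" for t using lift that by auto
    have c1: "continuous_on (ball 0 (r c)) (\<phi> c)" using *[OF c(1)] holomorphic_on_imp_continuous_on by blast
    have c2: "continuous_on ?T (\<lambda>t. \<omega> * of_real (root ?p t))" by (intro continuous_intros)
    show "continuous_on ?T ?g"
      by (rule continuous_on_compose2[OF c1 c2]) (use inb in auto)
    show gl: "of_real t = poly P (?g t)" if "t \<in> ?T" for t
    proof -
      have "poly P (?g t) = (\<omega> * of_real (root ?p t)) ^ ?p" using *[OF c(1)] inb[OF that] by blast
      also have "\<dots> = of_real (root ?p t ^ ?p)" using \<omega>p by (simp add: power_mult_distrib)
      also have "root ?p t ^ ?p = t" using rp that by auto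
      finally show ?thesis by simp
    qed
    show "?g \<in> ?T \<rightarrow> poly P -` U" 
    proof
      fix t assume t: "t \<in> ?T"
      then have "poly P (?g t) \<in> U" using gl[OF t] posU[of t] by simp
      then show "?g t \<in> poly P -` U" by simp
    qed
    show "connected ?T" by simp
    show "t2 \<in> ?T" "t \<in> ?T" by fact+
  qed
  show ?thesis
    by (rule that[of c "r c" "\<phi> c" \<omega>]) (use *[OF c(1)] c(1) \<omega>p eq in auto)
qed

text \<open>The lifts exist on all of \<open>U\<close> because a convex set is simply connected, and
  each is determined by its value at the single point \<open>t1\<close>. Since
  \<open>\<psi> w\<close> behaves like \<open>\<kappa> / w\<close>, the index \<open>s\<close> is
  the cyclic position of the branch at infinity, counted clockwise.\<close>

lemma branches:
  fixes P :: "complex poly"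
  assumes n: "degree P = n" "n > 0" and U: "open U" "convex U" and posU: "\<And>t::real. t > 0 \<Longrightarrow> of_real t \<in> U"
    and sep: "\<And>x. poly P x \<in> U \<Longrightarrow> poly (pderiv P) x \<noteq> 0"
  obtains x \<psi> \<kappa> r T where
    "r > 0" "\<psi> holomorphic_on ball 0 r - {0}" "inj_on \<psi> (ball 0 r - {0})"
    "\<kappa> \<noteq> 0" "((\<lambda>w. w * \<psi> w) \<longlongrightarrow> \<kappa>) (at 0)"
    "\<And>w. w \<in> ball 0 r - {0} \<Longrightarrow> poly P (\<psi> w) = 1 / w ^ n"
    "\<And>s. s < n \<Longrightarrow> x s holomorphic_on U"
    "\<And>s t. s < n \<Longrightarrow> t \<in> U \<Longrightarrow> poly P (x s t) = t"
    "\<And>s s' t. s < n \<Longrightarrow> s' < n \<Longrightarrow> s \<noteq> s' \<Longrightarrow> t \<in> U \<Longrightarrow> x s t \<noteq> x s' t"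
    "T > 0" "\<And>s t. s < n \<Longrightarrow> t > T \<Longrightarrow> x s (of_real t) = \<psi> (cis (2 * pi * s / n) * of_real (1 / root n t))"
    "\<And>t. t > T \<Longrightarrow> 1 / root n t < r"
proof -
  have n0: "degree P > 0" using n by simp
  from root_at_infinity[OF n0, unfolded n(1)]
  obtain r \<psi> \<kappa> where \<psi>: "r > 0" "\<psi> holomorphic_on ball 0 r - {0}" "inj_on \<psi> (ball 0 r - {0})"
    "\<kappa> \<noteq> 0" "((\<lambda>w. w * \<psi> w) \<longlongrightarrow> \<kappa>) (at 0)"
    "\<And>w. w \<in> ball 0 r - {0} \<Longrightarrow> poly P (\<psi> w) = 1 / w ^ n" by blast
  have cov: "covering_space (poly P -` U) (poly P) U" by (rule covering_space_poly[OF n0 U(1) sep])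
  define T where "T = (1 / r) ^ n"
  have T: "T > 0" using \<psi>(1) by (simp add: T_def)
  have small: "1 / root n t < r" "root n t > 0" "root n t ^ n = t" if "t > T" for t
  proof -
    have t0: "t > 0" using that T by simp
    then show "root n t > 0" "root n t ^ n = t" using n by auto
    have "root n ((1 / r) ^ n) < root n t" using that n unfolding T_def by (intro real_root_less_mono) auto
    then have "1 / r < root n t" using real_root_power_cancel[of n "1 / r"] \<psi>(1) n(2) by simp
    then show "1 / root n t < r" using \<psi>(1) \<open>root n t > 0\<close> by (simp add: field_simps)
  qed
  let ?w = "\<lambda>s t. cis (2 * pi * real s / real n) * complex_of_real (1 / root n t)"
  have cisn: "cis (2 * pi * real s / real n) ^ n = 1" for s
  proof -
    have "cis (2 * pi * real s / real n) ^ n = cis (real n * (2 * pi * real s / real n))" by (rule Complex.DeMoivre)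
    also have "real n * (2 * pi * real s / real n) = 2 * pi * real s" using n(2) by simp
    finally show ?thesis using cis_multiple_2pi[of "real s"] by simp
  qed
  have win: "?w s t \<in> ball 0 r - {0}" if "t > T" for s t
    using small[OF that] by (auto simp: norm_mult norm_divide)
  have wP: "poly P (\<psi> (?w s t)) = of_real t" if "t > T" for s t
  proof -
    have "poly P (\<psi> (?w s t)) = 1 / (?w s t) ^ n" by (rule \<psi>(6)[OF win[OF that]])
    also have "(?w s t) ^ n = 1 / of_real (root n t ^ n)"
      using cisn by (simp add: power_mult_distrib power_divide)
    also have "\<dots> = 1 / of_real t" by (simp only: small(3)[OF that])
    finally show ?thesis by simp
  qed
  define t1 where "t1 = T + 1"
  have t1: "t1 > T" "t1 > 0" using T by (auto simp: t1_def)
  have "\<exists>g. continuous_on U g \<and> g \<in> U \<rightarrow> poly P -` U \<and> g (of_real t1) = \<psi> (?w s t1) \<and> (\<forall>y\<in>U. poly P (g y) = y)" for s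
  proof (rule covering_space_lift_strong[OF cov, of "\<psi> (?w s t1)" "of_real t1" U "\<lambda>y. y"])
    show "\<psi> (?w s t1) \<in> poly P -` U" using wP[OF t1(1)] posU[OF t1(2)] by simp
    show "simply_connected U" using U(2) by (rule convex_imp_simply_connected)
    show "locally path_connected U" using U by (simp add: open_imp_locally_path_connected)
  qed (use posU[OF t1(2)] wP[OF t1(1)] in auto)
  then obtain x where x: "\<And>s. continuous_on U (x s)" "\<And>s. x s \<in> U \<rightarrow> poly P -` U"
    "\<And>s. x s (of_real t1) = \<psi> (?w s t1)" "\<And>s y. y \<in> U \<Longrightarrow> poly P (x s y) = y" by metis
  have opC: "open (poly P -` U)"
    using U(1) by (intro continuous_open_vimage) auto
  show ?thesis
  proof (rule that[OF \<psi>])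
    show "x s holomorphic_on U" for s
      by (rule covering_space_lift_is_holomorphic[OF cov opC, where f = "\<lambda>y. y"])
         (use x in \<open>auto intro!: holomorphic_intros\<close>)
    show "poly P (x s t) = t" if "t \<in> U" for s t using x(4) that by blast
    show "x s t \<noteq> x s' t" if s: "s < n" "s' < n" "s \<noteq> s'" and t: "t \<in> U" for s s' t
    proof
      assume eq: "x s t = x s' t"
      have "x s (of_real t1) = x s' (of_real t1)"
        by (rule covering_space_lift_unique[OF cov, where ?g1.0 = "x s" and ?g2.0 = "x s'" and a = t
              and T = U and f = "\<lambda>y. y", OF eq])
           (use x posU[OF t1(2)] t U in \<open>auto intro: convex_connected\<close>)
      then have "?w s t1 = ?w s' t1" using x(3) inj_onD[OF \<psi>(3) _ win[OF t1(1)] win[OF t1(1)]] by metis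
      then have "cis (2 * pi * real s / real n) = cis (2 * pi * real s' / real n)"
        using small(2)[OF t1(1)] by simp
      then show False
        using inj_onD[OF bij_betw_imp_inj_on[OF Complex.bij_betw_roots_unity[OF n(2)]], of s s'] s by auto
    qed
    show "T > 0" by fact
    show "x s (of_real t) = \<psi> (?w s t)" if "t > T" for s t
    proof (rule covering_space_lift_unique[OF cov, of "\<lambda>t. x s (of_real t)" t1 "\<lambda>t. \<psi> (?w s t)" "{T<..}" of_real t])
      show "x s (of_real t1) = \<psi> (?w s t1)" by (rule x(3))
      show "continuous_on {T<..} (of_real :: real \<Rightarrow> complex)" by (intro continuous_intros)
      show "of_real \<in> {T<..} \<rightarrow> U" using posU T by auto
      show "continuous_on {T<..} (\<lambda>t. x s (of_real t))"
        by (rule continuous_on_compose2[OF x(1)]) (use posU T in \<open>auto intro!: continuous_intros\<close>)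
      show "(\<lambda>t. x s (of_real t)) \<in> {T<..} \<rightarrow> poly P -` U" using x(4) posU T by auto
      show "of_real t = poly P (x s (of_real t))" if "t \<in> {T<..}" for t using x(4) posU T that by auto
      show "of_real t = poly P (\<psi> (?w s t))" if "t \<in> {T<..}" for t using wP that by auto
      show "(\<lambda>t. \<psi> (?w s t)) \<in> {T<..} \<rightarrow> poly P -` U" using wP posU T by auto
      have c1: "continuous_on (ball 0 r - {0}) \<psi>" using \<psi>(2) holomorphic_on_imp_continuous_on by blast
      have c2: "continuous_on {T<..} (?w s)"
        by (intro continuous_intros) (use small(2) n in force)+
      show "continuous_on {T<..} (\<lambda>t. \<psi> (?w s t))"
        by (rule continuous_on_compose2[OF c1 c2]) (use win in auto)
    qed (use that t1 in auto)
    show "1 / root n t < r" if "t > T" for t using small that by blast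
  qed
qed

section \<open>The relation between branches\<close>

text \<open>Continue the relation to the two lifts \<open>v\<close> of a negative number \<open>v^4\<close> in the right
  half-plane; there the logarithms differ while \<open>A\<close> and \<open>B\<close> take the same values.\<close>
lemma log_independent:
  assumes A: "A holomorphic_on ball 0 \<rho>" and B: "B holomorphic_on ball 0 \<rho>" and "\<rho> > 0"
    and eq: "\<And>u. 0 < u \<Longrightarrow> u < \<rho> \<Longrightarrow> A (of_real u) = of_real (ln u) * B (of_real u)"
    and z: "z \<in> ball 0 \<rho>"
  shows "B z = 0"
proof -
  define \<sigma> where "\<sigma> = min 1 \<rho>"
  have \<sigma>: "0 < \<sigma>" "\<sigma> \<le> 1" "\<sigma> \<le> \<rho>" using \<open>\<rho> > 0\<close> by (auto simp: \<sigma>_def)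
  have small: "r ^ 4 < \<rho>" if "0 \<le> r" "r < \<sigma>" for r :: real
    using power_le_one_iff[of r 4] power_decreasing[of 1 4 r] that \<sigma> by simp
  let ?H = "ball (0::complex) \<sigma> \<inter> {v. Re v > 0}"
  have v4: "v ^ 4 \<in> ball 0 \<rho>" if "v \<in> ?H" for v
    using small[of "norm v"] that by (auto simp: norm_power)
  \<comment> \<open>For positive real \<open>v\<close>, \<open>4 * Ln v\<close> is the logarithm of
    \<open>v ^ 4\<close>. Fourth powers are used because square roots of a negative number lie on
    the boundary of the half-plane, whereas fourth roots with angles \<open>pi / 4\<close> and
    \<open>- pi / 4\<close> lie inside.\<close>
  define F where "F = (\<lambda>v::complex. A (v ^ 4) - 4 * Ln v * B (v ^ 4))"
  have comp: "(\<lambda>v. G (v ^ 4)) holomorphic_on ?H" if "G holomorphic_on ball 0 \<rho>" for G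
  proof -
    have "(\<lambda>v::complex. v ^ 4) holomorphic_on ?H" by (intro holomorphic_intros)
    moreover have "(\<lambda>v. v ^ 4) ` ?H \<subseteq> ball 0 \<rho>" using v4 by blast
    ultimately show ?thesis using holomorphic_on_compose_gen[OF _ that] by (auto simp: o_def)
  qed
  have hF: "F holomorphic_on ?H"
    unfolding F_def by (intro holomorphic_intros comp A B) (auto simp: complex_nonpos_Reals_iff)
  have oH: "open ?H" by (intro open_Int open_ball open_halfspace_Re_gt)
  have cH: "connected ?H"
    by (intro convex_connected convex_Int convex_ball convex_halfspace_Re_gt)
  let ?R = "of_real ` {0<..<\<sigma>} :: complex set"
  have F0: "F v = 0" if "v \<in> ?H" for v
  proof (rule analytic_continuation[OF hF oH cH, of ?R "of_real (\<sigma> / 2)"])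
    show "?R \<subseteq> ?H" "of_real (\<sigma> / 2) \<in> ?H" using \<sigma> by auto
    have "\<sigma> / 2 islimpt {0<..<\<sigma>}" using \<sigma> by (intro open_imp_islimpt) auto
    then show "complex_of_real (\<sigma> / 2) islimpt ?R"
    proof (rule islimpt_isCont_image)
      show "\<forall>\<^sub>F y in at (\<sigma> / 2). complex_of_real y \<noteq> complex_of_real (\<sigma> / 2)"
        unfolding of_real_eq_iff by (simp add: eventually_at_filter)
    qed (intro continuous_intros)
    fix v assume "v \<in> ?R"
    then obtain u where u: "v = of_real u" "0 < u" "u < \<sigma>" by auto
    have "A (of_real (u ^ 4)) = of_real (ln (u ^ 4)) * B (of_real (u ^ 4))"
      using small[of u] u by (intro eq) auto
    then show "F v = 0" using u by (simp add: F_def Ln_of_real ln_realpow)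
  qed (use that in auto)
  have Bneg: "B (- of_real (r ^ 4)) = 0" if r: "0 < r" "r < \<sigma>" for r :: real
  proof -
    have e: "(of_real r * cis (pi / 4)) ^ 4 = - complex_of_real (r ^ 4)"
      "(of_real r * cis (- pi / 4)) ^ 4 = - complex_of_real (r ^ 4)"
      by (simp_all add: power_mult_distrib Complex.DeMoivre complex_eq_iff)
    have H: "of_real r * cis (pi / 4) \<in> ?H" "of_real r * cis (- pi / 4) \<in> ?H"
      using r by (auto simp: norm_mult cos_45 cos_minus)
    have L: "Ln (of_real r * cis t) = of_real (ln r) + \<i> * t" if "\<bar>t\<bar> < pi" for t
    proof -
      have "of_real r * cis t = exp (of_real (ln r) + \<i> * t)"
        using r by (simp add: exp_add cis_conv_exp exp_of_real[symmetric] flip: of_real_exp)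
      then show ?thesis using that by (simp add: Ln_exp)
    qed
    have "F (of_real r * cis (pi / 4)) = 0" "F (of_real r * cis (- pi / 4)) = 0" using F0 H by blast+
    then have "4 * (of_real (ln r) + \<i> * (pi / 4)) * B (- of_real (r ^ 4)) = 
         4 * (of_real (ln r) + \<i> * (- pi / 4)) * B (- of_real (r ^ 4))"
      using L[of "pi/4"] L[of "- pi/4"] unfolding F_def e by simp
    then have "2 * \<i> * pi * B (- of_real (r ^ 4)) = 0" by (simp add: algebra_simps)
    then show ?thesis by simp
  qed
  let ?N = "(\<lambda>r. - complex_of_real (r ^ 4)) ` {0<..<\<sigma>}"
  show ?thesis
  proof (rule analytic_continuation[OF B open_ball connected_ball, of ?N "- of_real ((\<sigma>/2) ^ 4)"])
    show "?N \<subseteq> ball 0 \<rho>" using small by (auto simp: norm_power less_imp_le)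
    show "- of_real ((\<sigma>/2) ^ 4) \<in> ball (0::complex) \<rho>" using small[of "\<sigma>/2"] \<sigma> by (auto simp: norm_power)
    have "\<sigma> / 2 islimpt {0<..<\<sigma>}" using \<sigma> by (intro open_imp_islimpt) auto
    then show "- complex_of_real ((\<sigma>/2) ^ 4) islimpt ?N"
    proof (rule islimpt_isCont_image)
      show "isCont (\<lambda>r. - complex_of_real (r ^ 4)) (\<sigma> / 2)" by (intro continuous_intros)
      have "\<forall>\<^sub>F y in at (\<sigma> / 2). y > 0" using \<sigma> by (intro order_tendstoD(1)[OF tendsto_ident_at]) auto
      then have "\<forall>\<^sub>F y in at (\<sigma> / 2). y > 0 \<and> y \<noteq> \<sigma> / 2"
        by (intro eventually_conj) (auto simp: eventually_at_filter)
      then show "\<forall>\<^sub>F y in at (\<sigma> / 2). - complex_of_real (y ^ 4) \<noteq> - complex_of_real ((\<sigma> / 2) ^ 4)"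
      proof eventually_elim
        case (elim y)
        then show ?case using \<sigma> power_eq_imp_eq_base[of y 4 "\<sigma>/2"] by (auto simp flip: of_real_power)
      qed
    qed
  qed (use Bneg z in auto)
qed

text \<open>The difference of the two functions takes values in the integer multiples of 2 pi i, a
  discrete set, so it is constant on a connected set.\<close>

lemma continuous_logs_differ_by_constant:
  fixes f g :: "real \<Rightarrow> complex"
  assumes "connected S" "continuous_on S f" "continuous_on S g" "\<And>x. x \<in> S \<Longrightarrow> exp (f x) = exp (g x)"
  obtains k where "exp k = 1" "\<And>x. x \<in> S \<Longrightarrow> f x = g x + k"
proof -
  have "(\<lambda>x. f x - g x) constant_on S"
  proof (rule continuous_discrete_range_constant[OF assms(1)])
    show "continuous_on S (\<lambda>x. f x - g x)" using assms by (intro continuous_intros)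
    fix x assume x: "x \<in> S"
    show "\<exists>e>0. \<forall>y. y \<in> S \<and> f y - g y \<noteq> f x - g x \<longrightarrow> e \<le> norm (f y - g y - (f x - g x))"
    proof (intro exI[of _ "2*pi"] conjI allI impI)
      fix y assume y: "y \<in> S \<and> f y - g y \<noteq> f x - g x"
      have "exp (f y - g y - (f x - g x)) = 1" using assms(4) x y by (simp add: exp_diff)
      then obtain m :: int where m: "Im (f y - g y - (f x - g x)) = of_int (2 * m) * pi" 
         "Re (f y - g y - (f x - g x)) = 0" unfolding exp_eq_1 by blast
      then have "m \<noteq> 0" using y by (auto simp: complex_eq_iff)
      then have "2 * pi \<le> \<bar>of_int (2 * m) * pi\<bar>" by (simp add: abs_mult)
      also have "\<dots> \<le> norm (f y - g y - (f x - g x))" unfolding m(1)[symmetric] by (rule abs_Im_le_cmod)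
      finally show "2 * pi \<le> norm (f y - g y - (f x - g x))" .
    qed auto
  qed
  then obtain k where k: "\<And>x. x \<in> S \<Longrightarrow> f x - g x = k" by (auto simp: constant_on_def)
  show ?thesis
  proof (cases "S = {}")
    case True then show ?thesis using that[of 0] by auto
  next
    case False
    then obtain x where x: "x \<in> S" by blast
    have "exp (f x - g x) = 1" using assms(4)[OF x] by (simp add: exp_diff)
    then have "exp k = 1" using k[OF x] by simp
    then show ?thesis using that[of k] k by (auto simp: algebra_simps)
  qed
qed

section \<open>Cauchy transforms of polynomials along the segment, and moments\<close>

lemma poly_antiderivative:
  fixes G :: "'a :: field_char_0 poly"
  obtains F where "pderiv F = G"
proof -
  define F where "F = (\<Sum>i\<le>degree G. monom (coeff G i / of_nat (Suc i)) (Suc i))"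
  have "coeff F (Suc i) = coeff G i / of_nat (Suc i)" for i
  proof -
    have "coeff F (Suc i) = (\<Sum>j\<le>degree G. if j = i then coeff G j / of_nat (Suc j) else 0)"
      unfolding F_def coeff_sum by (intro sum.cong) auto
    then show ?thesis by (auto simp: coeff_eq_0 simp del: of_nat_Suc)
  qed
  then have "pderiv F = G" by (intro poly_eqI) (simp add: coeff_pderiv del: of_nat_Suc)
  then show ?thesis using that by blast
qed

lemma contour_integral_poly:
  assumes "pderiv F = G"
  shows "contour_integral (linepath a b) (poly G) = poly F b - poly F a"
  using contour_integral_primitive[of UNIV "poly F" "poly G" "linepath a b"] poly_DERIV[of F] assms
  by (auto intro!: contour_integral_unique intro: DERIV_subset)

text \<open>The quotient (Q(z) - Q(y)) / (z - y) is a polynomial in both variables, so its integral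
  over \<open>z\<close> is a polynomial \<open>D\<close> in \<open>y\<close>. The induction along
  the coefficients uses z Q(z) / (z - y) = Q(z) + y Q(z) / (z - y).\<close>

lemma cauchy_transform_poly:
  obtains D :: "complex poly" where
    "\<And>y. y \<notin> closed_segment a b \<Longrightarrow> contour_integral (linepath a b) (\<lambda>z. poly Q z / (z - y)) =
       poly D y + poly Q y * contour_integral (linepath a b) (\<lambda>z. 1 / (z - y))"
proof -
  have "\<exists>D. \<forall>y. y \<notin> closed_segment a b \<longrightarrow> contour_integral (linepath a b) (\<lambda>z. poly Q z / (z - y)) =
       poly D y + poly Q y * contour_integral (linepath a b) (\<lambda>z. 1 / (z - y))"
  proof (induction Q)
    case 0
    show ?case by (rule exI[of _ 0]) simp
  next
    case (pCons c Q)
    then obtain D where D: "\<And>y. y \<notin> closed_segment a b \<Longrightarrow> contour_integral (linepath a b) (\<lambda>z. poly Q z / (z - y)) =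
       poly D y + poly Q y * contour_integral (linepath a b) (\<lambda>z. 1 / (z - y))" by blast
    show ?case
    proof (intro exI[of _ "[:contour_integral (linepath a b) (poly Q):] + [:0,1:] * D"] allI impI)
      fix y assume y: "y \<notin> closed_segment a b"
      have ci: "(\<lambda>z. 1 / (z - y)) contour_integrable_on linepath a b"
        "(\<lambda>z. poly Q z / (z - y)) contour_integrable_on linepath a b"
        "poly Q contour_integrable_on linepath a b"
        by (auto intro!: contour_integrable_continuous_linepath continuous_intros) (use y in auto)
      have "contour_integral (linepath a b) (\<lambda>z. poly (pCons c Q) z / (z - y)) =
        contour_integral (linepath a b) (\<lambda>z. c * (1 / (z - y)) + (poly Q z + y * (poly Q z / (z - y))))"
      proof (rule contour_integral_eq)
        fix z assume "z \<in> path_image (linepath a b)"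
        then have "z - y \<noteq> 0" using y by auto
        then show "poly (pCons c Q) z / (z - y) = c * (1 / (z - y)) + (poly Q z + y * (poly Q z / (z - y)))"
          by (simp add: divide_simps) (simp add: algebra_simps)
      qed
      also have "\<dots> = c * contour_integral (linepath a b) (\<lambda>z. 1 / (z - y)) +
        (contour_integral (linepath a b) (poly Q) + y * contour_integral (linepath a b) (\<lambda>z. poly Q z / (z - y)))"
        using ci by (simp add: contour_integral_add contour_integral_lmul contour_integrable_add contour_integrable_lmul
              del: times_divide_eq_right)
      finally show "contour_integral (linepath a b) (\<lambda>z. poly (pCons c Q) z / (z - y)) =
        poly ([:contour_integral (linepath a b) (poly Q):] + [:0,1:] * D) y +
        poly (pCons c Q) y * contour_integral (linepath a b) (\<lambda>z. 1 / (z - y))"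
        unfolding D[OF y] by (simp add: algebra_simps)
    qed
  qed
  then show ?thesis using that by blast
qed

text \<open>If \<open>y\<close> is farther from \<open>a\<close> than \<open>b\<close> is, then (z -
  y) / (a - y) stays within distance 1 of 1 along the segment, so its principal logarithm is a
  primitive of 1 / (z - y).\<close>

lemma cauchy_transform_one:
  assumes far: "norm (b - a) < norm (y - a)"
  shows "y \<notin> closed_segment a b"
    and "contour_integral (linepath a b) (\<lambda>z. 1 / (z - y)) = Ln ((b - y) / (a - y))"
    and "(b - y) / (a - y) \<notin> \<real>\<^sub>\<le>\<^sub>0"
proof -
  have ya: "a - y \<noteq> 0" using far by auto
  have seg: "norm (z - a) < norm (y - a)" if "z \<in> closed_segment a b" for z
    using segment_bound(1)[OF that] far by simp
  then show "y \<notin> closed_segment a b" by blast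
  have np: "(z - y) / (a - y) \<notin> \<real>\<^sub>\<le>\<^sub>0" if "z \<in> closed_segment a b" for z
  proof -
    have "norm ((z - y) / (a - y) - 1) = norm (z - a) / norm (y - a)"
      using ya by (simp add: diff_divide_eq_iff norm_divide norm_minus_commute)
    also have "\<dots> < 1" using seg[OF that] by (simp add: divide_less_eq_1) 
    finally have "Re ((z - y) / (a - y)) > 0"
      using abs_Re_le_cmod[of "(z - y) / (a - y) - 1"] by simp
    then show ?thesis by (auto simp: complex_nonpos_Reals_iff)
  qed
  from np[of b] show "(b - y) / (a - y) \<notin> \<real>\<^sub>\<le>\<^sub>0" by simp
  have "((\<lambda>z. Ln ((z - y) / (a - y))) has_field_derivative 1 / (z - y)) (at z within closed_segment a b)"
    if "z \<in> closed_segment a b" for z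
  proof -
    have "z - y \<noteq> 0" using seg[OF that] by auto
    then have "1 / (z - y) = 1 / (a - y) / ((z - y) / (a - y))" using ya by simp
    moreover have "((\<lambda>z. Ln ((z - y) / (a - y))) has_field_derivative 1 / (a - y) / ((z - y) / (a - y)))
        (at z within closed_segment a b)"
      by (rule derivative_eq_intros np[OF that] refl | use ya in simp)+
    ultimately show ?thesis by (simp only:)
  qed
  then have "((\<lambda>z. 1 / (z - y)) has_contour_integral Ln ((b - y) / (a - y)) - Ln ((a - y) / (a - y))) (linepath a b)"
    using contour_integral_primitive[of "closed_segment a b" "\<lambda>z. Ln ((z - y) / (a - y))" _ "linepath a b"] by simp
  then show "contour_integral (linepath a b) (\<lambda>z. 1 / (z - y)) = Ln ((b - y) / (a - y))"
    using contour_integral_unique ya by fastforce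
qed

text \<open>The integrals of \<open>P ^ k\<close> against dQ from \<open>a\<close> to
  \<open>b\<close>, expressed through primitives: no path enters, which makes the substitution of an
  inner polynomial immediate.\<close>

definition moments_vanish :: "complex poly \<Rightarrow> complex poly \<Rightarrow> complex \<Rightarrow> complex \<Rightarrow> bool" where
  "moments_vanish P Q a b \<longleftrightarrow> (\<forall>k F. pderiv F = P ^ k * pderiv Q \<longrightarrow> poly F a = poly F b)"

text \<open>Since \<open>P\<close> vanishes at both endpoints, integration by parts turns the
  integral of Q P' P^k into a multiple of a moment, hence into 0. So the terms of the geometric
  expansion of 1 / (P - t) in powers of \<open>P / t\<close> contribute nothing, and the remainder
  after \<open>N\<close> terms is of order (1/2)^N.\<close>

lemma moments_vanish_generating:
  assumes Pab: "poly P a = 0" "poly P b = 0" and mom: "moments_vanish P Q a b"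
    and B: "\<And>z. z \<in> closed_segment a b \<Longrightarrow> norm (poly P z) \<le> B" and t: "2 * B < norm t"
  shows "contour_integral (linepath a b) (\<lambda>z. poly Q z * poly (pderiv P) z / (poly P z - t)) = 0" (is "?J = 0")
proof -
  have B0: "B \<ge> 0" using B[of a] Pab by simp
  have t0: "t \<noteq> 0" "norm t > 0" using t B0 by auto
  have Pt: "norm (poly P z - t) \<ge> norm t / 2" if "z \<in> closed_segment a b" for z
    using B[OF that] t norm_triangle_ineq2[of t "poly P z"] by (simp add: norm_minus_commute)
  then have nz: "poly P z - t \<noteq> 0" if "z \<in> closed_segment a b" for z using that t0 by force
  have I0: "contour_integral (linepath a b) (poly (Q * pderiv P * P ^ k)) = 0" for k
  proof -
    obtain F where F: "pderiv F = P ^ Suc k * pderiv Q" using poly_antiderivative by blast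
    have Fab: "poly F a = poly F b" using mom F unfolding moments_vanish_def by blast
    have "pderiv (Q * P ^ Suc k - F) = smult (of_nat (Suc k)) (Q * pderiv P * P ^ k)"
      by (simp only: pderiv_diff pderiv_mult pderiv_power_Suc F) (simp add: algebra_simps)
    then have "pderiv (smult (1 / of_nat (Suc k)) (Q * P ^ Suc k - F)) = Q * pderiv P * P ^ k"
      by (simp add: pderiv_smult del: of_nat_Suc)
    from contour_integral_poly[OF this] Pab Fab show ?thesis by simp
  qed
  have cint: "f contour_integrable_on linepath a b" if "continuous_on (closed_segment a b) f" for f
    using that by (rule contour_integrable_continuous_linepath)
  have J: "?J = contour_integral (linepath a b) (\<lambda>z. poly (Q * pderiv P) z * (poly P z / t) ^ N / (poly P z - t))" for N
  proof (induction N)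
    case (Suc N)
    have "contour_integral (linepath a b) (\<lambda>z. poly (Q * pderiv P) z * (poly P z / t) ^ N / (poly P z - t)) =
      contour_integral (linepath a b) (\<lambda>z. poly (Q * pderiv P) z * (poly P z / t) ^ Suc N / (poly P z - t)
         - (1 / t ^ Suc N) * poly (Q * pderiv P * P ^ N) z)"
    proof (rule contour_integral_eq)
      fix z assume "z \<in> path_image (linepath a b)"
      then have "poly P z - t \<noteq> 0" using nz by simp
      then show "poly (Q * pderiv P) z * (poly P z / t) ^ N / (poly P z - t) =
        poly (Q * pderiv P) z * (poly P z / t) ^ Suc N / (poly P z - t) - (1 / t ^ Suc N) * poly (Q * pderiv P * P ^ N) z"
        using t0 by (simp add: field_simps power_divide)
    qed
    also have "\<dots> = contour_integral (linepath a b) (\<lambda>z. poly (Q * pderiv P) z * (poly P z / t) ^ Suc N / (poly P z - t))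
         - contour_integral (linepath a b) (\<lambda>z. (1 / t ^ Suc N) * poly (Q * pderiv P * P ^ N) z)"
      by (rule contour_integral_diff; rule cint) (use nz t0 in \<open>auto intro!: continuous_intros\<close>)
    also have "contour_integral (linepath a b) (\<lambda>z. (1 / t ^ Suc N) * poly (Q * pderiv P * P ^ N) z) = 0"
      by (subst contour_integral_lmul) (auto intro!: cint continuous_intros simp: I0 simp del: poly_mult)
    finally show ?case using Suc by simp
  qed simp
  obtain C where C: "C > 0" "\<And>z. z \<in> closed_segment a b \<Longrightarrow> norm (poly (Q * pderiv P) z) \<le> C"
  proof -
    have "compact (poly (Q * pderiv P) ` closed_segment a b)"
      by (intro compact_continuous_image continuous_intros) auto
    then show ?thesis using that compact_imp_bounded bounded_pos by (metis image_eqI)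
  qed
  have "norm ?J \<le> C * (1/2) ^ N / (norm t / 2) * norm (b - a)" for N
    unfolding J[of N]
  proof (rule contour_integral_bound_linepath)
    show "(\<lambda>z. poly (Q * pderiv P) z * (poly P z / t) ^ N / (poly P z - t)) contour_integrable_on linepath a b"
      by (rule cint) (use nz t0 in \<open>auto intro!: continuous_intros\<close>)
    show "0 \<le> C * (1/2) ^ N / (norm t / 2)" using C(1) by simp
    fix z assume z: "z \<in> closed_segment a b"
    have "norm (poly P z / t) \<le> 1 / 2" using B[OF z] t t0 by (simp add: norm_divide field_simps)
    then have "norm (poly P z / t) ^ N \<le> (1/2) ^ N" by (intro power_mono) auto
    then show "norm (poly (Q * pderiv P) z * (poly P z / t) ^ N / (poly P z - t)) \<le> C * (1/2) ^ N / (norm t / 2)"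
      unfolding norm_divide norm_mult norm_power
      using C(2)[OF z] Pt[OF z] t0 C(1) by (intro frac_le mult_mono) (auto simp: norm_divide)
  qed
  then have le: "norm ?J \<le> (C / (norm t / 2) * norm (b - a)) * (1/2) ^ N" for N by (simp add: field_simps)
  have "(\<lambda>N. (C / (norm t / 2) * norm (b - a)) * (1/2) ^ N) \<longlonglongrightarrow> (C / (norm t / 2) * norm (b - a)) * 0"
    by (intro tendsto_intros LIMSEQ_power_zero) auto
  then have "norm ?J \<le> 0" by (intro LIMSEQ_le_const) (use le in auto)
  then show ?thesis by simp
qed

text \<open>The logarithmic derivative of \<open>P - t\<close> is the sum of the simple fractions 1
  / (z - x_s) over the fibre; this splits the generating integral into Cauchy transforms of
  \<open>Q\<close>.\<close>

lemma fibre_sum_contour_integral_eq_0: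
  fixes P Q :: "complex poly" and x :: "nat \<Rightarrow> complex"
  assumes n: "degree P = n" "n > 0" and Pab: "poly P a = 0" "poly P b = 0" and mom: "moments_vanish P Q a b"
    and B: "\<And>z. z \<in> closed_segment a b \<Longrightarrow> norm (poly P z) \<le> B" and t: "2 * B < norm t"
    and x: "\<And>s. s < n \<Longrightarrow> poly P (x s) = t" and inj: "inj_on x {..<n}"
    and sep: "\<And>x. poly P x = t \<Longrightarrow> poly (pderiv P) x \<noteq> 0"
  shows "(\<Sum>s<n. contour_integral (linepath a b) (\<lambda>z. poly Q z / (z - x s))) = 0"
    and "\<And>s. s < n \<Longrightarrow> x s \<notin> closed_segment a b"
proof -
  have B0: "B \<ge> 0" using B[of a] Pab by simp
  show off: "x s \<notin> closed_segment a b" if "s < n" for s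
  proof
    assume "x s \<in> closed_segment a b"
    from B[OF this] x[OF that] t B0 show False by simp
  qed
  have n0: "degree P > 0" using n by simp
  have fib: "{x. poly P x = t} = x ` {..<n}"
  proof (rule card_subset_eq[symmetric])
    show "finite {x. poly P x = t}" using separable_fibre(2)[OF n0 sep] by simp
    show "card (x ` {..<n}) = card {x. poly P x = t}"
      using separable_fibre(3)[OF n0 sep] inj n by (simp add: card_image)
  qed (use x in auto)
  have fac: "P - [:t:] = smult (lead_coeff P) (\<Prod>s<n. [:- x s, 1:])"
    using separable_fibre(1)[OF n0 sep] fib inj by (simp add: prod.reindex)
  have pfac: "poly P z - t = lead_coeff P * (\<Prod>s<n. z - x s)" for z
    using arg_cong[OF fac, of "\<lambda>p. poly p z"] by (simp add: poly_prod)
  have "pderiv (P - [:t:]) = smult (lead_coeff P) (\<Sum>s<n. prod (\<lambda>s. [:- x s, 1:]) ({..<n} - {s}))"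
    unfolding fac by (simp add: pderiv_smult pderiv_prod pderiv_pCons)
  then have dfac: "poly (pderiv P) z = lead_coeff P * (\<Sum>s<n. \<Prod>s'\<in>{..<n} - {s}. z - x s')" for z
    by (simp add: pderiv_diff pderiv_pCons poly_sum poly_prod)
  have frac: "poly (pderiv P) z / (poly P z - t) = (\<Sum>s<n. 1 / (z - x s))" if "z \<in> closed_segment a b" for z
  proof -
    have nz: "z - x s \<noteq> 0" if "s < n" for s using off[OF that] \<open>z \<in> closed_segment a b\<close> by auto
    have P1: "(\<Prod>s'<n. z - x s') = (z - x s) * (\<Prod>s'\<in>{..<n} - {s}. z - x s')" if "s < n" for s
      using that by (subst prod.remove[of _ s]) auto
    have lc: "lead_coeff P \<noteq> 0" using n0 by auto
    have "poly (pderiv P) z / (poly P z - t) = (\<Sum>s<n. (\<Prod>s'\<in>{..<n} - {s}. z - x s') / (\<Prod>s'<n. z - x s'))"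
      unfolding pfac dfac using lc by (simp add: sum_divide_distrib)
    also have "\<dots> = (\<Sum>s<n. 1 / (z - x s))"
    proof (rule sum.cong[OF refl])
      fix s assume "s \<in> {..<n}"
      then have s: "s < n" by simp
      have "(\<Prod>s'\<in>{..<n} - {s}. z - x s') \<noteq> 0" using nz by (simp add: prod_zero_iff)
      then show "(\<Prod>s'\<in>{..<n} - {s}. z - x s') / (\<Prod>s'<n. z - x s') = 1 / (z - x s)"
        unfolding P1[OF s] by simp
    qed
    finally show ?thesis .
  qed
  have "0 = contour_integral (linepath a b) (\<lambda>z. poly Q z * poly (pderiv P) z / (poly P z - t))"
    using moments_vanish_generating[OF Pab mom B t] by simp
  also have "\<dots> = contour_integral (linepath a b) (\<lambda>z. \<Sum>s<n. poly Q z / (z - x s))"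
  proof (rule contour_integral_eq)
    fix z assume "z \<in> path_image (linepath a b)"
    then have z: "z \<in> closed_segment a b" by simp
    have "poly Q z * poly (pderiv P) z / (poly P z - t) = poly Q z * (poly (pderiv P) z / (poly P z - t))" by simp
    also have "\<dots> = (\<Sum>s<n. poly Q z / (z - x s))" unfolding frac[OF z] by (simp add: sum_distrib_left)
    finally show "poly Q z * poly (pderiv P) z / (poly P z - t) = (\<Sum>s<n. poly Q z / (z - x s))" .
  qed
  also have "\<dots> = (\<Sum>s<n. contour_integral (linepath a b) (\<lambda>z. poly Q z / (z - x s)))"
    by (intro contour_integral_sum) (use off in \<open>auto intro!: contour_integrable_continuous_linepath continuous_intros\<close>)
  finally show "(\<Sum>s<n. contour_integral (linepath a b) (\<lambda>z. poly Q z / (z - x s))) = 0" by simp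
qed

text \<open>The exponent of \<open>1 / t\<close> in \<open>(b - x t) / (a - x t)\<close> along a branch starting at the root \<open>c\<close>.\<close>
definition log_weight :: "complex poly \<Rightarrow> complex \<Rightarrow> complex \<Rightarrow> complex \<Rightarrow> real" where
  "log_weight P a b c = (if c = a then 1 / order a P else if c = b then - 1 / order b P else 0)"

text \<open>The substitution of \<open>u ^ fact N\<close> for the parameter clears the ramification
  of all branches at once, since the order of every root divides \<open>fact N\<close>. What remains
  of the ratio after removing a power of \<open>u\<close> is holomorphic and zero-free, hence the
  exponential of some \<open>\<Lambda>\<close>.\<close>

lemma branch_ratio:
  fixes P :: "complex poly"
  assumes P0: "P \<noteq> 0" and n: "degree P \<le> N" and Pab: "poly P a = 0" "poly P b = 0" "a \<noteq> b"
    and c: "poly P c = 0" and r: "r > 0" and \<phi>: "\<phi> holomorphic_on ball 0 r" "\<phi> 0 = c" "deriv \<phi> 0 \<noteq> 0"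
    and inj: "inj_on \<phi> (ball 0 r)" and \<omega>: "\<omega> ^ order c P = 1"
    and P\<phi>: "\<And>w. w \<in> ball 0 r \<Longrightarrow> poly P (\<phi> w) = w ^ order c P"
    and x: "\<And>t. 0 < t \<Longrightarrow> t < r ^ order c P \<Longrightarrow> x t = \<phi> (\<omega> * of_real (root (order c P) t))"
  obtains \<rho> \<Xi> \<Lambda> where "\<rho> > 0" "\<Xi> holomorphic_on ball 0 \<rho>" "\<Lambda> holomorphic_on ball 0 \<rho>"
    "\<And>u. 0 < u \<Longrightarrow> u < \<rho> \<Longrightarrow> x (u ^ fact N) = \<Xi> (of_real u)"
    "\<And>u. 0 < u \<Longrightarrow> u < \<rho> \<Longrightarrow> (b - x (u ^ fact N)) / (a - x (u ^ fact N)) = 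
        exp (\<Lambda> (of_real u) - of_real (log_weight P a b c * ln (u ^ fact N)))"
proof -
  define p where "p = order c P"
  have p: "p > 0" using c P0 order_root by (auto simp: p_def)
  have "p \<le> N" using order_degree[OF P0, of c] n by (simp add: p_def)
  then have "p dvd fact N" using p by (intro dvd_fact) auto
  then obtain m where m: "fact N = p * m" by blast
  have m0: "m > 0" using m by (metis fact_nonzero gr0I mult_0_right)
  define \<rho> where "\<rho> = min 1 r"
  have \<rho>: "0 < \<rho>" "\<rho> \<le> 1" "\<rho> \<le> r" using r by (auto simp: \<rho>_def)
  have n\<omega>: "norm \<omega> = 1" using \<omega> p unfolding p_def[symmetric]
    by (metis norm_ge_zero norm_one norm_power power_eq_imp_eq_base power_one zero_le_one)
  define W where "W = (\<lambda>u::complex. \<omega> * u ^ m)"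
  have small: "v ^ m < r" if "0 \<le> v" "v < \<rho>" for v :: real
    using power_decreasing[of 1 m v] that m0 \<rho> by simp
  have W: "W u \<in> ball 0 r" if "u \<in> ball 0 \<rho>" for u
    using small[of "norm u"] that by (simp add: W_def norm_mult norm_power n\<omega>)
  have Whol: "W holomorphic_on ball 0 \<rho>" unfolding W_def by (intro holomorphic_intros)
  have comp: "(\<lambda>u. G (W u)) holomorphic_on ball 0 \<rho>" if "G holomorphic_on ball 0 r" for G
    using holomorphic_on_compose_gen[OF Whol that] W by (auto simp: o_def image_subset_iff)
  define \<Xi> where "\<Xi> = (\<lambda>u. \<phi> (W u))"
  have \<Xi>: "\<Xi> holomorphic_on ball 0 \<rho>" unfolding \<Xi>_def by (rule comp[OF \<phi>(1)])
  have xX: "x (u ^ fact N) = \<Xi> (of_real u)" if u: "0 < u" "u < \<rho>" for u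
  proof -
    have "u ^ fact N = (u ^ m) ^ p" by (simp add: m power_mult[symmetric] mult.commute)
    moreover have "root p ((u ^ m) ^ p) = u ^ m" using u p by (simp add: real_root_power_cancel)
    moreover have "(u ^ m) ^ p < r ^ p" using small[of u] u p by (intro power_strict_mono) auto
    ultimately show ?thesis using x[of "(u ^ m) ^ p"] u by (simp add: \<Xi>_def W_def p_def)
  qed
  have avoid: "\<phi> w \<noteq> d" if "w \<in> ball 0 r" "poly P d = 0" "d \<noteq> c" for w d
  proof
    assume "\<phi> w = d"
    then have "w ^ p = 0" using P\<phi>[OF that(1)] that(2) by (simp add: p_def)
    then have "\<phi> w = c" using p \<phi>(2) by simp
    then show False using \<open>\<phi> w = d\<close> that(3) by simp
  qed
  \<comment> \<open>The difference quotient of \<open>\<phi>\<close> at 0, with its removable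
    singularity filled in. Injectivity of \<open>\<phi>\<close> makes it zero-free, so
    \<open>w * E w\<close> exhibits the simple zero of \<open>\<phi> w - c\<close>.\<close>
  define E where "E = (\<lambda>w. if w = 0 then deriv \<phi> 0 else (\<phi> w - \<phi> 0) / (w - 0))"
  have E: "E holomorphic_on ball 0 r" unfolding E_def by (rule pole_lemma[OF \<phi>(1)]) (use r in auto)
  have E0: "E w \<noteq> 0" if "w \<in> ball 0 r" for w
    using that inj_onD[OF inj, of w 0] r \<phi>(3) by (auto simp: E_def)
  have \<phi>E: "\<phi> w = c + w * E w" for w using \<phi>(2) by (simp add: E_def)
  have \<omega>0: "\<omega> \<noteq> 0" using n\<omega> by auto
  \<comment> \<open>For a branch from \<open>a\<close> the denominator carries the factor
    \<open>u ^ m\<close>, for one from \<open>b\<close> the numerator does, otherwise neither. The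
    exponential of the weighted logarithm is exactly this power of \<open>u\<close>, because
    \<open>fact N = p * m\<close>.\<close>
  obtain K where K: "K holomorphic_on ball 0 \<rho>" "\<And>u. u \<in> ball 0 \<rho> \<Longrightarrow> K u \<noteq> 0"
    "\<And>u. 0 < u \<Longrightarrow> u < \<rho> \<Longrightarrow> (b - \<Xi> (of_real u)) / (a - \<Xi> (of_real u)) = 
        K (of_real u) * exp (- of_real (log_weight P a b c * ln (u ^ fact N)))"
  proof -
    consider (a) "c = a" | (b) "c = b" "c \<noteq> a" | (o) "c \<noteq> a" "c \<noteq> b" by blast
    then show ?thesis
    proof cases
      case a
      have op: "order a P = p" by (simp add: p_def a)
      have pw: "exp (- complex_of_real (log_weight P a b c * ln (u ^ fact N))) = 1 / of_real (u ^ m)" if "0 < u" for u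
      proof -
        have "log_weight P a b c * ln (u ^ fact N) = m * ln u"
          using p that by (simp add: a log_weight_def op m ln_realpow del: of_nat_fact)
        then have "exp (- complex_of_real (log_weight P a b c * ln (u ^ fact N))) = of_real (exp (- (m * ln u)))"
          using exp_of_real[of "- (m * ln u)", where ?'a = complex] by simp
        also have "exp (- (m * ln u)) = 1 / u ^ m" using that by (simp add: exp_minus exp_of_nat_mult field_simps)
        finally show ?thesis by simp
      qed
      show ?thesis
      proof (rule that[of "\<lambda>u. (b - \<phi> (W u)) / (- \<omega> * E (W u))"])
        show "(\<lambda>u. (b - \<phi> (W u)) / (- \<omega> * E (W u))) holomorphic_on ball 0 \<rho>"
          by (intro holomorphic_intros comp E \<phi>) (use E0 W \<omega>0 in auto)
        show "(b - \<phi> (W u)) / (- \<omega> * E (W u)) \<noteq> 0" if "u \<in> ball 0 \<rho>" for u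
          using avoid[OF W[OF that] Pab(2)] E0[OF W[OF that]] \<omega>0 Pab(3) a by auto
        show "(b - \<Xi> (of_real u)) / (a - \<Xi> (of_real u)) = (b - \<phi> (W (of_real u))) / (- \<omega> * E (W (of_real u))) *
            exp (- of_real (log_weight P a b c * ln (u ^ fact N)))" if u: "0 < u" "u < \<rho>" for u
        proof -
          have "a - \<Xi> (of_real u) = (- \<omega> * E (W (of_real u))) * of_real (u ^ m)"
            unfolding \<Xi>_def \<phi>E[of "W (of_real u)"] by (simp add: a W_def)
          then show ?thesis unfolding pw[OF u(1)] by (simp add: \<Xi>_def)
        qed
      qed
    next
      case b
      have op: "order b P = p" by (simp add: p_def b)
      have pw: "exp (- complex_of_real (log_weight P a b c * ln (u ^ fact N))) = of_real (u ^ m)" if "0 < u" for u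
      proof -
        have "log_weight P a b c * ln (u ^ fact N) = - (m * ln u)"
          using b p that Pab(3) by (simp add: log_weight_def op m ln_realpow del: of_nat_fact)
        then have "exp (- complex_of_real (log_weight P a b c * ln (u ^ fact N))) = of_real (exp (m * ln u))"
          using exp_of_real[of "m * ln u", where ?'a = complex] by simp
        also have "exp (m * ln u) = u ^ m" using that by (simp add: exp_of_nat_mult)
        finally show ?thesis by simp
      qed
      show ?thesis
      proof (rule that[of "\<lambda>u. (- \<omega> * E (W u)) / (a - \<phi> (W u))"])
        have av: "a \<noteq> \<phi> (W u)" if "u \<in> ball 0 \<rho>" for u
          using avoid[OF W[OF that] Pab(1)] b by metis
        show "(\<lambda>u. (- \<omega> * E (W u)) / (a - \<phi> (W u))) holomorphic_on ball 0 \<rho>"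
          by (intro holomorphic_intros comp E \<phi>) (use av in auto)
        show "(- \<omega> * E (W u)) / (a - \<phi> (W u)) \<noteq> 0" if "u \<in> ball 0 \<rho>" for u
          using av[OF that] E0[OF W[OF that]] \<omega>0 by auto
        show "(b - \<Xi> (of_real u)) / (a - \<Xi> (of_real u)) = (- \<omega> * E (W (of_real u))) / (a - \<phi> (W (of_real u))) *
            exp (- of_real (log_weight P a b c * ln (u ^ fact N)))" if u: "0 < u" "u < \<rho>" for u
        proof -
          have "b - \<Xi> (of_real u) = (- \<omega> * E (W (of_real u))) * of_real (u ^ m)"
            unfolding \<Xi>_def \<phi>E[of "W (of_real u)"] by (simp add: b W_def)
          then show ?thesis unfolding pw[OF u(1)] by (simp add: \<Xi>_def)
        qed
      qed
    next
      case o
      show ?thesis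
      proof (rule that[of "\<lambda>u. (b - \<phi> (W u)) / (a - \<phi> (W u))"])
        have av: "a \<noteq> \<phi> (W u)" "b \<noteq> \<phi> (W u)" if "u \<in> ball 0 \<rho>" for u
          using avoid[OF W[OF that] Pab(1)] avoid[OF W[OF that] Pab(2)] o by metis+
        show "(\<lambda>u. (b - \<phi> (W u)) / (a - \<phi> (W u))) holomorphic_on ball 0 \<rho>"
          by (intro holomorphic_intros comp \<phi>) (use av in auto)
        show "(b - \<phi> (W u)) / (a - \<phi> (W u)) \<noteq> 0" if "u \<in> ball 0 \<rho>" for u
          using av[OF that] by auto
      qed (use o in \<open>simp add: log_weight_def \<Xi>_def\<close>)
    qed
  qed
  obtain \<Lambda> where \<Lambda>: "\<Lambda> holomorphic_on ball 0 \<rho>" "\<And>u. u \<in> ball 0 \<rho> \<Longrightarrow> K u = exp (\<Lambda> u)"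
    using K(1,2) convex_imp_simply_connected[of "ball (0::complex) \<rho>"]
    by (metis convex_ball open_ball simply_connected_eq_holomorphic_log)
  show ?thesis
  proof (rule that[OF \<rho>(1) \<Xi> \<Lambda>(1)])
    fix u :: real assume u: "0 < u" "u < \<rho>"
    show "x (u ^ fact N) = \<Xi> (of_real u)" by (rule xX[OF u])
    then show "(b - x (u ^ fact N)) / (a - x (u ^ fact N)) = 
        exp (\<Lambda> (of_real u) - of_real (log_weight P a b c * ln (u ^ fact N)))"
      using K(3)[OF u] \<Lambda>(2)[of "of_real u"] u by (simp add: exp_diff exp_minus field_simps)
  qed
qed

lemma common_radius:
  fixes \<rho> :: "nat \<Rightarrow> real"
  assumes "\<And>s. s < n \<Longrightarrow> \<rho> s > 0"
  obtains r where "r > 0" "\<And>s. s < n \<Longrightarrow> r \<le> \<rho> s"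
proof -
  let ?S = "insert 1 (\<rho> ` {..<n})"
  show ?thesis
  proof (rule that[of "Min ?S"])
    show "Min ?S > 0" using assms by (subst Min_gr_iff) auto
    show "Min ?S \<le> \<rho> s" if "s < n" for s using that by (intro Min_le) auto
  qed
qed

text \<open>The starting points \<open>c s\<close> depend on the branches only, so one choice of
  them serves every \<open>Q\<close> with vanishing moments. This uniformity is used later, when the
  constant polynomial is inserted for \<open>Q\<close>.\<close>

lemma branch_relation:
  fixes P :: "complex poly" and x :: "nat \<Rightarrow> complex \<Rightarrow> complex"
  assumes n: "degree P = n" "n > 0" and Pab: "poly P a = 0" "poly P b = 0" and ab: "a \<noteq> b"
    and U: "open U" "convex U" "0 \<notin> U" and posU: "\<And>t::real. t > 0 \<Longrightarrow> of_real t \<in> U"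
    and sep: "\<And>x. poly P x \<in> U \<Longrightarrow> poly (pderiv P) x \<noteq> 0"
    and xhol: "\<And>s. s < n \<Longrightarrow> x s holomorphic_on U"
    and xP: "\<And>s t. s < n \<Longrightarrow> t \<in> U \<Longrightarrow> poly P (x s t) = t"
    and xinj: "\<And>s s' t. s < n \<Longrightarrow> s' < n \<Longrightarrow> s \<noteq> s' \<Longrightarrow> t \<in> U \<Longrightarrow> x s t \<noteq> x s' t"
    and xinf: "\<And>s. s < n \<Longrightarrow> filterlim (\<lambda>t. x s (of_real t)) at_infinity at_top"
  obtains c where "\<And>s. s < n \<Longrightarrow> poly P (c s) = 0"
    "\<And>s. s < n \<Longrightarrow> ((\<lambda>t. x s (of_real t)) \<longlongrightarrow> c s) (at_right 0)"
    "\<And>Q t. moments_vanish P Q a b \<Longrightarrow> t \<in> U \<Longrightarrow> (\<Sum>s<n. of_real (log_weight P a b (c s)) * poly Q (x s t)) = 0"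
proof -
  have n0: "degree P > 0" and P0: "P \<noteq> 0" using n by auto
  let ?N = "fact n :: nat"
  have contx: "continuous_on {0<..} (\<lambda>t. x s (of_real t))" if "s < n" for s
    by (rule continuous_on_compose2[OF holomorphic_on_imp_continuous_on[OF xhol[OF that]]])
       (use posU in \<open>auto intro!: continuous_intros\<close>)
  have "\<exists>c \<rho> \<Xi> \<Lambda>. \<rho> > 0 \<and> \<Xi> holomorphic_on ball 0 \<rho> \<and> \<Lambda> holomorphic_on ball 0 \<rho> \<and> poly P c = 0 \<and>
      ((\<lambda>t. x s (of_real t)) \<longlongrightarrow> c) (at_right 0) \<and>
      (\<forall>u. 0 < u \<and> u < \<rho> \<longrightarrow> x s (of_real (u ^ ?N)) = \<Xi> (of_real u) \<and>
        (b - x s (of_real (u ^ ?N))) / (a - x s (of_real (u ^ ?N))) =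
          exp (\<Lambda> (of_real u) - of_real (log_weight P a b c * ln (u ^ ?N))))" if s: "s < n" for s
  proof -
    obtain c r \<phi> \<omega> where *: "poly P c = 0" "r > 0" "\<phi> holomorphic_on ball 0 r" "\<phi> 0 = c"
      "deriv \<phi> 0 \<noteq> 0" "inj_on \<phi> (ball 0 r)" "\<omega> ^ order c P = 1"
      "\<And>w. w \<in> ball 0 r \<Longrightarrow> poly P (\<phi> w) = w ^ order c P"
      "\<And>t. 0 < t \<Longrightarrow> t < r ^ order c P \<Longrightarrow> x s (of_real t) = \<phi> (\<omega> * of_real (root (order c P) t))"
      using branch_at_zero[OF n0 U(1) posU sep contx[OF s] xP[OF s posU]] by blast
    obtain \<rho> \<Xi> \<Lambda> where **: "\<rho> > 0" "\<Xi> holomorphic_on ball 0 \<rho>" "\<Lambda> holomorphic_on ball 0 \<rho>"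
      "\<And>u. 0 < u \<Longrightarrow> u < \<rho> \<Longrightarrow> x s (of_real (u ^ ?N)) = \<Xi> (of_real u)"
      "\<And>u. 0 < u \<Longrightarrow> u < \<rho> \<Longrightarrow> (b - x s (of_real (u ^ ?N))) / (a - x s (of_real (u ^ ?N))) = 
        exp (\<Lambda> (of_real u) - of_real (log_weight P a b c * ln (u ^ ?N)))"
    proof (rule branch_ratio[OF P0 eq_refl[OF n(1)] Pab ab *(1-7)])
      show "poly P (\<phi> w) = w ^ order c P" if "w \<in> ball 0 r" for w using *(8)[OF that] .
      show "x s (of_real t) = \<phi> (\<omega> * of_real (root (order c P) t))" if "0 < t" "t < r ^ order c P" for t
        using *(9)[OF that] .
    qed blast
    have p: "order c P > 0" using *(1) P0 order_root by blast
    have "((\<lambda>t. \<phi> (\<omega> * of_real (root (order c P) t))) \<longlongrightarrow> \<phi> 0) (at_right 0)"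
    proof (rule isCont_tendsto_compose[where g = \<phi> and l = 0])
      show "isCont \<phi> 0" using *(2,3) holomorphic_on_imp_continuous_on continuous_on_eq_continuous_at
        by (metis centre_in_ball open_ball)
      have "((\<lambda>t. \<omega> * of_real (root (order c P) t)) \<longlongrightarrow> \<omega> * of_real (root (order c P) 0)) (at_right 0)"
        by (intro tendsto_intros tendsto_of_real)
      then show "((\<lambda>t. \<omega> * of_real (root (order c P) t)) \<longlongrightarrow> 0) (at_right 0)" by simp
    qed
    moreover have "\<forall>\<^sub>F t in at_right 0. \<phi> (\<omega> * of_real (root (order c P) t)) = x s (of_real t)"
      using eventually_at_right_real[of 0 "r ^ order c P"] *(2) by (auto elim!: eventually_mono simp: *(9))
    ultimately have "((\<lambda>t. x s (of_real t)) \<longlongrightarrow> c) (at_right 0)"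
      unfolding *(4) by (rule Lim_transform_eventually)
    then show ?thesis
      by (intro exI[of _ c] exI[of _ \<rho>] exI[of _ \<Xi>] exI[of _ \<Lambda>] conjI allI impI)
         (use *(1) ** in \<open>auto simp del: of_real_power\<close>)
  qed
  then obtain c \<rho>0 \<Xi> \<Lambda> where near: "\<And>s. s < n \<Longrightarrow> \<rho>0 s > 0 \<and> \<Xi> s holomorphic_on ball 0 (\<rho>0 s) \<and>
      \<Lambda> s holomorphic_on ball 0 (\<rho>0 s) \<and> poly P (c s) = 0 \<and>
      ((\<lambda>t. x s (of_real t)) \<longlongrightarrow> c s) (at_right 0) \<and>
      (\<forall>u. 0 < u \<and> u < \<rho>0 s \<longrightarrow> x s (of_real (u ^ ?N)) = \<Xi> s (of_real u) \<and>
        (b - x s (of_real (u ^ ?N))) / (a - x s (of_real (u ^ ?N))) =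
          exp (\<Lambda> s (of_real u) - of_real (log_weight P a b (c s) * ln (u ^ ?N))))"
    by metis
  obtain \<rho> where \<rho>: "\<rho> > 0" "\<And>s. s < n \<Longrightarrow> \<rho> \<le> \<rho>0 s" using common_radius[of n \<rho>0] near by metis
  have hol\<Xi>: "\<Xi> s holomorphic_on ball 0 \<rho>" "\<Lambda> s holomorphic_on ball 0 \<rho>" if "s < n" for s
    using near[OF that] \<rho>(2)[OF that] by (meson holomorphic_on_subset subset_ball)+
  have x\<Xi>: "x s (of_real (u ^ ?N)) = \<Xi> s (of_real u)" if "s < n" "0 < u" "u < \<rho>" for s u
    using near[OF that(1)] \<rho>(2)[OF that(1)] that by fastforce
  have ratio: "(b - x s (of_real (u ^ ?N))) / (a - x s (of_real (u ^ ?N))) =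
          exp (\<Lambda> s (of_real u) - of_real (log_weight P a b (c s) * ln (u ^ ?N)))" if "s < n" "0 < u" "u < \<rho>" for s u
    using near[OF that(1)] \<rho>(2)[OF that(1)] that by fastforce
  have xab: "x s t \<noteq> a" "x s t \<noteq> b" if "s < n" "t \<in> U" for s t using xP[OF that] Pab U(3) that(2) by auto
  obtain B where B: "\<And>z. z \<in> closed_segment a b \<Longrightarrow> norm (poly P z) \<le> B"
  proof -
    have "compact (poly P ` closed_segment a b)"
      by (intro compact_continuous_image continuous_intros) auto
    then show ?thesis using that compact_imp_bounded bounded_iff by (metis image_eqI)
  qed
  \<comment> \<open>Beyond \<open>T\<close> two formulas are available: the generating identity, as
    \<open>t > 2 * B\<close>, and the principal logarithm for the Cauchy transform of 1, as all
    branches are then far from \<open>a\<close>.\<close>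
  obtain T where T: "T > 0" "T > 2 * B" "\<And>s t. s < n \<Longrightarrow> t > T \<Longrightarrow> norm (b - a) < norm (x s (of_real t) - a)"
  proof -
    have "\<forall>\<^sub>F t in at_top. \<forall>s\<in>{..<n}. norm (b - a) + norm a < norm (x s (of_real t))"
      using xinf by (intro eventually_ball_finite) (auto simp: filterlim_at_infinity_conv_norm_at_top filterlim_at_top_dense)
    then obtain T0 where T0: "\<And>t s. t \<ge> T0 \<Longrightarrow> s < n \<Longrightarrow> norm (b - a) + norm a < norm (x s (of_real t))"
      by (auto simp: eventually_at_top_linorder)
    show ?thesis
    proof (rule that[of "max T0 (max 1 (2 * B + 1))"])
      fix s t assume "s < n" "t > max T0 (max 1 (2 * B + 1))"
      then show "norm (b - a) < norm (x s (of_real t) - a)"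
        using T0[of t s] norm_triangle_ineq2[of "x s (of_real t)" a] by simp
    qed auto
  qed
  define q where "q = (\<lambda>s t. (b - x s t) / (a - x s t))"
  \<comment> \<open>The continuation to all of \<open>U\<close> of the principal logarithm used
    beyond \<open>T\<close>. A holomorphic logarithm of \<open>q s\<close> exists on the convex
    \<open>U\<close>; subtracting a constant adjusts it to the principal one.\<close>
  have "\<exists>g. g holomorphic_on U \<and> (\<forall>t\<in>U. exp (g t) = q s t) \<and> (\<forall>t>T. g (of_real t) = Ln (q s (of_real t)))"
    if s: "s < n" for s
  proof -
    have "q s holomorphic_on U" unfolding q_def using xab[OF s] by (intro holomorphic_intros xhol s) auto
    moreover have "\<forall>t\<in>U. q s t \<noteq> 0" using xab[OF s] by (auto simp: q_def)
    ultimately obtain g where g: "g holomorphic_on U" "\<And>t. t \<in> U \<Longrightarrow> q s t = exp (g t)"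
      using convex_imp_simply_connected[OF U(2)] U(1) by (metis simply_connected_eq_holomorphic_log)
    have TU: "of_real t \<in> U" if "t \<in> {T<..}" for t using posU T(1) that by auto
    have qp: "q s (of_real t) \<notin> \<real>\<^sub>\<le>\<^sub>0" if "t \<in> {T<..}" for t
      unfolding q_def by (rule cauchy_transform_one(3)) (use T(3)[OF s] that in auto)
    obtain k where k: "exp k = 1" "\<And>t. t \<in> {T<..} \<Longrightarrow> g (of_real t) = Ln (q s (of_real t)) + k"
    proof (rule continuous_logs_differ_by_constant[of "{T<..}" "\<lambda>t. g (of_real t)" "\<lambda>t. Ln (q s (of_real t))"])
      show "continuous_on {T<..} (\<lambda>t. g (of_real t))"
        by (rule continuous_on_compose2[OF holomorphic_on_imp_continuous_on[OF g(1)]])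
           (use TU in \<open>auto intro!: continuous_intros\<close>)
      have "continuous_on {T<..} (\<lambda>t. q s (of_real t))"
        by (rule continuous_on_compose2[OF holomorphic_on_imp_continuous_on[OF \<open>q s holomorphic_on U\<close>]])
           (use TU in \<open>auto intro!: continuous_intros\<close>)
      then show "continuous_on {T<..} (\<lambda>t. Ln (q s (of_real t)))"
        by (rule continuous_on_Ln') (use qp in auto)
      fix t assume t: "t \<in> {T<..}"
      have "q s (of_real t) \<noteq> 0" using qp[OF t] by auto
      then show "exp (g (of_real t)) = exp (Ln (q s (of_real t)))" using g(2)[OF TU[OF t]] by simp
    qed auto
    show ?thesis
      by (rule exI[of _ "\<lambda>t. g t - k"]) (use g k in \<open>auto intro!: holomorphic_intros simp: exp_diff\<close>)
  qed
  then obtain g where g: "\<And>s. s < n \<Longrightarrow> g s holomorphic_on U" "\<And>s t. s < n \<Longrightarrow> t \<in> U \<Longrightarrow> exp (g s t) = q s t"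
    "\<And>s t. s < n \<Longrightarrow> t > T \<Longrightarrow> g s (of_real t) = Ln (q s (of_real t))" by metis
  \<comment> \<open>Near 0 the continued logarithm agrees with the local expansion up to a constant.
    This constant records the change of determination between infinity and 0 and is free of
    \<open>ln u\<close>, so it joins the holomorphic part.\<close>
  have "\<exists>k. \<forall>u. 0 < u \<and> u < \<rho> \<longrightarrow> g s (of_real (u ^ ?N)) =
     \<Lambda> s (of_real u) - of_real (log_weight P a b (c s) * ln (u ^ ?N)) + k" if s: "s < n" for s
  proof -
    obtain k where "exp k = 1" "\<And>u. u \<in> {0<..<\<rho>} \<Longrightarrow> g s (of_real (u ^ ?N)) =
       \<Lambda> s (of_real u) - of_real (log_weight P a b (c s) * ln (u ^ ?N)) + k"
    proof (rule continuous_logs_differ_by_constant[of "{0<..<\<rho>}" "\<lambda>u. g s (of_real (u ^ ?N))"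
          "\<lambda>u. \<Lambda> s (of_real u) - of_real (log_weight P a b (c s) * ln (u ^ ?N))"])
      show "continuous_on {0<..<\<rho>} (\<lambda>u. g s (of_real (u ^ ?N)))"
        by (rule continuous_on_compose2[OF holomorphic_on_imp_continuous_on[OF g(1)[OF s]]])
           (auto simp del: of_real_power intro!: continuous_intros posU)
      have "continuous_on {0<..<\<rho>} (\<lambda>u. \<Lambda> s (of_real u))"
        by (rule continuous_on_compose2[OF holomorphic_on_imp_continuous_on[OF hol\<Xi>(2)[OF s]]])
           (auto intro!: continuous_intros)
      then show "continuous_on {0<..<\<rho>} (\<lambda>u. \<Lambda> s (of_real u) - of_real (log_weight P a b (c s) * ln (u ^ ?N)))"
        by (intro continuous_intros) auto
      fix u assume u: "u \<in> {0<..<\<rho>}"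
      then have "of_real (u ^ ?N) \<in> U" by (intro posU) simp
      from g(2)[OF s this] ratio[OF s] u
      show "exp (g s (of_real (u ^ ?N))) = exp (\<Lambda> s (of_real u) - of_real (log_weight P a b (c s) * ln (u ^ ?N)))"
        by (simp add: q_def)
    qed auto
    then show ?thesis by auto
  qed
  then obtain k where k: "\<And>s u. s < n \<Longrightarrow> 0 < u \<Longrightarrow> u < \<rho> \<Longrightarrow> g s (of_real (u ^ ?N)) =
     \<Lambda> s (of_real u) - of_real (log_weight P a b (c s) * ln (u ^ ?N)) + k s" by metis
  have lim_pt: "of_real t \<in> U \<and> complex_of_real t islimpt of_real ` {l<..<r}" if "l < t" "t < r" "0 < t" for l t r :: real
  proof
    have "t islimpt {l<..<r}" using that by (intro open_imp_islimpt) auto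
    then show "complex_of_real t islimpt of_real ` {l<..<r}"
    proof (rule islimpt_isCont_image)
      show "\<forall>\<^sub>F y in at t. complex_of_real y \<noteq> complex_of_real t"
        unfolding of_real_eq_iff by (simp add: eventually_at_filter)
    qed (intro continuous_intros)
  qed (use posU that in auto)
  have rel: "(\<Sum>s<n. of_real (log_weight P a b (c s)) * poly Q (x s t)) = 0"
    if mom: "moments_vanish P Q a b" and t: "t \<in> U" for Q t
  proof -
    obtain D where D: "\<And>y. y \<notin> closed_segment a b \<Longrightarrow> contour_integral (linepath a b) (\<lambda>z. poly Q z / (z - y)) =
       poly D y + poly Q y * contour_integral (linepath a b) (\<lambda>z. 1 / (z - y))"
      using cauchy_transform_poly[of a b Q] by metis
    \<comment> \<open>The sum of the Cauchy transforms of \<open>Q\<close> at the points of the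
      fibre, with \<open>g s\<close> in place of the principal logarithm; it vanishes beyond
      \<open>T\<close> and therefore on \<open>U\<close>.\<close>
    define F where "F = (\<lambda>t. \<Sum>s<n. poly D (x s t) + poly Q (x s t) * g s t)"
    have hF: "F holomorphic_on U" unfolding F_def by (intro holomorphic_intros xhol g(1)) auto
    have F0: "F t = 0" if t: "t \<in> U" for t
    proof (rule analytic_continuation[OF hF U(1) convex_connected[OF U(2)], of "of_real ` {T<..<T+2}" "of_real (T+1)"])
      show "of_real ` {T<..<T+2} \<subseteq> U" using posU T(1) by auto
      show "of_real (T+1) \<in> U" "complex_of_real (T+1) islimpt of_real ` {T<..<T+2}"
        using lim_pt[of T "T+1" "T+2"] T(1) by auto
      fix z assume "z \<in> complex_of_real ` {T<..<T+2}"
      then obtain t where t: "z = of_real t" "t > T" by auto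
      have tU: "of_real t \<in> U" using t T(1) posU by auto
      have tB: "2 * B < norm (complex_of_real t)" using t T by simp
      have "(\<Sum>s<n. contour_integral (linepath a b) (\<lambda>z. poly Q z / (z - x s (of_real t)))) = 0"
      proof (rule fibre_sum_contour_integral_eq_0[OF n Pab mom B tB])
        show "inj_on (\<lambda>s. x s (of_real t)) {..<n}" by (rule inj_onI) (use xinj tU in blast)
      qed (use xP tU sep in auto)
      also have "(\<Sum>s<n. contour_integral (linepath a b) (\<lambda>z. poly Q z / (z - x s (of_real t)))) = F z"
        unfolding F_def t(1)
      proof (rule sum.cong[OF refl])
        fix s assume "s \<in> {..<n}"
        then have s: "s < n" by simp
        note far = T(3)[OF s t(2)]
        show "contour_integral (linepath a b) (\<lambda>z. poly Q z / (z - x s (of_real t))) =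
          poly D (x s (of_real t)) + poly Q (x s (of_real t)) * g s (of_real t)"
          unfolding D[OF cauchy_transform_one(1)[OF far]] cauchy_transform_one(2)[OF far] g(3)[OF s t(2)] q_def ..
      qed
      finally show "F z = 0" .
    qed (use t in auto)
    \<comment> \<open>Up to the factor \<open>fact n\<close>, this is the coefficient of
      \<open>ln u\<close> when the equation for \<open>F\<close> is written in the uniformizing
      variable \<open>u\<close>. \<open>log_independent\<close> shows that it vanishes.\<close>
    define L where "L = (\<lambda>u. \<Sum>s<n. of_real (log_weight P a b (c s)) * poly Q (\<Xi> s u))"
    have L0: "of_nat ?N * L u = 0" if "u \<in> ball 0 \<rho>" for u
    proof (rule log_independent[of "\<lambda>u. \<Sum>s<n. poly D (\<Xi> s u) + poly Q (\<Xi> s u) * (\<Lambda> s u + k s)" \<rho>, OF _ _ \<rho>(1) _ that])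
      show "(\<lambda>u. \<Sum>s<n. poly D (\<Xi> s u) + poly Q (\<Xi> s u) * (\<Lambda> s u + k s)) holomorphic_on ball 0 \<rho>"
        by (intro holomorphic_intros hol\<Xi>) auto
      show "(\<lambda>u. of_nat ?N * L u) holomorphic_on ball 0 \<rho>"
        unfolding L_def by (intro holomorphic_intros hol\<Xi>) auto
      fix u assume u: "0 < u" "u < \<rho>"
      have lnu: "ln (u ^ ?N) = ?N * ln u" using u by (simp add: ln_realpow del: of_nat_fact)
      have "0 = F (of_real (u ^ ?N))" by (rule F0[symmetric], rule posU) (use u in simp)
      also have "\<dots> = (\<Sum>s<n. (poly D (\<Xi> s (of_real u)) + poly Q (\<Xi> s (of_real u)) * (\<Lambda> s (of_real u) + k s))
           - of_real (ln u) * of_nat ?N * (of_real (log_weight P a b (c s)) * poly Q (\<Xi> s (of_real u))))"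
        unfolding F_def
      proof (rule sum.cong[OF refl])
        fix s assume "s \<in> {..<n}"
        then have s: "s < n" by simp
        show "poly D (x s (of_real (u ^ ?N))) + poly Q (x s (of_real (u ^ ?N))) * g s (of_real (u ^ ?N)) =
          (poly D (\<Xi> s (of_real u)) + poly Q (\<Xi> s (of_real u)) * (\<Lambda> s (of_real u) + k s))
           - of_real (ln u) * of_nat ?N * (of_real (log_weight P a b (c s)) * poly Q (\<Xi> s (of_real u)))"
          unfolding x\<Xi>[OF s u] k[OF s u] lnu by (simp add: algebra_simps del: of_nat_fact)
      qed
      also have "\<dots> = (\<Sum>s<n. poly D (\<Xi> s (of_real u)) + poly Q (\<Xi> s (of_real u)) * (\<Lambda> s (of_real u) + k s))
          - of_real (ln u) * of_nat ?N * L (of_real u)"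
        unfolding L_def by (simp only: sum_subtractf sum_distrib_left)
      finally show "(\<Sum>s<n. poly D (\<Xi> s (of_real u)) + poly Q (\<Xi> s (of_real u)) * (\<Lambda> s (of_real u) + k s)) =
         of_real (ln u) * (of_nat ?N * L (of_real u))" by (simp add: mult.assoc)
    qed
    define H where "H = (\<lambda>t. \<Sum>s<n. of_real (log_weight P a b (c s)) * poly Q (x s t))"
    have hH: "H holomorphic_on U" unfolding H_def by (intro holomorphic_intros xhol) auto
    define \<tau> where "\<tau> = \<rho> ^ ?N"
    have \<tau>: "\<tau> > 0" using \<rho>(1) by (simp add: \<tau>_def)
    have "H t = 0"
    proof (rule analytic_continuation[OF hH U(1) convex_connected[OF U(2)], of "of_real ` {0<..<\<tau>}" "of_real (\<tau>/2)"])
      show "of_real ` {0<..<\<tau>} \<subseteq> U" using posU by auto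
      show "of_real (\<tau>/2) \<in> U" "complex_of_real (\<tau>/2) islimpt of_real ` {0<..<\<tau>}"
        using lim_pt[of 0 "\<tau>/2" \<tau>] \<tau> by auto
      fix z assume "z \<in> complex_of_real ` {0<..<\<tau>}"
      then obtain t where t: "z = of_real t" "0 < t" "t < \<tau>" by auto
      define u where "u = root ?N t"
      have u: "u > 0" "u ^ ?N = t" using t(2) by (auto simp: u_def)
      have "u < \<rho>"
      proof (rule ccontr)
        assume "\<not> ?thesis"
        then have "\<rho> ^ ?N \<le> u ^ ?N" using \<rho>(1) by (intro power_mono) auto
        then show False using t(3) u(2) by (simp add: \<tau>_def)
      qed
      have "H z = L (of_real u)" unfolding H_def L_def t(1) u(2)[symmetric]
        using x\<Xi>[OF _ u(1) \<open>u < \<rho>\<close>] by (intro sum.cong) auto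
      then show "H z = 0" using L0[of "of_real u"] u \<open>u < \<rho>\<close> by simp
    qed (use t in auto)
    then show ?thesis by (simp add: H_def)
  qed
  show ?thesis by (rule that[of c]) (use near rel in auto)
qed

section \<open>Planarity\<close>

text \<open>Both paths fit into the box from -B to B in width and from 0 to B in height, and all
  four endpoints lie on its lower edge in alternating order, which is the position treated by
  \<open>fashoda_interlace\<close>.\<close>

lemma half_plane_cross:
  fixes f g :: "real \<Rightarrow> complex"
  assumes "path f" "path g" and f: "\<And>t. t \<in> {0..1} \<Longrightarrow> Im (f t) \<ge> 0" and g: "\<And>t. t \<in> {0..1} \<Longrightarrow> Im (g t) \<ge> 0"
    and "Im (pathstart f) = 0" "Im (pathfinish f) = 0" "Im (pathstart g) = 0" "Im (pathfinish g) = 0"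
    and "Re (pathstart f) < Re (pathstart g)" "Re (pathstart g) < Re (pathfinish f)" "Re (pathfinish f) < Re (pathfinish g)"
  shows "path_image f \<inter> path_image g \<noteq> {}"
proof -
  define V where "V = (\<lambda>z. vector [Re z, Im z] :: real^2)"
  have V: "V z $ 1 = Re z" "V z $ 2 = Im z" for z by (auto simp: V_def)
  have Vinj: "V z = V w \<Longrightarrow> z = w" for z w by (metis V complex_eqI)
  have cV: "continuous_on S V" for S
  proof -
    have eq: "V = (\<lambda>z. \<chi> i. if i = 1 then Re z else Im z)"
      by (rule ext, simp add: vec_eq_iff forall_2 V)
    show ?thesis unfolding eq
    proof (rule continuous_on_vec_lambda)
      show "continuous_on S (\<lambda>z. if i = 1 then Re z else Im z)" for i :: 2
        by (cases "i = 1") (auto intro!: continuous_intros)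
    qed
  qed
  have pf: "path (V \<circ> f)" "path (V \<circ> g)"
    using assms(1,2) cV by (auto intro: path_continuous_image)
  have "bounded (path_image f \<union> path_image g)"
    using assms(1,2) by (simp add: bounded_path_image)
  then obtain B where B: "B > 0" "\<And>z. z \<in> path_image f \<union> path_image g \<Longrightarrow> norm z \<le> B"
    by (meson bounded_pos)
  let ?a = "vector [-B, 0] :: real^2" and ?b = "vector [B, B] :: real^2"
  have in1: "V z \<in> cbox ?a ?b" if "z \<in> path_image f \<union> path_image g" for z
  proof -
    have "\<bar>Re z\<bar> \<le> B" "\<bar>Im z\<bar> \<le> B" using B(2)[OF that] abs_Re_le_cmod[of z] abs_Im_le_cmod[of z] by linarith+
    moreover have "Im z \<ge> 0" using that f g by (auto simp: path_image_def)
    ultimately show ?thesis by (auto simp: mem_box_cart forall_2 V)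
  qed
  obtain z where "z \<in> path_image (V \<circ> f)" "z \<in> path_image (V \<circ> g)"
  proof (rule fashoda_interlace[OF pf, of ?a ?b])
    show "path_image (V \<circ> f) \<subseteq> cbox ?a ?b" "path_image (V \<circ> g) \<subseteq> cbox ?a ?b"
      using in1 by (auto simp: path_image_compose)
  qed (use assms in \<open>auto simp: V pathstart_compose pathfinish_compose\<close>)
  then show ?thesis using Vinj by (auto simp: path_image_compose)
qed

text \<open>The Cayley map sends the disc to the upper half-plane and the boundary point \<open>p\<close> to infinity,
  which transports Fashoda's theorem from a box to the disc.\<close>
definition cayley :: "complex \<Rightarrow> complex \<Rightarrow> complex" where
  "cayley p z = \<i> * (p + z) / (p - z)"

lemma cayley_inj:
  assumes "p \<noteq> 0" "z \<noteq> p" "w \<noteq> p" "cayley p z = cayley p w"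
  shows "z = w"
proof -
  have "(p + z) * (p - w) = (p + w) * (p - z)"
    using assms(2-4) by (auto simp: cayley_def field_simps)
  then have "2 * p * (z - w) = 0" by (simp add: algebra_simps)
  then show ?thesis using assms(1) by simp
qed

text \<open>The imaginary part is the Poisson kernel (1 - |z|^2) / |p - z|^2 of the disc.\<close>

lemma Im_cayley:
  assumes "norm p = 1" "norm z \<le> 1" "z \<noteq> p"
  shows "Im (cayley p z) \<ge> 0"
proof -
  have "cayley p z = \<i> * ((p + z) * cnj (p - z)) / of_real (norm (p - z) ^ 2)"
    unfolding cayley_def complex_norm_square using assms(3) by (simp add: divide_simps)
  then have "Im (cayley p z) = Re ((p + z) * cnj (p - z)) / norm (p - z) ^ 2"
    by (simp only: Im_divide_of_real) simp
  also have "Re ((p + z) * cnj (p - z)) = norm p ^ 2 - norm z ^ 2"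
    unfolding cmod_power2 by (simp add: power2_eq_square algebra_simps)
  finally have "Im (cayley p z) = (norm p ^ 2 - norm z ^ 2) / norm (p - z) ^ 2" .
  moreover have "norm p ^ 2 - norm z ^ 2 \<ge> 0" using assms by (simp add: power_le_one)
  ultimately show ?thesis by simp
qed

lemma odd_multiple_less_pi:
  fixes n s :: nat
  assumes "s < n"
  shows "0 < pi * (2 * real s + 1) / (2 * real n)" "pi * (2 * real s + 1) / (2 * real n) < pi"
proof -
  have "pi * (2 * real s + 1) < pi * (2 * real n)" using assms by (intro mult_strict_left_mono) auto
  then show "pi * (2 * real s + 1) / (2 * real n) < pi" using assms by (simp add: pos_divide_less_eq)
qed (use assms in \<open>auto intro!: divide_pos_pos mult_pos_pos\<close>)

text \<open>The pole, at angle \<open>pi / n\<close>, is midway between the points of indices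
  \<open>n - 1\<close> and 0, so the circle is cut exactly where the numbering wraps around. The
  argument of the cotangent is half the angle between a point and the pole.\<close>

lemma cayley_circle:
  fixes n s :: nat
  assumes n: "n > 0" and s: "s < n"
  shows "cayley (cis (pi / n)) (cis (- (2 * pi * s / n))) = of_real (cot (pi * (2 * real s + 1) / (2 * real n)))"
    and "cis (- (2 * pi * s / n)) \<noteq> cis (pi / n)"
proof -
  define b where "b = pi * (2 * real s + 1) / (2 * real n)"
  have b: "0 < b" "b < pi" using odd_multiple_less_pi[OF s] by (auto simp: b_def)
  have sb: "sin b > 0" using b by (rule sin_gt_zero)
  have 1: "cis (- (2 * pi * s / n)) = cis (pi / n - b) * cis (- b)"
  proof -
    have "- (2 * pi * s / n) = (pi / n - b) + - b" using n by (simp add: b_def field_simps)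
    then show ?thesis by (simp add: cis_mult)
  qed
  have 2: "cis (pi / n) = cis (pi / n - b) * cis b" by (simp add: cis_mult)
  have nz: "cis b \<noteq> cis (- b)" using sb by (simp add: complex_eq_iff)
  then show "cis (- (2 * pi * s / n)) \<noteq> cis (pi / n)" unfolding 1 2 by simp
  have "cayley (cis (pi / n)) (cis (- (2 * pi * s / n))) =
     \<i> * (cis (pi / n - b) * (cis b + cis (- b))) / (cis (pi / n - b) * (cis b - cis (- b)))"
    unfolding cayley_def 1 2 by (simp add: algebra_simps)
  also have "\<dots> = \<i> * (cis b + cis (- b)) / (cis b - cis (- b))" by simp
  also have "cis b + cis (- b) = of_real (2 * cos b)" by (simp add: complex_eq_iff)
  also have "cis b - cis (- b) = \<i> * of_real (2 * sin b)" by (simp add: complex_eq_iff)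
  also have "\<i> * of_real (2 * cos b) / (\<i> * of_real (2 * sin b)) = (of_real (cot b) :: complex)"
    using sb by (simp add: cot_def)
  finally show "cayley (cis (pi / n)) (cis (- (2 * pi * s / n))) = of_real (cot (pi * (2 * real s + 1) / (2 * real n)))"
    by (simp add: b_def)
qed

lemma cot_decreasing:
  assumes "0 < x" "x < y" "y < pi"
  shows "cot y < cot (x::real)"
proof -
  have "tan (pi / 2 - y) < tan (pi / 2 - x)" by (rule tan_monotone) (use assms in auto)
  then show ?thesis by (simp add: tan_def cot_def sin_diff cos_diff)
qed

lemma interlaced_arcs_cross:
  fixes f g :: "real \<Rightarrow> complex"
  assumes pf: "path f" "path g" and f: "path_image f \<subseteq> cball 0 1" and g: "path_image g \<subseteq> cball 0 1"
    and avoid: "cis (pi / real n) \<notin> path_image f" "cis (pi / real n) \<notin> path_image g"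
    and s: "s1 < s2" "s2 < s3" "s3 < s4" "s4 < n"
    and e: "pathstart f = cis (- (2 * pi * real s1 / real n))" "pathfinish f = cis (- (2 * pi * real s3 / real n))"
      "pathstart g = cis (- (2 * pi * real s2 / real n))" "pathfinish g = cis (- (2 * pi * real s4 / real n))"
  shows "path_image f \<inter> path_image g \<noteq> {}"
proof -
  let ?p = "cis (pi / real n)" and ?C = "cayley (cis (pi / real n))"
  have n: "n > 0" using s by simp
  have cont: "continuous_on S ?C" if "?p \<notin> S" for S
    unfolding cayley_def by (intro continuous_intros) (use that in auto)
  have pC: "path (?C \<circ> f)" "path (?C \<circ> g)" "path (?C \<circ> reversepath f)" "path (?C \<circ> reversepath g)"
    using pf cont avoid by (auto intro!: path_continuous_image simp: path_reversepath)
  define X where "X = (\<lambda>s. cot (pi * (2 * real s + 1) / (2 * real n)))"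
  have C: "?C (cis (- (2 * pi * real s / real n))) = of_real (X s)" if "s < n" for s
    using cayley_circle(1)[OF n that] by (simp only: X_def)
  have X: "X s' < X s" if "s < s'" "s' < n" for s s'
    unfolding X_def by (rule cot_decreasing)
      (use that odd_multiple_less_pi[of s n] odd_multiple_less_pi[of s' n] in
        \<open>auto intro!: divide_strict_right_mono mult_strict_left_mono\<close>)
  have Im0: "Im (?C z) \<ge> 0" if "z \<in> path_image f \<union> path_image g" for z
    using that f g avoid by (intro Im_cayley) auto
  \<comment> \<open>The cotangent decreases, so the order of the indices is reversed on the real
    line. Running both paths backwards and letting \<open>g\<close> take the role of the first path
    restores the order that \<open>half_plane_cross\<close> asks for.\<close>
  have "path_image (?C \<circ> reversepath g) \<inter> path_image (?C \<circ> reversepath f) \<noteq> {}"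
  proof (rule half_plane_cross)
    show "Im ((?C \<circ> reversepath g) t) \<ge> 0" if "t \<in> {0..1}" for t
    proof -
      have "reversepath g t \<in> path_image g" using that by (metis path_image_def path_image_reversepath image_eqI)
      then show ?thesis using Im0 by simp
    qed
    show "Im ((?C \<circ> reversepath f) t) \<ge> 0" if "t \<in> {0..1}" for t
    proof -
      have "reversepath f t \<in> path_image f" using that by (metis path_image_def path_image_reversepath image_eqI)
      then show ?thesis using Im0 by simp
    qed
  qed (use s X pC in \<open>simp_all add: pathstart_compose pathfinish_compose e C\<close>)
  then obtain z w where "z \<in> path_image f" "w \<in> path_image g" "?C z = ?C w"
    by (auto simp: path_image_compose) metis
  moreover have "z = w"
    by (rule cayley_inj[of ?p]) (use calculation avoid in auto)
  ultimately show ?thesis by auto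
qed

lemma norm_shrink_inj:
  fixes z w u :: complex
  assumes "u \<noteq> 0" and "z / (u * of_real (1 + norm z)) = w / (u * of_real (1 + norm w))"
  shows "z = w"
proof -
  have pos: "1 + norm z > 0" "1 + norm w > 0" by (auto intro: add_pos_nonneg)
  have nz: "(1 + of_real (norm z) :: complex) \<noteq> 0" "(1 + of_real (norm w) :: complex) \<noteq> 0"
    using pos by (metis of_real_1 of_real_add of_real_eq_0_iff less_irrefl)+
  have eq: "z * of_real (1 + norm w) = w * of_real (1 + norm z)"
    using assms nz by (simp add: divide_simps mult.assoc mult.commute mult.left_commute)
  then have "norm (z * of_real (1 + norm w)) = norm (w * of_real (1 + norm z))" by (rule arg_cong)
  then have "norm z * (1 + norm w) = norm w * (1 + norm z)"
    using pos by (simp only: norm_mult norm_of_real abs_of_pos)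
  then have "norm z = norm w" by (simp add: algebra_simps)
  then show ?thesis using eq nz by simp
qed

text \<open>The map \<open>z / (u (1 + |z|))\<close> compactifies the plane to the disc; the lifts of the positive ray
  become arcs from a root to the point of the circle given by their asymptotic direction.\<close>
lemma not_interlaced:
  fixes x :: "nat \<Rightarrow> real \<Rightarrow> complex" and c :: "nat \<Rightarrow> complex"
  assumes cont: "\<And>s. s < n \<Longrightarrow> continuous_on {0<..} (x s)"
    and inj: "\<And>s s' t t'. s < n \<Longrightarrow> s' < n \<Longrightarrow> 0 < t \<Longrightarrow> 0 < t' \<Longrightarrow> x s t = x s' t' \<Longrightarrow> s = s'"
    and avoid: "\<And>s s' t. s < n \<Longrightarrow> s' < n \<Longrightarrow> 0 < t \<Longrightarrow> x s t \<noteq> c s'"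
    and lim0: "\<And>s. s < n \<Longrightarrow> (x s \<longlongrightarrow> c s) (at_right 0)"
    and liminf: "\<And>s. s < n \<Longrightarrow> filterlim (x s) at_infinity at_top"
    and dir: "\<And>s. s < n \<Longrightarrow> ((\<lambda>t. sgn (x s t)) \<longlongrightarrow> u * cis (- (2 * pi * real s / real n))) at_top"
    and u: "norm u = 1"
    and s: "s1 < s2" "s2 < s3" "s3 < s4" "s4 < n" and c: "c s1 = c s3" "c s2 = c s4"
  shows "c s1 = c s2"
proof (rule ccontr)
  assume ne: "c s1 \<noteq> c s2"
  have n: "n > 0" using s by simp
  have u0: "u \<noteq> 0" using u by auto
  define M where "M = (\<lambda>z. z / (u * of_real (1 + norm z)))"
  define d where "d = (\<lambda>s. cis (- (2 * pi * real s / real n)))"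
  \<comment> \<open>The parameter \<open>\<theta> / (1 - \<theta>)\<close> maps the open unit
    interval onto the positive ray; the two endpoints carry the limits, the root under
    \<open>M\<close> and the direction \<open>d s\<close> on the circle.\<close>
  define h where "h = (\<lambda>s \<theta>. if \<theta> \<le> 0 then M (c s) else if \<theta> \<ge> 1 then d s else M (x s (\<theta> / (1 - \<theta>))))"
  have Minj: "M z = M w \<Longrightarrow> z = w" for z w unfolding M_def by (rule norm_shrink_inj[OF u0])
  have nz: "(1 + of_real (norm z) :: complex) \<noteq> 0" for z :: complex
    by (metis add_pos_nonneg less_irrefl norm_ge_zero of_real_1 of_real_add of_real_eq_0_iff zero_less_one)
  have Mnorm: "norm (M z) < 1" for z
  proof -
    have "norm (M z) = norm z / (1 + norm z)"
      unfolding M_def norm_divide norm_mult u by (simp only: norm_of_real) simp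
    also have "\<dots> < 1" by (smt (verit, best) divide_less_eq_1_pos norm_ge_zero)
    finally show ?thesis .
  qed
  have Mcont: "isCont M z" for z unfolding M_def using nz u0 by (intro continuous_intros) auto
  have h01: "h s 0 = M (c s)" "h s 1 = d s" for s by (auto simp: h_def)
  have himg: "h s ` {0..1} \<subseteq> {M (c s), d s} \<union> (M \<circ> x s) ` {0<..}" for s
    by (auto simp: h_def)
  have hpath: "path (h s)" if "s < n" for s unfolding path_def
  proof (rule continuous_on_IccI)
    have ev0: "\<forall>\<^sub>F \<theta> in at_right (0::real). 0 < \<theta> \<and> \<theta> < 1"
      using eventually_at_right_real[of 0 1] by (auto elim: eventually_mono)
    have ev1: "\<forall>\<^sub>F \<theta> in at_left (1::real). 0 < \<theta> \<and> \<theta> < 1"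
      using eventually_at_left_real[of 0 1] by (auto elim: eventually_mono)
    have "filterlim (\<lambda>\<theta>::real. \<theta> / (1 - \<theta>)) (at_right 0) (at_right 0)" by real_asymp
    from filterlim_compose[OF lim0[OF that] this]
    have "((\<lambda>\<theta>. M (x s (\<theta> / (1 - \<theta>)))) \<longlongrightarrow> M (c s)) (at_right 0)"
      by (rule isCont_tendsto_compose[OF Mcont])
    then show "(h s \<longlongrightarrow> h s 0) (at_right 0)" unfolding h01
      by (rule Lim_transform_eventually) (use ev0 in \<open>auto simp: h_def elim: eventually_mono\<close>)
    have t1: "filterlim (\<lambda>\<theta>::real. \<theta> / (1 - \<theta>)) at_top (at_left 1)" by real_asymp
    have "((\<lambda>t. (sgn (x s t) / u) * (1 - 1 / of_real (1 + norm (x s t)))) \<longlongrightarrow> (u * d s / u) * (1 - 0)) at_top"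
    proof (intro tendsto_intros u0)
      show "((\<lambda>t. sgn (x s t)) \<longlongrightarrow> u * d s) at_top" using dir[OF that] by (simp add: d_def)
      have "filterlim (\<lambda>t. 1 + norm (x s t)) at_top at_top"
        using liminf[OF that] by (intro filterlim_tendsto_add_at_top[OF tendsto_const] filterlim_at_infinity_imp_norm_at_top)
      then have "filterlim (\<lambda>t. of_real (1 + norm (x s t)) :: complex) at_infinity at_top"
        by (intro filterlim_norm_at_top_imp_at_infinity) (simp only: norm_of_real abs_of_nonneg add_nonneg_nonneg norm_ge_zero zero_le_one)
      then show "((\<lambda>t. 1 / of_real (1 + norm (x s t)) :: complex) \<longlongrightarrow> 0) at_top"
        by (rule tendsto_divide_0[OF tendsto_const])
    qed
    moreover have "(sgn z / u) * (1 - 1 / of_real (1 + norm z)) = M z" for z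
      using nz[of z] u0 by (cases "z = 0") (auto simp: M_def sgn_eq field_simps)
    ultimately have "((\<lambda>t. M (x s t)) \<longlongrightarrow> d s) at_top" using u0 by simp
    from filterlim_compose[OF this t1]
    show "(h s \<longlongrightarrow> h s 1) (at_left 1)" unfolding h01
      by (rule Lim_transform_eventually) (use ev1 in \<open>auto simp: h_def elim: eventually_mono\<close>)
    fix \<theta> :: real assume \<theta>: "0 < \<theta>" "\<theta> < 1"
    have "continuous_on {0<..<1} (\<lambda>\<theta>. M (x s (\<theta> / (1 - \<theta>))))"
    proof (rule continuous_on_compose2[of UNIV M])
      show "continuous_on UNIV M" using Mcont by (simp add: continuous_on_eq_continuous_at)
      show "continuous_on {0<..<1} (\<lambda>\<theta>. x s (\<theta> / (1 - \<theta>)))"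
        by (rule continuous_on_compose2[OF cont[OF that]]) (auto intro!: continuous_intros)
    qed auto
    then have "continuous_on {0<..<1} (h s)"
      by (rule continuous_on_eq) (auto simp: h_def)
    then show "h s \<midarrow>\<theta>\<rightarrow> h s \<theta>" using \<theta>
      by (simp add: continuous_on_eq_continuous_at isCont_def)
  qed auto
  have dnorm: "norm (d s) = 1" for s by (simp add: d_def)
  have dinj: "s = s'" if "s < n" "s' < n" "d s = d s'" for s s'
  proof -
    have "cnj (d s) = cnj (d s')" using that by simp
    then have "cis (2 * pi * real s / real n) = cis (2 * pi * real s' / real n)" by (simp add: d_def cis_cnj)
    then show ?thesis
      using inj_onD[OF bij_betw_imp_inj_on[OF Complex.bij_betw_roots_unity[OF n]], of s s'] that by auto
  qed
  have cases: "(\<exists>z. y = M z \<and> (z = c s \<or> z \<in> x s ` {0<..})) \<or> y = d s" if "y \<in> path_image (h s)" for y s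
    using that himg[of s] by (auto simp: path_image_def)
  \<comment> \<open>Arcs with different roots are disjoint: two branches never share a point, a
    branch never passes through a root, interior points stay inside the open disc, and the endpoints
    on the circle are distinct.\<close>
  have disj: False if "s < n" "s' < n" "c s \<noteq> c s'" "y \<in> path_image (h s)" "y \<in> path_image (h s')" for s s' y
  proof -
    have ss: "s \<noteq> s'" using that by auto
    have Md: "M z \<noteq> d k" "d k \<noteq> M z" for z k using Mnorm[of z] dnorm[of k] by auto
    from cases[OF that(4)] cases[OF that(5)] consider z w where "y = M z" "y = M w"
        "z = c s \<or> z \<in> x s ` {0<..}" "w = c s' \<or> w \<in> x s' ` {0<..}" | "y = d s" "y = d s'"
      using Md by metis
    then show False
    proof cases
      case 1
      then have zw: "z = w" using Minj by metis
      have a: "c s \<notin> x s' ` {0<..}" "c s' \<notin> x s ` {0<..}"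
        using avoid[OF that(1,2)] avoid[OF that(2,1)] by force+
      show False
      proof (cases "z = c s"; cases "w = c s'")
        assume "z \<noteq> c s" "w \<noteq> c s'"
        then obtain t t' where "z = x s t" "t > 0" "w = x s' t'" "t' > 0" using 1 by auto
        then show False using inj[OF that(1,2), of t t'] zw ss by simp
      qed (use 1 zw that(3) a in blast)+
    qed (use dinj[OF that(1,2)] ss in auto)
  qed
  have sub: "path_image (h s) \<subseteq> cball 0 1" for s
    using cases[of _ s] Mnorm dnorm by (force simp: less_imp_le)
  have av: "cis (pi / real n) \<notin> path_image (h s)" if "s < n" for s
  proof
    assume "cis (pi / real n) \<in> path_image (h s)"
    moreover have "cis (pi / real n) \<noteq> M z" for z using Mnorm[of z] by (metis norm_cis less_irrefl)
    ultimately have "cis (pi / real n) = d s" using cases by metis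
    then show False using cayley_circle(2)[OF n that] by (simp add: d_def)
  qed
  have se: "pathstart (h s) = M (c s)" "pathfinish (h s) = d s" for s
    by (auto simp: pathstart_def pathfinish_def h01)
  \<comment> \<open>Two arcs from the same root are joined there, giving a path across the disc from
    index \<open>s1\<close> to \<open>s3\<close>, and likewise from \<open>s2\<close> to
    \<open>s4\<close>. Interlacing forces these to cross, against disjointness.\<close>
  let ?f = "reversepath (h s1) +++ h s3" and ?g = "reversepath (h s2) +++ h s4"
  have img: "path_image ?f = path_image (h s1) \<union> path_image (h s3)" "path_image ?g = path_image (h s2) \<union> path_image (h s4)"
    using c by (simp_all add: path_image_join se)
  have "path_image ?f \<inter> path_image ?g \<noteq> {}"
  proof (rule interlaced_arcs_cross[OF _ _ _ _ _ _ s])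
    show "path ?f" "path ?g" using hpath s c by (auto simp: se)
    show "path_image ?f \<subseteq> cball 0 1" "path_image ?g \<subseteq> cball 0 1" unfolding img using sub by auto
    show "cis (pi / real n) \<notin> path_image ?f" "cis (pi / real n) \<notin> path_image ?g"
      unfolding img using av s by auto
  qed (simp_all add: se d_def)
  then show False unfolding img using disj s c ne by (smt (verit) Int_iff Un_iff all_not_in_conv less_trans)
qed

section \<open>Conjugate roots of unity\<close>

text \<open>Coefficients are kept in the integers and only the point is complex, so that congruences
  modulo a prime remain available for relations between roots of unity.\<close>

definition int_eval :: "int poly \<Rightarrow> complex \<Rightarrow> complex" where
  "int_eval F z = poly (map_poly of_int F) z"

lemma int_eval_pCons [simp]: "int_eval (pCons c F) z = of_int c + z * int_eval F z"
  by (simp add: int_eval_def map_poly_pCons)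

lemma int_eval_0 [simp]: "int_eval 0 z = 0"
  by (simp add: int_eval_def)

lemma int_eval_1 [simp]: "int_eval 1 z = 1"
  by (simp add: one_pCons)

lemma int_eval_add [simp]: "int_eval (F + G) z = int_eval F z + int_eval G z"
  by (induction F G rule: poly_induct2) (auto simp: algebra_simps)

lemma int_eval_smult [simp]: "int_eval (smult c F) z = of_int c * int_eval F z"
  by (induction F) (auto simp: algebra_simps)

lemma int_eval_diff [simp]: "int_eval (F - G) z = int_eval F z - int_eval G z"
  using int_eval_add[of "F - G" G z] by simp

lemma int_eval_mult [simp]: "int_eval (F * G) z = int_eval F z * int_eval G z"
  by (induction F) (auto simp: algebra_simps)

lemma int_eval_power [simp]: "int_eval (F ^ k) z = int_eval F z ^ k"
  by (induction k) auto

lemma int_eval_monom [simp]: "int_eval (monom c k) z = of_int c * z ^ k"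
  by (induction k) (auto simp: monom_0 monom_Suc algebra_simps)

lemma int_eval_pcompose [simp]: "int_eval (pcompose F G) z = int_eval F (int_eval G z)"
  by (induction F) (auto simp: pcompose_pCons)

lemma prime_dvd_binomial_power:
  fixes a b :: "'a :: comm_ring_1"
  assumes q: "prime q"
  shows "of_nat q dvd (a + b) ^ q - a ^ q - b ^ q"
proof -
  have q0: "q > 0" using q prime_gt_0_nat by blast
  have "(a + b) ^ q = (\<Sum>k\<le>q. of_nat (q choose k) * a ^ k * b ^ (q - k))" by (rule binomial_ring)
  also have "{..q} = insert 0 (insert q {1..<q})" using q0 by auto
  also have "(\<Sum>k\<in>\<dots>. of_nat (q choose k) * a ^ k * b ^ (q - k)) =
     b ^ q + (a ^ q + (\<Sum>k\<in>{1..<q}. of_nat (q choose k) * a ^ k * b ^ (q - k)))" using q0 by simp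
  finally have eq: "(a + b) ^ q - a ^ q - b ^ q = (\<Sum>k\<in>{1..<q}. of_nat (q choose k) * a ^ k * b ^ (q - k))" by simp
  show ?thesis unfolding eq
  proof (rule dvd_sum)
    fix k assume "k \<in> {1..<q}"
    then have "q dvd q choose k" using q q0 by (intro dvd_choose_prime) auto
    then have "(of_nat q :: 'a) dvd of_nat (q choose k)" by (metis dvdE dvd_triv_left of_nat_mult)
    then show "of_nat q dvd of_nat (q choose k) * a ^ k * b ^ (q - k)" by (metis dvd_mult2)
  qed
qed

lemma prime_dvd_power_minus_self:
  fixes c :: int
  assumes q: "prime q"
  shows "int q dvd c ^ q - c"
proof (induction c rule: int_induct[of _ 0])
  case base
  show ?case using q prime_gt_0_nat by (simp add: power_0_left)
next
  case (step1 c)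
  have "int q dvd ((c + 1) ^ q - c ^ q - 1 ^ q) + (c ^ q - c)"
    using prime_dvd_binomial_power[OF q, of c 1] step1 by (intro dvd_add) auto
  then show ?case by (simp add: algebra_simps)
next
  case (step2 c)
  have "int q dvd c ^ q - (c - 1) ^ q - 1" using prime_dvd_binomial_power[OF q, of "c - 1" 1] by simp
  from dvd_diff[OF step2(2) this] show ?case by (simp add: algebra_simps)
qed

text \<open>The Frobenius congruence: modulo \<open>q\<close> the power map is additive, fixes the
  integers and sends X to X^q. The induction adds one coefficient at a time.\<close>

lemma prime_dvd_frobenius:
  fixes h :: "int poly"
  assumes q: "prime q"
  shows "of_nat q dvd h ^ q - pcompose h (monom 1 q)"
proof (induction h)
  case 0
  show ?case using q prime_gt_0_nat by (simp add: power_0_left)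
next
  case (pCons c h)
  have 1: "pCons c h = [:c:] + [:0, 1:] * h" by simp
  obtain e where "c ^ q - c = int q * e" using prime_dvd_power_minus_self[OF q, of c] by blast
  then have "[:c:] ^ q - [:c:] = of_nat q * [:e:]"
    by (simp add: poly_const_pow of_nat_poly)
  then have 2: "of_nat q dvd [:c:] ^ q - [:c:]" by (metis dvd_triv_left)
  have X: "[:0, 1::int:] ^ q = monom 1 q" by (simp add: monom_altdef)
  have 3: "pcompose (pCons c h) (monom 1 q) = [:c:] + monom 1 q * pcompose h (monom 1 q)"
    by (simp add: pcompose_pCons)
  have "pCons c h ^ q - pcompose (pCons c h) (monom 1 q) =
    (([:c:] + [:0, 1:] * h) ^ q - [:c:] ^ q - ([:0, 1:] * h) ^ q) + ([:c:] ^ q - [:c:]) +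
     monom 1 q * (h ^ q - pcompose h (monom 1 q))"
    unfolding 1[symmetric] 3 power_mult_distrib X by (simp add: algebra_simps)
  then show ?case
    using prime_dvd_binomial_power[OF q, of "[:c:]" "[:0, 1:] * h"] 2 pCons
    by (metis dvd_add dvd_mult)
qed

text \<open>A nonzero annihilating polynomial of least degree is made primitive. Pseudo-division
  gives divisibility up to an integer factor, and Gauss's lemma on contents removes that
  factor.\<close>

lemma minimal_int_poly:
  assumes F: "F \<noteq> 0" "int_eval F z = 0"
  obtains \<mu> where "\<mu> \<noteq> 0" "int_eval \<mu> z = 0" "\<And>G. int_eval G z = 0 \<Longrightarrow> G = 0 \<or> degree \<mu> \<le> degree G"
    "\<And>G. int_eval G z = 0 \<Longrightarrow> \<mu> dvd G"
proof -
  obtain \<mu>0 where \<mu>0: "\<mu>0 \<noteq> 0" "int_eval \<mu>0 z = 0" "\<And>G. G \<noteq> 0 \<and> int_eval G z = 0 \<Longrightarrow> degree \<mu>0 \<le> degree G"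
    using ex_has_least_nat[of "\<lambda>G. G \<noteq> 0 \<and> int_eval G z = 0" F degree] F by blast
  define \<mu> where "\<mu> = primitive_part \<mu>0"
  have c: "content \<mu>0 \<noteq> 0" using \<mu>0(1) by simp
  have "int_eval (smult (content \<mu>0) \<mu>) z = 0" unfolding \<mu>_def content_times_primitive_part by (rule \<mu>0(2))
  then have z: "int_eval \<mu> z = 0" using c by simp
  have nz: "\<mu> \<noteq> 0" using \<mu>0(1) by (simp add: \<mu>_def)
  have min: "G = 0 \<or> degree \<mu> \<le> degree G" if "int_eval G z = 0" for G
    using \<mu>0(3)[of G] that by (auto simp: \<mu>_def)
  have c1: "content \<mu> = 1" using \<mu>0(1) by (simp add: \<mu>_def)
  have "\<mu> dvd G" if G: "int_eval G z = 0" for G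
  proof -
    obtain a s where as: "a \<noteq> 0" "smult a G = \<mu> * s + pseudo_mod G \<mu>" using pseudo_mod(1)[OF nz] by blast
    have "int_eval (smult a G) z = 0" using G by simp
    then have "int_eval (pseudo_mod G \<mu>) z = 0" unfolding as(2) using z by simp
    then have "pseudo_mod G \<mu> = 0" using min pseudo_mod(2)[OF nz, of G] by fastforce
    then have eq: "smult a G = \<mu> * s" using as(2) by simp
    then have "content (smult a G) = content s" using c1 by (simp add: content_mult)
    then have "a dvd content s" by (metis content_smult dvd_triv_left normalize_dvd_iff)
    then have "[:a:] dvd s" by (simp add: const_poly_dvd_iff_dvd_content)
    then obtain s' where "s = [:a:] * s'" by blast
    then have "smult a G = smult a (\<mu> * s')" using eq by simp
    then have "smult a (G - \<mu> * s') = 0" by (simp add: smult_diff_right)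
    then show ?thesis using as(1) by simp
  qed
  then show ?thesis using that nz z min by blast
qed

text \<open>The classical proof that cyclotomic polynomials are irreducible: if \<open>\<zeta>\<close> and \<open>\<zeta>^q\<close> were not
  conjugate, \<open>X^n - 1\<close> would have a repeated factor modulo \<open>q\<close>.\<close>
lemma int_eval_prime_power_root_of_unity:
  assumes q: "prime q" "\<not> q dvd n" and n: "n > 0" and z: "z ^ n = 1" and f: "int_eval f z = 0"
  shows "int_eval f (z ^ q) = 0"
proof -
  let ?X = "monom 1 n - 1 :: int poly"
  have X: "?X \<noteq> 0"
  proof
    assume "?X = 0"
    then have "coeff (monom 1 n - 1 :: int poly) n = 0" by simp
    then show False using n by (simp add: coeff_1)
  qed
  have Xz: "int_eval ?X z = 0" using z by simp
  obtain \<mu> where \<mu>: "\<mu> \<noteq> 0" "int_eval \<mu> z = 0" "\<And>G. int_eval G z = 0 \<Longrightarrow> G = 0 \<or> degree \<mu> \<le> degree G"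
    "\<And>G. int_eval G z = 0 \<Longrightarrow> \<mu> dvd G"
    using minimal_int_poly[OF X Xz] by blast
  obtain h where h: "?X = \<mu> * h" using \<mu>(4)[OF Xz] by blast
  obtain g where g: "f = \<mu> * g" using \<mu>(4)[OF f] by blast
  have "int_eval ?X (z ^ q) = 0" using z by (simp add: power_mult[symmetric] mult.commute[of q] power_mult)
  then have "int_eval \<mu> (z ^ q) = 0 \<or> int_eval h (z ^ q) = 0" unfolding h by simp
  \<comment> \<open>The Frobenius congruence places h(z)^q in q Z[z]. Differentiating X^n - 1 =
    \<mu> h at z gives n z^(n-1) = h(z) \<mu>'(z), so n^q lies in q Z[z] as well; it remains to
    descend from Z[z] to the integers.\<close>
  moreover have False if hq: "int_eval h (z ^ q) = 0"
  proof -
    obtain w where w: "h ^ q - pcompose h (monom 1 q) = of_nat q * w" using prime_dvd_frobenius[OF q(1)] by blast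
    from arg_cong[OF w, of "\<lambda>p. int_eval p z"] hq
    have hw: "int_eval h z ^ q = of_nat q * int_eval w z" by (simp add: of_nat_poly)
    have "pderiv ?X = monom (int n) (n - 1)" by (simp add: pderiv_diff pderiv_monom)
    then have "monom (int n) (n - 1) = \<mu> * pderiv h + h * pderiv \<mu>" unfolding h by (simp add: pderiv_mult)
    from arg_cong[OF this, of "\<lambda>p. int_eval p z"] \<mu>(2)
    have "of_nat n * z ^ (n - 1) = int_eval h z * int_eval (pderiv \<mu>) z" by simp
    then have "(z * (of_nat n * z ^ (n - 1))) ^ q = (z * (int_eval h z * int_eval (pderiv \<mu>) z)) ^ q" by simp
    moreover have "z * (of_nat n * z ^ (n - 1)) = of_nat n"
      using z n by (metis mult.left_commute mult.right_neutral power_eq_if not_gr_zero)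
    ultimately have "of_nat n ^ q = (z * (int_eval h z * int_eval (pderiv \<mu>) z)) ^ q" by (simp only:)
    also have "\<dots> = int_eval h z ^ q * (z * int_eval (pderiv \<mu>) z) ^ q" by (simp add: power_mult_distrib)
    finally have nq: "of_nat n ^ q = of_nat q * int_eval (w * (pCons 0 (pderiv \<mu>)) ^ q) z"
      unfolding hw by simp
    define v where "v = w * (pCons 0 (pderiv \<mu>)) ^ q"
    have "lead_coeff ?X = 1"
    proof -
      have "degree (monom 1 n + - 1 :: int poly) = degree (monom 1 n :: int poly)"
        by (rule degree_add_eq_left) (use n in \<open>simp add: degree_monom_eq\<close>)
      then have "degree ?X = n" by (simp add: degree_monom_eq)
      then show ?thesis using n by (simp add: coeff_1)
    qed
    \<comment> \<open>As the leading coefficient of \<open>\<mu>\<close> is a unit, pseudo-division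
      by it introduces only a sign \<open>e\<close> and no denominators.\<close>
    then have "lead_coeff \<mu> dvd 1" unfolding h lead_coeff_mult by (metis dvd_triv_left)
    then have lc: "\<bar>lead_coeff \<mu>\<bar> = 1" by simp
    obtain s r where sr: "pseudo_divmod v \<mu> = (s, r)" by fastforce
    define e where "e = lead_coeff \<mu> ^ (Suc (degree v) - degree \<mu>)"
    have e: "\<bar>e\<bar> = 1" unfolding e_def using lc by (simp add: power_abs)
    have vs: "smult e v = \<mu> * s + r" "r = 0 \<or> degree r < degree \<mu>"
      using pseudo_divmod[OF \<mu>(1) sr] by (auto simp: e_def)
    have "of_int e * int_eval v z = int_eval r z"
      using arg_cong[OF vs(1), of "\<lambda>p. int_eval p z"] \<mu>(2) by simp
    \<comment> \<open>This polynomial vanishes at \<open>z\<close> and has degree below that of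
      \<open>\<mu>\<close>, so it is zero; its constant coefficient yields the divisibility by
      \<open>q\<close>.\<close>
    then have "int_eval ([:e * int n ^ q:] - smult (int q) r) z = of_int e * (of_nat n ^ q - of_nat q * int_eval v z)"
      by (simp add: algebra_simps)
    also have "\<dots> = 0" using nq by (simp add: v_def)
    finally have root: "int_eval ([:e * int n ^ q:] - smult (int q) r) z = 0" .
    have "degree \<mu> > 0"
    proof (rule ccontr)
      assume "\<not> ?thesis"
      then obtain c where "\<mu> = [:c:]" using degree_eq_zeroE by blast
      then show False using \<mu>(1,2) by simp
    qed
    then have "degree ([:e * int n ^ q:] - smult (int q) r) < degree \<mu>"
      using vs(2) by (intro le_less_trans[OF degree_diff_le_max]) auto
    then have "[:e * int n ^ q:] - smult (int q) r = 0" using \<mu>(3)[OF root] by auto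
    then have "coeff [:e * int n ^ q:] 0 = coeff (smult (int q) r) 0" by simp
    then have "int q dvd e * int n ^ q" by simp
    then have "int q dvd int n ^ q" using e by (metis abs_dvd_iff dvd_abs_iff mult_1 abs_mult)
    then have "int q dvd int n" using q(1) by (metis prime_dvd_power prime_nat_int_transfer)
    then show False using q(2) by simp
  qed
  ultimately show ?thesis unfolding g by auto
qed

lemma int_eval_coprime_power_root_of_unity:
  assumes n: "n > 0" and "coprime l n" and "z ^ n = 1" and "int_eval f z = 0" and "l > 0"
  shows "int_eval f (z ^ l) = 0"
  using assms(2-)
proof (induction l arbitrary: z rule: less_induct)
  case (less l)
  show ?case
  proof (cases "l = 1")
    case False
    then obtain q where q: "prime q" "q dvd l" using prime_factor_nat by blast
    then obtain m where m: "l = q * m" by blast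
    have cop: "coprime q n" "coprime m n" using less.prems(1) by (auto simp: m)
    have "\<not> q dvd n" using cop(1) q(1) by (metis coprime_absorb_left not_prime_unit)
    then have "int_eval f (z ^ q) = 0" using int_eval_prime_power_root_of_unity[OF q(1) _ n less.prems(2,3)] by blast
    moreover have "m < l" "m > 0" using less.prems(4) prime_gt_1_nat[OF q(1)] by (auto simp: m)
    moreover have "(z ^ q) ^ n = 1" using less.prems(2) by (metis mult.commute power_mult power_one)
    ultimately have "int_eval f ((z ^ q) ^ m) = 0" using less.IH cop(2) by blast
    then show ?thesis by (simp add: m power_mult)
  qed (use less.prems in simp)
qed

lemma coprime_exponent_root_of_unity_sum:
  fixes f :: "nat \<Rightarrow> int"
  assumes n: "n > 0" and l: "coprime l n" and sum: "(\<Sum>s<n. of_int (f s) * cis (2 * pi * s / n) ^ l) = 0"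
  shows "(\<Sum>s<n. of_int (f s) * cis (2 * pi * s / n)) = 0"
proof -
  let ?z = "cis (2 * pi / n)"
  have zs: "cis (2 * pi * s / n) = ?z ^ s" for s :: nat by (simp add: Complex.DeMoivre mult.commute)
  have zn: "?z ^ n = 1" using n by (simp add: Complex.DeMoivre)
  define F where "F = (\<Sum>s<n. monom (f s) s)"
  have F: "int_eval F w = (\<Sum>s<n. of_int (f s) * w ^ s)" for w
  proof -
    have "int_eval (\<Sum>s\<in>S. monom (f s) s) w = (\<Sum>s\<in>S. of_int (f s) * w ^ s)" if "finite S" for S
      using that by induction auto
    then show ?thesis by (simp add: F_def)
  qed
  obtain i where i: "[l * i = 1] (mod n)" using l cong_solve_coprime_nat[of l n] by auto
  have "coprime (l * i) n" using i cong_imp_coprime[of 1 "l * i" n] by (simp add: cong_sym)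
  then have "coprime i n" by simp
  \<comment> \<open>The inverse \<open>i\<close> of \<open>l\<close> modulo \<open>n\<close> may be
    0 when \<open>n = 1\<close>. Adding \<open>n\<close> keeps the residue class and makes the
    exponent positive.\<close>
  then have cop: "coprime (i + n) n" by (simp add: coprime_iff_gcd_eq_1)
  have red: "?z ^ j = ?z ^ (j mod n)" for j
  proof -
    have "?z ^ j = ?z ^ (n * (j div n) + j mod n)" by simp
    also have "\<dots> = ?z ^ (j mod n)" unfolding power_add power_mult zn by simp
    finally show ?thesis .
  qed
  have "l * (i + n) mod n = 1 mod n" using i by (simp add: cong_def algebra_simps)
  then have inv: "?z ^ (l * (i + n)) = ?z" using red[of "l * (i + n)"] red[of 1] by simp
  have "int_eval F (?z ^ l) = 0" using sum unfolding F zs by (simp add: power_mult[symmetric] mult.commute)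
  moreover have "(?z ^ l) ^ n = 1" using zn by (metis mult.commute power_mult power_one)
  ultimately have "int_eval F ((?z ^ l) ^ (i + n)) = 0"
    using int_eval_coprime_power_root_of_unity[OF n cop] n by simp
  also have "(?z ^ l) ^ (i + n) = ?z" using inv by (simp only: power_mult)
  finally show ?thesis unfolding F zs .
qed

section \<open>The Puiseux expansion at infinity\<close>

text \<open>The product of sines \<open>w s\<close> is an affine function of the point of index
  \<open>s\<close> on the circle; it vanishes on the chord through the points \<open>i0\<close> and
  \<open>i1\<close>, or on the tangent if they coincide. The sign pattern makes every
  \<open>F s * w s\<close> nonnegative and one of them positive, while both vanishing sums would
  make the total 0.\<close>

lemma separated_weights_sum_nonzero:
  fixes F :: "nat \<Rightarrow> real"
  assumes n: "n > 0" and i: "i0 \<le> i1" "i1 < n" and neg: "\<And>s. s < n \<Longrightarrow> F s < 0 \<Longrightarrow> i0 \<le> s \<and> s \<le> i1"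
    and pos: "\<And>s. s < n \<Longrightarrow> F s > 0 \<Longrightarrow> s < i0 \<or> i1 < s"
    and ex: "s0 < n" "F s0 > 0" and sum0: "(\<Sum>s<n. F s) = 0"
  shows "(\<Sum>s<n. of_real (F s) * cis (2 * pi * s / n)) \<noteq> 0"
proof
  assume S0: "(\<Sum>s<n. of_real (F s) * cis (2 * pi * s / n)) = 0"
  define w where "w = (\<lambda>s. sin (pi * (real s - real i0) / n) * sin (pi * (real s - real i1) / n))"
  have sp: "sin (pi * y / n) > 0" if "0 < y" "y < n" for y :: real
    using that n by (intro sin_gt_zero) (auto simp: field_simps)
  have sn: "sin (pi * y / n) < 0" if "- real n < y" "y < 0" for y :: real
    using sp[of "- y"] that by simp
  have sp0: "sin (pi * y / n) \<ge> 0" if "0 \<le> y" "y < n" for y :: real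
    using sp[of y] that by (cases "y = 0") auto
  have sn0: "sin (pi * y / n) \<le> 0" if "- real n < y" "y \<le> 0" for y :: real
    using sn[of y] that by (cases "y = 0") auto
  have w_in: "w s \<le> 0" if "i0 \<le> s" "s \<le> i1" "s < n" for s
    unfolding w_def using that i by (intro mult_nonneg_nonpos sp0 sn0) auto
  have w_out: "w s > 0" if "s < i0 \<or> i1 < s" "s < n" for s
    using that(1)
  proof
    assume "s < i0"
    then show ?thesis unfolding w_def using that i by (intro mult_neg_neg sn) auto
  next
    assume "i1 < s"
    then show ?thesis unfolding w_def using that i by (intro mult_pos_pos sp) auto
  qed
  have nn: "F s * w s \<ge> 0" if "s < n" for s
  proof (cases "F s" "0 :: real" rule: linorder_cases)
    case less
    then show ?thesis using w_in neg[OF that] that by (intro mult_nonpos_nonpos) auto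
  next
    case greater
    then show ?thesis using w_out[OF pos[OF that]] that by simp
  qed simp
  have "(\<Sum>s<n. F s * w s) > 0"
  proof (rule sum_pos2[of _ s0])
    show "0 < F s0 * w s0" using w_out[OF pos[OF ex] ex(1)] ex(2) by simp
  qed (use nn ex in auto)
  moreover have "(\<Sum>s<n. F s * w s) = 0"
  proof -
    let ?th = "pi * (real i0 + real i1) / n" and ?c = "cos (pi * (real i1 - real i0) / n)"
    have w: "w s = (?c - Re (cis (2 * pi * s / n) * cis (- ?th))) / 2" for s
    proof -
      have "sin (pi * (real s - real i0) / n) * sin (pi * (real s - real i1) / n) =
        (cos (pi * (real s - real i0) / n - pi * (real s - real i1) / n) -
         cos (pi * (real s - real i0) / n + pi * (real s - real i1) / n)) / 2"
        by (rule sin_times_sin)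
      also have "pi * (real s - real i0) / n - pi * (real s - real i1) / n = pi * (real i1 - real i0) / n"
        by (simp add: diff_divide_distrib[symmetric]) (simp add: algebra_simps)
      also have "pi * (real s - real i0) / n + pi * (real s - real i1) / n = 2 * pi * s / n + - ?th"
        by (simp add: add_divide_distrib[symmetric] diff_divide_distrib[symmetric]) (simp add: algebra_simps)
      finally show ?thesis unfolding w_def cis_mult by simp
    qed
    have "(\<Sum>s<n. F s * w s) = (?c * (\<Sum>s<n. F s) - Re ((\<Sum>s<n. of_real (F s) * cis (2 * pi * s / n)) * cis (- ?th))) / 2"
      unfolding w sum_distrib_left sum_distrib_right Re_sum sum_subtractf[symmetric] sum_divide_distrib
      by (intro sum.cong refl) (simp add: field_simps)
    then show ?thesis unfolding S0 sum0 by simp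
  qed
  ultimately show False by simp
qed

text \<open>Without the alternating patterns, one of the two sign classes has an index interval that
  the other class does not enter, so a chord separates them; exchanging signs covers both
  possibilities.\<close>

lemma noninterlaced_weights_sum_nonzero:
  fixes F :: "nat \<Rightarrow> real"
  assumes n: "n > 0" and sum0: "(\<Sum>s<n. F s) = 0" and ex: "s0 < n" "F s0 \<noteq> 0"
    and ni: "\<And>s1 s2 s3 s4. s1 < s2 \<Longrightarrow> s2 < s3 \<Longrightarrow> s3 < s4 \<Longrightarrow> s4 < n \<Longrightarrow>
      F s1 > 0 \<and> F s2 < 0 \<and> F s3 > 0 \<and> F s4 < 0 \<or> F s1 < 0 \<and> F s2 > 0 \<and> F s3 < 0 \<and> F s4 > 0 \<Longrightarrow> False"
  shows "(\<Sum>s<n. of_real (F s) * cis (2 * pi * s / n)) \<noteq> 0"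
proof -
  define A where "A = {s. s < n \<and> F s > 0}"
  define B where "B = {s. s < n \<and> F s < 0}"
  have fin: "finite A" "finite B" by (auto simp: A_def B_def)
  have ne: "A \<noteq> {}" "B \<noteq> {}"
  proof -
    show "A \<noteq> {}"
    proof
      assume "A = {}"
      then have le: "F s \<le> 0" if "s < n" for s using that by (force simp: A_def)
      then have "(\<Sum>s<n. - F s) > 0" using ex by (intro sum_pos2[of _ s0]) (auto simp: less_le)
      then show False using sum0 by (simp add: sum_negf)
    qed
    show "B \<noteq> {}"
    proof
      assume "B = {}"
      then have le: "F s \<ge> 0" if "s < n" for s using that by (force simp: B_def)
      then have "(\<Sum>s<n. F s) > 0" using ex by (intro sum_pos2[of _ s0]) (auto simp: less_le)
      then show False using sum0 by simp
    qed
  qed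
  have mA: "Min A \<in> A" "Max A \<in> A" and mB: "Min B \<in> B" "Max B \<in> B" using fin ne by auto
  show ?thesis
  \<comment> \<open>If some positive index lies between the extreme negative ones, then all of
    \<open>A\<close> does, since an outlier would give an alternating quadruple; for the same reason
    \<open>B\<close> then avoids the interval from \<open>Min A\<close> to
    \<open>Max A\<close>.\<close>
  proof (cases "\<exists>a\<in>A. Min B < a \<and> a < Max B")
    case False
    show ?thesis
    proof (rule separated_weights_sum_nonzero[OF n, of "Min B" "Max B" F "Min A"])
      show "s < Min B \<or> Max B < s" if "s < n" "0 < F s" for s
      proof (rule ccontr)
        assume "\<not> ?thesis"
        moreover have "s \<in> A" "s \<noteq> Min B" "s \<noteq> Max B" using that mB by (auto simp: A_def B_def)
        ultimately show False using False by force
      qed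
      show "Min B \<le> Max B" using fin ne by simp
    qed (use mA mB fin sum0 in \<open>auto simp: A_def B_def\<close>)
  next
    case True
    then obtain a where a: "a \<in> A" "Min B < a" "a < Max B" by blast
    have A1: "Min B < Min A"
    proof (rule ccontr)
      assume "\<not> ?thesis"
      moreover have "Min A \<noteq> Min B" using mA mB by (auto simp: A_def B_def)
      ultimately have "Min A < Min B" by simp
      from ni[OF this a(2,3)] show False using mA mB a by (auto simp: A_def B_def)
    qed
    have A2: "Max A < Max B"
    proof (rule ccontr)
      assume "\<not> ?thesis"
      moreover have "Max A \<noteq> Max B" using mA mB by (auto simp: A_def B_def)
      ultimately have "Max B < Max A" by simp
      from ni[OF a(2,3) this] show False using mA mB a by (auto simp: A_def B_def)
    qed
    have "(\<Sum>s<n. of_real (- F s) * cis (2 * pi * s / n)) \<noteq> 0"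
    proof (rule separated_weights_sum_nonzero[OF n, of "Min A" "Max A" "\<lambda>s. - F s" "Min B"])
      show "s < Min A \<or> Max A < s" if "s < n" "0 < - F s" for s
      proof (rule ccontr)
        assume "\<not> ?thesis"
        moreover have "s \<in> B" "s \<noteq> Min A" "s \<noteq> Max A" using that mA by (auto simp: A_def B_def)
        ultimately have "Min A < s" "s < Max A" by auto
        from ni[OF A1 this] show False using mA mB \<open>s \<in> B\<close> by (auto simp: A_def B_def)
      qed
      show "Min A \<le> Max A" using fin ne by simp
    qed (use mA mB fin sum0 in \<open>auto simp: A_def B_def sum_negf\<close>)
    then show ?thesis by (simp add: sum_negf)
  qed
qed

text \<open>Finitely many directions are bad and the circle is infinite. The bound
  \<open>t \<le> 0\<close> leaves room for the critical value 0, which no rotation moves and which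
  occurs as soon as \<open>P\<close> has a multiple root.\<close>

lemma rotation_avoiding_critical_values:
  fixes P :: "complex poly"
  assumes n: "degree P > 0"
  obtains \<gamma> where "norm \<gamma> = 1" "\<And>x t. poly (pderiv P) x = 0 \<Longrightarrow> \<gamma> * poly P x = complex_of_real t \<Longrightarrow> t \<le> 0"
proof -
  let ?V = "poly P ` {x. poly (pderiv P) x = 0}"
  have "pderiv P \<noteq> 0" using n by (simp add: pderiv_eq_0_iff)
  then have "finite ?V" using poly_roots_finite by blast
  then have "finite ((\<lambda>v. cnj (sgn v)) ` ?V)" by simp
  moreover have "infinite (sphere (0::complex) 1)"
  proof -
    have "connected (sphere (0::complex) 1)" by (rule connected_sphere) simp
    moreover have "1 \<in> sphere (0::complex) 1" "-1 \<in> sphere (0::complex) 1" by auto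
    moreover have "(1::complex) \<noteq> -1" by simp
    ultimately show ?thesis using connected_finite_iff_sing[of "sphere (0::complex) 1"] by (metis emptyE singletonD)
  qed
  ultimately obtain \<gamma> where \<gamma>: "\<gamma> \<in> sphere 0 1" "\<gamma> \<notin> (\<lambda>v. cnj (sgn v)) ` ?V"
    by (meson finite_subset subsetI)
  show ?thesis
  proof (rule that[of \<gamma>])
    show "norm \<gamma> = 1" using \<gamma>(1) by simp
    fix x t assume x: "poly (pderiv P) x = 0" "\<gamma> * poly P x = complex_of_real t"
    show "t \<le> 0"
    proof (rule ccontr)
      assume "\<not> t \<le> 0"
      then have t: "t > 0" by simp
      have "sgn \<gamma> * sgn (poly P x) = 1" using arg_cong[OF x(2), of sgn] t by (simp add: sgn_mult sgn_of_real)
      then have *: "\<gamma> * sgn (poly P x) = 1" using \<open>norm \<gamma> = 1\<close> by (simp add: sgn_eq)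
      have "poly P x \<noteq> 0" using * by auto
      then have "sgn (poly P x) * cnj (sgn (poly P x)) = 1"
        by (simp add: complex_norm_square[symmetric] norm_sgn)
      then have "\<gamma> = cnj (sgn (poly P x))" using * by (metis mult.assoc mult.commute mult.right_neutral)
      then show False using \<gamma>(2) x(1) by blast
    qed
  qed
qed

text \<open>The slope of the sector is the least ratio of imaginary to real part, in absolute value,
  among the critical values with positive real part. Convexity supplies the simple connectivity
  needed for lifts and logarithms.\<close>

lemma sector_avoiding_critical_values:
  fixes P :: "complex poly"
  assumes n: "degree P > 0" and crit: "\<And>x t. poly (pderiv P) x = 0 \<Longrightarrow> poly P x = complex_of_real t \<Longrightarrow> t \<le> 0"
  obtains U where "open U" "convex U" "0 \<notin> U" "\<And>t::real. t > 0 \<Longrightarrow> of_real t \<in> U"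
    "\<And>x. poly P x \<in> U \<Longrightarrow> poly (pderiv P) x \<noteq> 0"
proof -
  let ?V = "poly P ` {x. poly (pderiv P) x = 0}"
  have "pderiv P \<noteq> 0" using n by (simp add: pderiv_eq_0_iff)
  then have fin: "finite ?V" using poly_roots_finite by blast
  \<comment> \<open>The element 1 keeps the set nonempty when no critical value has positive real
    part.\<close>
  define S where "S = insert 1 ((\<lambda>v. \<bar>Im v\<bar> / Re v) ` {v \<in> ?V. Re v > 0})"
  define k where "k = Min S"
  have fS: "finite S" using fin by (simp add: S_def)
  have Spos: "s > 0" if "s \<in> S" for s
  proof -
    have "Im v \<noteq> 0" if v: "v \<in> ?V" "Re v > 0" for v
    proof
      assume "Im v = 0"
      then have "v = of_real (Re v)" by (simp add: complex_eq_iff)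
      moreover obtain x where "v = poly P x" "poly (pderiv P) x = 0" using v(1) by blast
      ultimately show False using crit[of x "Re v"] v(2) by simp
    qed
    then have "\<bar>Im v\<bar> / Re v > 0" if "v \<in> ?V" "Re v > 0" for v using that by (simp del: image_iff)
    moreover have "s = 1 \<or> (\<exists>v. v \<in> ?V \<and> Re v > 0 \<and> s = \<bar>Im v\<bar> / Re v)"
      using that unfolding S_def by (elim insertE imageE CollectE) auto
    ultimately show ?thesis by (elim disjE exE conjE) simp_all
  qed
  have "S \<noteq> {}" by (simp add: S_def)
  then have k: "k > 0" unfolding k_def using Min_in[OF fS] Spos by blast
  have kle: "k \<le> s" if "s \<in> S" for s using fS that by (simp add: k_def)
  let ?U = "{t. inner (Complex (-1) 0) t < 0} \<inter> {t. inner (Complex (-k) 1) t < 0} \<inter> {t. inner (Complex (-k) (-1)) t < 0}"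
  have U: "t \<in> ?U \<longleftrightarrow> Re t > 0 \<and> \<bar>Im t\<bar> < k * Re t" for t
    by (auto simp: inner_complex_def)
  show ?thesis
  proof (rule that[of ?U])
    show "open ?U" by (intro open_Int open_halfspace_lt)
    show "convex ?U" by (intro convex_Int convex_halfspace_lt)
    show "0 \<notin> ?U" by simp
    show "of_real t \<in> ?U" if "t > 0" for t :: real unfolding U using that k by simp
    fix x assume x: "poly P x \<in> ?U"
    show "poly (pderiv P) x \<noteq> 0"
    proof
      assume "poly (pderiv P) x = 0"
      then have "\<bar>Im (poly P x)\<bar> / Re (poly P x) \<in> S" using x unfolding U S_def by auto
      from kle[OF this] show False using x unfolding U by (simp add: field_simps)
    qed
  qed
qed

lemma moments_vanish_smult: "moments_vanish P Q a b \<Longrightarrow> moments_vanish (smult \<gamma> P) Q a b"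
  unfolding moments_vanish_def
proof (intro allI impI)
  fix k F
  assume mom: "\<forall>k F. pderiv F = P ^ k * pderiv Q \<longrightarrow> poly F a = poly F b" and F: "pderiv F = smult \<gamma> P ^ k * pderiv Q"
  obtain G where G: "pderiv G = P ^ k * pderiv Q" using poly_antiderivative by blast
  have "pderiv (F - smult (\<gamma> ^ k) G) = 0"
    by (simp add: pderiv_diff pderiv_smult F G smult_power)
  then have "degree (F - smult (\<gamma> ^ k) G) = 0" by (simp add: pderiv_eq_0_iff)
  then obtain c where c: "F - smult (\<gamma> ^ k) G = [:c:]" using degree_eq_zeroE by blast
  have "poly F x - \<gamma> ^ k * poly G x = c" for x
    using arg_cong[OF c, of "\<lambda>p. poly p x"] by simp
  moreover have "poly G a = poly G b" using mom G by blast
  ultimately show "poly F a = poly F b" by (metis diff_add_cancel)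
qed

lemma moments_vanish_const [simp]: "moments_vanish P [:c:] a b"
  unfolding moments_vanish_def
proof (intro allI impI)
  fix k F assume "pderiv F = P ^ k * pderiv [:c:]"
  then have "pderiv F = 0" by (simp add: pderiv_pCons)
  then have "degree F = 0" by (simp add: pderiv_eq_0_iff)
  then obtain d where "F = [:d:]" using degree_eq_zeroE by blast
  then show "poly F a = poly F b" by simp
qed

text \<open>Near 0, \<open>\<psi> w\<close> behaves like \<open>\<kappa> / w\<close>, so the angle
  of \<open>w\<close> enters the direction of the branch with the opposite sign.\<close>

lemma branch_directions:
  fixes x :: "real \<Rightarrow> complex"
  assumes n: "n > 0" and \<kappa>: "\<kappa> \<noteq> 0" "((\<lambda>w. w * \<psi> w) \<longlongrightarrow> \<kappa>) (at 0)"
    and x: "\<And>t. t > T \<Longrightarrow> x t = \<psi> (cis \<theta> * of_real (1 / root n t))"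
  shows "filterlim x at_infinity at_top" and "((\<lambda>t. sgn (x t)) \<longlongrightarrow> sgn \<kappa> * cis (- \<theta>)) at_top"
proof -
  let ?w = "\<lambda>t. cis \<theta> * complex_of_real (1 / root n t)"
  have r: "filterlim (root n) at_top at_top"
    unfolding filterlim_at_top
  proof
    fix Z :: real
    have "root n t \<ge> Z" if "t \<ge> max 0 Z ^ n" for t
    proof -
      have "max 0 Z = root n (max 0 Z ^ n)" using n by (simp add: real_root_power_cancel)
      also have "\<dots> \<le> root n t" using n that by (intro real_root_le_mono) auto
      finally show ?thesis by simp
    qed
    then show "\<forall>\<^sub>F t in at_top. Z \<le> root n t" by (auto simp: eventually_at_top_linorder)
  qed
  have "((\<lambda>t. 1 / root n t) \<longlongrightarrow> 0) at_top" using tendsto_inverse_0_at_top[OF r] by (simp add: inverse_eq_divide)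
  then have "(?w \<longlongrightarrow> cis \<theta> * of_real 0) at_top" by (intro tendsto_intros tendsto_of_real)
  moreover have rp: "root n t > 0" if "t > 0" for t using that n by simp
  have "\<forall>\<^sub>F t in at_top. ?w t \<noteq> 0"
    using eventually_gt_at_top[of 0] by eventually_elim (use rp in force)
  ultimately have w0: "filterlim ?w (at 0) at_top" by (simp add: filterlim_at)
  have lim: "((\<lambda>t. ?w t * \<psi> (?w t)) \<longlongrightarrow> \<kappa>) at_top" by (rule filterlim_compose[OF \<kappa>(2) w0])
  have ev: "\<forall>\<^sub>F t in at_top. t > T \<and> t > 0" using eventually_gt_at_top[of "max T 0"] by (auto elim: eventually_mono)
  have "filterlim (\<lambda>t. (?w t * \<psi> (?w t)) * inverse (?w t)) at_infinity at_top"
    by (rule tendsto_mult_filterlim_at_infinity[OF lim \<kappa>(1)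
          filterlim_compose[OF filterlim_inverse_at_infinity w0]])
  moreover have eqx: "\<forall>\<^sub>F t in at_top. (?w t * \<psi> (?w t)) * inverse (?w t) = x t"
    using ev
  proof eventually_elim
    case (elim t)
    then have "?w t \<noteq> 0" using rp[of t] by simp
    then show ?case using x[of t] elim by simp
  qed
  ultimately show "filterlim x at_infinity at_top" 
    using filterlim_cong[OF refl refl eqx] by blast
  have "((\<lambda>t. sgn (?w t * \<psi> (?w t)) * cis (- \<theta>)) \<longlongrightarrow> sgn \<kappa> * cis (- \<theta>)) at_top"
    by (intro tendsto_intros lim \<kappa>(1))
  moreover have "\<forall>\<^sub>F t in at_top. sgn (?w t * \<psi> (?w t)) * cis (- \<theta>) = sgn (x t)"
    using ev
  proof eventually_elim
    case (elim t)
    then have sw: "sgn (?w t) = cis \<theta>" using rp[of t] by (simp add: sgn_mult sgn_divide sgn_of_real sgn_eq norm_divide)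
    have "sgn (?w t * \<psi> (?w t)) * cis (- \<theta>) = (cis \<theta> * cis (- \<theta>)) * sgn (\<psi> (?w t))"
      unfolding sgn_mult[of "?w t" "\<psi> (?w t)"] sw by (simp only: mult_ac)
    then show ?case using elim by (simp add: cis_mult x)
  qed
  ultimately show "((\<lambda>t. sgn (x t)) \<longlongrightarrow> sgn \<kappa> * cis (- \<theta>)) at_top" by (rule Lim_transform_eventually)
qed

text \<open>\<open>\<psi>\<close> is the inverse of \<open>P\<close> at infinity in the coordinate \<open>w = (P / \<gamma>)^(-1/n)\<close>; the sum isolates the terms
  of the Puiseux expansion of \<open>Q\<close> whose exponent in \<open>1 / w\<close> is congruent to \<open>j\<close> modulo \<open>n\<close>.\<close>
lemma root_of_unity_component_vanishes:
  fixes P :: "complex poly"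
  assumes n: "degree P = n" "n > 0" and Pab: "poly P a = 0" "poly P b = 0" and ab: "a \<noteq> b"
  obtains r \<psi> \<kappa> \<gamma> where "r > 0" "\<psi> holomorphic_on ball 0 r - {0}" "inj_on \<psi> (ball 0 r - {0})"
    "\<kappa> \<noteq> 0" "((\<lambda>w. w * \<psi> w) \<longlongrightarrow> \<kappa>) (at 0)"
    "\<And>w. w \<in> ball 0 r - {0} \<Longrightarrow> poly P (\<psi> w) = \<gamma> / w ^ n"
    "\<And>Q j w. moments_vanish P Q a b \<Longrightarrow> coprime j n \<Longrightarrow> w \<in> ball 0 r - {0} \<Longrightarrow>
        (\<Sum>z | z ^ n = 1. z ^ j * poly Q (\<psi> (z * w))) = 0"
proof -
  have n0: "degree P > 0" using n by simp
  obtain \<gamma> where \<gamma>: "norm \<gamma> = 1" "\<And>x t. poly (pderiv P) x = 0 \<Longrightarrow> \<gamma> * poly P x = complex_of_real t \<Longrightarrow> t \<le> 0"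
    using rotation_avoiding_critical_values[OF n0] by blast
  have \<gamma>0: "\<gamma> \<noteq> 0" using \<gamma>(1) by auto
  define R where "R = smult \<gamma> P"
  have R: "degree R = n" "poly R a = 0" "poly R b = 0" "R \<noteq> 0" using n Pab \<gamma>0 by (auto simp: R_def)
  have R0: "degree R > 0" using R n by simp
  obtain U where U: "open U" "convex U" "0 \<notin> U" and posU: "\<And>t::real. t > 0 \<Longrightarrow> of_real t \<in> U"
    and sep: "\<And>x. poly R x \<in> U \<Longrightarrow> poly (pderiv R) x \<noteq> 0"
  proof (rule sector_avoiding_critical_values[OF R0])
    show "t \<le> 0" if "poly (pderiv R) x = 0" "poly R x = complex_of_real t" for x t
      using \<gamma>(2)[of x t] that \<gamma>0 by (simp add: R_def pderiv_smult)
  qed blast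
  obtain x \<psi> \<kappa> r T where \<psi>: "r > 0" "\<psi> holomorphic_on ball 0 r - {0}" "inj_on \<psi> (ball 0 r - {0})"
    "\<kappa> \<noteq> 0" "((\<lambda>w. w * \<psi> w) \<longlongrightarrow> \<kappa>) (at 0)"
    "\<And>w. w \<in> ball 0 r - {0} \<Longrightarrow> poly R (\<psi> w) = 1 / w ^ n"
    and x: "\<And>s. s < n \<Longrightarrow> x s holomorphic_on U"
    "\<And>s t. s < n \<Longrightarrow> t \<in> U \<Longrightarrow> poly R (x s t) = t"
    "\<And>s s' t. s < n \<Longrightarrow> s' < n \<Longrightarrow> s \<noteq> s' \<Longrightarrow> t \<in> U \<Longrightarrow> x s t \<noteq> x s' t"
    and T: "T > 0" "\<And>s t. s < n \<Longrightarrow> t > T \<Longrightarrow> x s (of_real t) = \<psi> (cis (2 * pi * s / n) * of_real (1 / root n t))"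
    "\<And>t. t > T \<Longrightarrow> 1 / root n t < r"
    by (rule branches[OF R(1) n(2) U(1,2) posU sep]) blast+
  have dirs: "filterlim (\<lambda>t. x s (of_real t)) at_infinity at_top"
    "((\<lambda>t. sgn (x s (of_real t))) \<longlongrightarrow> sgn \<kappa> * cis (- (2 * pi * s / n))) at_top" if "s < n" for s
    using branch_directions[OF n(2) \<psi>(4,5), of T "\<lambda>t. x s (of_real t)" "2 * pi * s / n"] T(2)[OF that] by simp_all
  obtain c where c: "\<And>s. s < n \<Longrightarrow> poly R (c s) = 0"
    "\<And>s. s < n \<Longrightarrow> ((\<lambda>t. x s (of_real t)) \<longlongrightarrow> c s) (at_right 0)"
    "\<And>Q t. moments_vanish R Q a b \<Longrightarrow> t \<in> U \<Longrightarrow> (\<Sum>s<n. of_real (log_weight R a b (c s)) * poly Q (x s t)) = 0"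
    by (rule branch_relation[OF R(1) n(2) R(2,3) ab U posU sep x dirs(1)]) blast+
  define f where "f = (\<lambda>s. log_weight R a b (c s))"
  define p where "p = order a R"
  define q where "q = order b R"
  have pq: "p > 0" "q > 0" using R order_root by (auto simp: p_def q_def)
  \<comment> \<open>The weights multiplied by \<open>p * q\<close>, hence integers: the conjugation
    argument for roots of unity works with integer coefficients.\<close>
  define F where "F = (\<lambda>s. if c s = a then int q else if c s = b then - int p else 0)"
  have Ff: "real_of_int (F s) = of_nat p * of_nat q * f s" for s
    using pq by (auto simp: F_def f_def log_weight_def p_def[symmetric] q_def[symmetric])
  \<comment> \<open>The constant polynomial 1 has vanishing moments, so the branch relation for it
    says that the weights add up to 0, without counting the branches at each root.\<close>
  have f0: "(\<Sum>s<n. f s) = 0"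
  proof -
    have "(\<Sum>s<n. of_real (f s) * poly [:1:] (x s (of_real 1))) = (0::complex)"
      unfolding f_def by (rule c(3)) (simp, rule posU, simp)
    then have "of_real (\<Sum>s<n. f s) = (0::complex)" by simp
    then show ?thesis by (simp only: of_real_eq_0_iff)
  qed
  have F0: "(\<Sum>s<n. real_of_int (F s)) = 0" unfolding Ff using f0 by (simp add: sum_distrib_left[symmetric])
  \<comment> \<open>By the open mapping theorem a fibre over a small positive \<open>t\<close> has a
    point near \<open>a\<close>. The branches exhaust that fibre, and if none started at
    \<open>a\<close> they would all stay at a definite distance from it.\<close>
  have exA: "\<exists>s0<n. c s0 = a"
  proof (rule ccontr)
    assume no: "\<not> ?thesis"
    let ?\<delta> = "\<lambda>s. dist (c s) a / 2"
    obtain \<delta> where \<delta>: "\<delta> > 0" "\<And>s. s < n \<Longrightarrow> \<delta> \<le> ?\<delta> s"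
    proof (rule common_radius[of n ?\<delta>])
      show "?\<delta> s > 0" if "s < n" for s using no that by auto
    qed blast
    have "\<forall>\<^sub>F t in at_right 0. \<forall>s\<in>{..<n}. dist (x s (of_real t)) (c s) < \<delta>"
      using c(2) \<delta>(1) by (intro eventually_ball_finite) (auto simp: tendsto_iff)
    then obtain t1 where t1: "t1 > 0" "\<And>t s. 0 < t \<Longrightarrow> t < t1 \<Longrightarrow> s < n \<Longrightarrow> dist (x s (of_real t)) (c s) < \<delta>"
      by (auto simp: eventually_at_right_field)
    have "open (poly R ` ball a \<delta>)"
    proof (rule open_mapping_thm[of _ UNIV])
      show "\<not> poly R constant_on UNIV"
      proof
        assume "poly R constant_on UNIV"
        then obtain k where "\<And>z. poly R z = k" by (auto simp: constant_on_def)
        then have "R = [:k:]" by (metis poly_eqI_degree poly_eq_poly_eq_iff ext poly_pCons poly_0 mult_zero_right add.right_neutral)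
        then show False using R0 by simp
      qed
    qed (auto intro!: holomorphic_intros)
    moreover have "0 \<in> poly R ` ball a \<delta>" using \<delta>(1) R(2) by (metis centre_in_ball image_eqI)
    ultimately obtain e where e: "e > 0" "ball 0 e \<subseteq> poly R ` ball a \<delta>" using openE by blast
    define t where "t = min t1 e / 2"
    have t: "0 < t" "t < t1" "t < e" using t1(1) e(1) by (auto simp: t_def)
    have "of_real t \<in> ball (0::complex) e" using t by simp
    then obtain y where y: "y \<in> ball a \<delta>" "poly R y = of_real t" using e(2) by (metis imageE subsetD)
    have tU: "of_real t \<in> U" by (rule posU[OF t(1)])
    have septU: "\<And>z. poly R z = of_real t \<Longrightarrow> poly (pderiv R) z \<noteq> 0" using sep tU by metis
    have "inj_on (\<lambda>s. x s (of_real t)) {..<n}" by (rule inj_onI) (use x(3) tU in blast)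
    then have "(\<lambda>s. x s (of_real t)) ` {..<n} = {z. poly R z = of_real t}"
      by (intro card_subset_eq separable_fibre(2)[OF R0 septU])
         (use x(2) tU separable_fibre(3)[OF R0 septU] R(1) in \<open>auto simp: card_image\<close>)
    then obtain s where s: "s < n" "y = x s (of_real t)" using y(2) by blast
    have "dist (c s) a \<le> dist y (c s) + dist a y" by (metis add.commute dist_commute dist_triangle)
    also have "\<dots> < \<delta> + \<delta>" using t1(2)[OF t(1,2) s(1)] y(1) s(2) by (intro add_strict_mono) auto
    finally show False using \<delta>(2)[OF s(1)] by simp
  qed
  then obtain s0 where s0: "s0 < n" "c s0 = a" by blast
  have cab: "c s = c s'" if "F s > 0 \<and> F s' > 0 \<or> F s < 0 \<and> F s' < 0" for s s'
    using that by (auto simp: F_def split: if_splits)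
  have ni: "c s1 = c s2" if s: "s1 < s2" "s2 < s3" "s3 < s4" "s4 < n" and "c s1 = c s3" "c s2 = c s4" for s1 s2 s3 s4
  proof (rule not_interlaced[where x = "\<lambda>s t. x s (of_real t)" and c = c and u = "sgn \<kappa>", OF _ _ _ _ _ _ _ s that(5,6)])
    show "norm (sgn \<kappa>) = 1" using \<psi>(4) by (simp add: norm_sgn)
    fix s assume s: "s < n"
    show "continuous_on {0<..} (\<lambda>t. x s (of_real t))"
      by (rule continuous_on_compose2[OF holomorphic_on_imp_continuous_on[OF x(1)[OF s]]])
         (use posU in \<open>auto intro!: continuous_intros\<close>)
    show "((\<lambda>t. x s (of_real t)) \<longlongrightarrow> c s) (at_right 0)" by (rule c(2)[OF s])
    show "filterlim (\<lambda>t. x s (of_real t)) at_infinity at_top"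
      "((\<lambda>t. sgn (x s (of_real t))) \<longlongrightarrow> sgn \<kappa> * cis (- (2 * pi * s / n))) at_top" using dirs[OF s] by auto
    fix s' assume s': "s' < n"
    show "x s (of_real t) \<noteq> c s'" if "t > 0" for t
      using x(2)[OF s posU[OF that]] c(1)[OF s'] that by auto
    show "s = s'" if "0 < t" "0 < t'" "x s (of_real t) = x s' (of_real t')" for t t'
    proof -
      have "complex_of_real t = of_real t'"
        using x(2)[OF s posU[OF that(1)]] x(2)[OF s' posU[OF that(2)]] that(3) by simp
      then show ?thesis using x(3)[OF s s' _ posU[OF that(1)]] that(3) by auto
    qed
  qed
  have Fne: "(\<Sum>s<n. of_int (F s) * cis (2 * pi * s / n)) \<noteq> 0"
  proof -
    have "(\<Sum>s<n. of_real (real_of_int (F s)) * cis (2 * pi * s / n)) \<noteq> 0"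
    proof (rule noninterlaced_weights_sum_nonzero[OF n(2) F0 s0(1)])
      show "real_of_int (F s0) \<noteq> 0" using s0(2) pq by (simp add: F_def)
      fix s1 s2 s3 s4 :: nat assume s: "s1 < s2" "s2 < s3" "s3 < s4" "s4 < n"
        and sg: "real_of_int (F s1) > 0 \<and> real_of_int (F s2) < 0 \<and> real_of_int (F s3) > 0 \<and> real_of_int (F s4) < 0 \<or>
          real_of_int (F s1) < 0 \<and> real_of_int (F s2) > 0 \<and> real_of_int (F s3) < 0 \<and> real_of_int (F s4) > 0"
      from sg have "c s1 = c s3" "c s2 = c s4" using cab[of s1 s3] cab[of s2 s4] by auto
      from ni[OF s this] have "c s1 = c s2" .
      then show False using sg by (auto simp: F_def split: if_splits)
    qed
    then show ?thesis by simp
  qed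
  have fl: "(\<Sum>s<n. of_real (f s) * cis (2 * pi * s / n) ^ l) \<noteq> 0" if l: "coprime l n" for l
  proof
    assume "(\<Sum>s<n. of_real (f s) * cis (2 * pi * s / n) ^ l) = 0"
    moreover have "(\<Sum>s<n. of_int (F s) * cis (2 * pi * s / n) ^ l) =
       of_nat p * of_nat q * (\<Sum>s<n. of_real (f s) * cis (2 * pi * s / n) ^ l)"
      unfolding sum_distrib_left using arg_cong[OF Ff, of complex_of_real] by (intro sum.cong) auto
    ultimately have "(\<Sum>s<n. of_int (F s) * cis (2 * pi * s / n) ^ l) = 0" by simp
    from coprime_exponent_root_of_unity_sum[OF n(2) l this] show False using Fne by simp
  qed
  have zinb: "z * w \<in> ball 0 r - {0}" if "norm z = 1" "w \<in> ball 0 r - {0}" for z w :: complex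
    using that by (auto simp: norm_mult)
  \<comment> \<open>In the variable \<open>w\<close> the ray at infinity becomes a small positive
    interval, and the identity theorem extends the relation to the whole punctured disc, where
    \<open>w\<close> can be rotated.\<close>
  have rel: "(\<Sum>s<n. of_real (f s) * poly Q (\<psi> (cis (2 * pi * s / n) * w))) = 0"
    if mom: "moments_vanish P Q a b" and w: "w \<in> ball 0 r - {0}" for Q w
  proof -
    have momR: "moments_vanish R Q a b" unfolding R_def by (rule moments_vanish_smult[OF mom])
    let ?H = "\<lambda>w. \<Sum>s<n. of_real (f s) * poly Q (\<psi> (cis (2 * pi * s / n) * w))"
    define r1 where "r1 = 1 / root n (T + 1)"
    have r1: "r1 > 0" using T(1) n by (simp add: r1_def)
    have r1r: "r1 < r" unfolding r1_def using T(3)[of "T+1"] by simp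
    let ?S = "of_real ` {0<..<r1} :: complex set"
    have H0: "?H v = 0" if v: "v \<in> ?S" for v
    proof -
      obtain y where y: "v = of_real y" "0 < y" "y < r1" using v by auto
      define t where "t = 1 / y ^ n"
      have "root n t = 1 / y" unfolding t_def using y(2) n by (simp add: real_root_divide real_root_power_cancel)
      moreover have "t > T"
      proof -
        have "1 / y > root n (T + 1)" using y r1 T(1) n by (simp add: r1_def field_simps)
        then have "(1 / y) ^ n > root n (T + 1) ^ n" using n T(1) by (intro power_strict_mono) auto
        also have "root n (T + 1) ^ n = T + 1" using n T(1) by simp
        finally show ?thesis by (simp add: t_def power_divide)
      qed
      ultimately have "x s (of_real t) = \<psi> (cis (2 * pi * s / n) * v)" if "s < n" for s
        using T(2)[OF that, of t] y by simp
      then have "?H v = (\<Sum>s<n. of_real (log_weight R a b (c s)) * poly Q (x s (of_real t)))"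
        unfolding f_def by (intro sum.cong) auto
      also have "\<dots> = 0" by (rule c(3)[OF momR posU]) (use y in \<open>simp add: t_def\<close>)
      finally show ?thesis .
    qed
    have comp: "(\<lambda>w. \<psi> (cis \<theta> * w)) holomorphic_on ball 0 r - {0}" for \<theta>
    proof -
      have "(\<lambda>w. cis \<theta> * w) holomorphic_on ball 0 r - {0}" by (intro holomorphic_intros)
      from holomorphic_on_compose_gen[OF this \<psi>(2)] zinb[of "cis \<theta>"] show ?thesis
        by (simp add: o_def image_subset_iff)
    qed
    show ?thesis
    proof (rule analytic_continuation[of ?H "ball 0 r - {0}" ?S "of_real (r1/2)" w])
      show "?H holomorphic_on ball 0 r - {0}" by (intro holomorphic_intros comp)
      show "connected (ball (0::complex) r - {0})" by (intro connected_punctured_ball) simp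
      show "?S \<subseteq> ball 0 r - {0}" "of_real (r1/2) \<in> ball (0::complex) r - {0}" using r1 r1r by auto
      have "r1 / 2 islimpt {0<..<r1}" using r1 by (intro open_imp_islimpt) auto
      then show "complex_of_real (r1 / 2) islimpt ?S"
      proof (rule islimpt_isCont_image)
        show "\<forall>\<^sub>F y in at (r1 / 2). complex_of_real y \<noteq> complex_of_real (r1 / 2)"
          unfolding of_real_eq_iff by (simp add: eventually_at_filter)
      qed (intro continuous_intros)
    qed (use H0 w in auto)
  qed
  let ?Z = "{z::complex. z ^ n = 1}"
  have finZ: "finite ?Z" using n(2) by (intro finite_roots_unity) simp
  have nZ: "norm z = 1" if "z \<in> ?Z" for z
    using that n(2) power_eq_1_iff[of z n] by simp
  have cisZ: "cis (2 * pi * s / n) \<in> ?Z" for s :: nat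
    using n(2) cis_multiple_2pi[of "real s"] by (simp add: Complex.DeMoivre)
  have comp0: "(\<Sum>z\<in>?Z. z ^ j * poly Q (\<psi> (z * w))) = 0"
    if mom: "moments_vanish P Q a b" and j: "coprime j n" and w: "w \<in> ball 0 r - {0}" for Q j w
  proof -
    let ?h = "\<lambda>w. poly Q (\<psi> w)" and ?G = "\<lambda>w. \<Sum>z\<in>?Z. z ^ j * poly Q (\<psi> (z * w))"
    \<comment> \<open>Rotation by a root of unity multiplies the component by a character. Averaging
      the relation therefore gives the conjugate of the weighted sum with exponent \<open>j\<close>
      times the component, and that sum is nonzero for \<open>j\<close> coprime to
      \<open>n\<close>.\<close>
    have shift: "?G (u * w) = cnj u ^ j * ?G w" if u: "u \<in> ?Z" for u
    proof -
      have uu: "cnj u * u = 1" using nZ[OF u] by (metis complex_norm_square mult.commute of_real_1 one_power2)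
      have "?G (u * w) = (\<Sum>z\<in>?Z. cnj u ^ j * (z ^ j * poly Q (\<psi> (z * w))))"
      proof (rule sum.reindex_bij_witness[of _ "\<lambda>z. z * cnj u" "\<lambda>z. z * u"])
        fix z assume z: "z \<in> ?Z"
        show "z * u * cnj u = z" "z * cnj u * u = z" using uu by (simp_all add: mult.assoc mult.commute)
        show "z * u \<in> ?Z" using z u by (simp add: power_mult_distrib)
        have "cnj u ^ n = 1" using u by (metis complex_cnj_one complex_cnj_power mem_Collect_eq)
        then show "z * cnj u \<in> ?Z" using z by (simp add: power_mult_distrib)
        have "cnj u ^ j * (z * u) ^ j = (cnj u * u) ^ j * z ^ j" by (simp add: power_mult_distrib mult_ac)
        then have "cnj u ^ j * (z * u) ^ j = z ^ j" unfolding uu by simp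
        then show "cnj u ^ j * ((z * u) ^ j * poly Q (\<psi> (z * u * w))) = z ^ j * poly Q (\<psi> (z * (u * w)))"
          by (simp add: mult.assoc[symmetric])
      qed
      then show ?thesis by (simp add: sum_distrib_left)
    qed
    have "0 = (\<Sum>z\<in>?Z. z ^ j * (\<Sum>s<n. of_real (f s) * poly Q (\<psi> (cis (2 * pi * s / n) * (z * w)))))"
      using rel[OF mom zinb[OF nZ w]] by simp
    also have "\<dots> = (\<Sum>s<n. of_real (f s) * ?G (cis (2 * pi * s / n) * w))"
      unfolding sum_distrib_left by (subst sum.swap) (intro sum.cong refl, simp add: mult_ac)
    also have "\<dots> = (\<Sum>s<n. of_real (f s) * cnj (cis (2 * pi * s / n)) ^ j) * ?G w"
      unfolding sum_distrib_right by (intro sum.cong refl) (subst shift[OF cisZ], rule mult.assoc[symmetric])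
    also have "(\<Sum>s<n. of_real (f s) * cnj (cis (2 * pi * s / n)) ^ j) = cnj (\<Sum>s<n. of_real (f s) * cis (2 * pi * s / n) ^ j)"
      by simp
    finally have "cnj (\<Sum>s<n. of_real (f s) * cis (2 * pi * s / n) ^ j) * ?G w = 0" by (rule sym)
    then show ?thesis using fl[OF j] by (simp only: mult_eq_0_iff complex_cnj_zero_iff simp_thms)
  qed
  show ?thesis
  proof (rule that[OF \<psi>(1-5)])
    show "poly P (\<psi> w) = (1 / \<gamma>) / w ^ n" if "w \<in> ball 0 r - {0}" for w
    proof -
      have "poly P (\<psi> w) = (\<gamma> * poly P (\<psi> w)) / \<gamma>" using \<gamma>0 by simp
      also have "\<gamma> * poly P (\<psi> w) = 1 / w ^ n" using \<psi>(6)[OF that] by (simp add: R_def)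
      finally show ?thesis by (simp add: mult.commute)
    qed
  qed (use comp0 in blast)
qed

section \<open>Common right factors\<close>

text \<open>Two-variable polynomials \<open>\<Theta>(x, y)\<close> are polynomials in \<open>y\<close> with coefficients in \<open>\<complex>[x]\<close>.\<close>
definition slice :: "complex poly poly \<Rightarrow> complex \<Rightarrow> complex poly" where
  "slice \<Theta> x = map_poly (\<lambda>c. poly c x) \<Theta>"

lemma coeff_slice [simp]: "coeff (slice \<Theta> x) i = poly (coeff \<Theta> i) x"
  by (simp add: slice_def coeff_map_poly)

lemma slice_simps [simp]:
  "slice (F + G) x = slice F x + slice G x" "slice (F * G) x = slice F x * slice G x"
  "slice (smult c F) x = smult (poly c x) (slice F x)" "slice (F - G) x = slice F x - slice G x"
  by (auto intro!: poly_eqI simp: coeff_mult poly_sum)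

text \<open>The two-variable polynomial F(y) - F(x): the first term has coefficients constant in
  \<open>x\<close>, and the subtracted one is constant in \<open>y\<close>.\<close>

definition const_in_x :: "complex poly \<Rightarrow> complex poly poly" where
  "const_in_x F = map_poly (\<lambda>c. [:c:]) F - [:F:]"

lemma slice_const_in_x [simp]: "slice (const_in_x F) x = F - [:poly F x:]"
  by (rule poly_eqI) (auto simp: const_in_x_def coeff_map_poly coeff_pCons split: nat.splits)

lemma poly_slice: "poly (slice \<Theta> x) y = poly (poly \<Theta> [:y:]) x"
  by (induction \<Theta>) (auto simp: slice_def map_poly_pCons)

definition common_fibre :: "complex poly \<Rightarrow> complex poly \<Rightarrow> complex \<Rightarrow> complex set" where
  "common_fibre P Q x = {y. poly P y = poly P x \<and> poly Q y = poly Q x}"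

lemma common_fibre_eq: "y \<in> common_fibre P Q x \<Longrightarrow> common_fibre P Q y = common_fibre P Q x"
  by (auto simp: common_fibre_def)

lemma finite_poly_eq:
  fixes P :: "complex poly"
  assumes "degree P > 0" shows "finite {x. poly P x = c}"
proof -
  have "P - [:c:] \<noteq> 0"
  proof
    assume "P - [:c:] = 0"
    then have "P = [:c:]" by simp
    then show False using assms by (metis degree_pCons_0 less_irrefl)
  qed
  from poly_roots_finite[OF this] show ?thesis by simp
qed

lemma finite_poly_in:
  fixes P :: "complex poly"
  assumes "degree P > 0" "finite C" shows "finite {x. poly P x \<in> C}"
proof -
  have "{x. poly P x \<in> C} = (\<Union>c\<in>C. {x. poly P x = c})" by auto
  then show ?thesis using finite_poly_eq[OF assms(1)] assms(2) by simp
qed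

section \<open>Growth of polynomials at infinity and divisibility\<close>

lemma poly_growth_upper:
  fixes P :: "complex poly"
  obtains M where "M > 0" "\<And>x. norm (poly P x) \<le> M * max 1 (norm x) ^ degree P"
proof -
  define M where "M = 1 + (\<Sum>i\<le>degree P. norm (coeff P i))"
  show ?thesis
  proof (rule that[of M])
    show "M > 0" unfolding M_def by (intro add_pos_nonneg sum_nonneg) auto
    fix x
    have "norm (poly P x) \<le> (\<Sum>i\<le>degree P. norm (coeff P i * x ^ i))"
      unfolding poly_altdef by (rule norm_sum)
    also have "\<dots> \<le> (\<Sum>i\<le>degree P. norm (coeff P i) * max 1 (norm x) ^ degree P)"
    proof (rule sum_mono)
      fix i assume "i \<in> {..degree P}"
      then have "norm x ^ i \<le> max 1 (norm x) ^ degree P"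
        by (intro order_trans[OF power_mono[of "norm x" "max 1 (norm x)" i]] power_increasing) auto
      then show "norm (coeff P i * x ^ i) \<le> norm (coeff P i) * max 1 (norm x) ^ degree P"
        by (simp add: norm_mult norm_power mult_left_mono)
    qed
    also have "\<dots> \<le> M * max 1 (norm x) ^ degree P"
      unfolding sum_distrib_right[symmetric] M_def by (intro mult_right_mono) auto
    finally show "norm (poly P x) \<le> M * max 1 (norm x) ^ degree P" .
  qed
qed

lemma poly_growth_lower:
  fixes P :: "complex poly"
  assumes n: "degree P > 0"
  obtains m r where "m > 0" "r \<ge> 1" "\<And>x. norm x \<ge> r \<Longrightarrow> m * norm x ^ degree P \<le> norm (poly P x)"
proof -
  have lc: "poly (reflect_poly P) 0 \<noteq> 0" using n by auto
  have "isCont (\<lambda>v. norm (poly (reflect_poly P) v)) 0" by (intro continuous_intros)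
  then have "\<forall>\<^sub>F v in nhds 0. norm (poly (reflect_poly P) v) > norm (lead_coeff P) / 2"
    using n by (intro order_tendstoD(1)) (auto simp: isCont_def tendsto_nhds_iff)
  then obtain e where e: "e > 0" "\<And>v. norm v < e \<Longrightarrow> norm (poly (reflect_poly P) v) > norm (lead_coeff P) / 2"
    by (auto simp: eventually_nhds_metric)
  show ?thesis
  proof (rule that[of "norm (lead_coeff P) / 2" "max 1 (2 / e)"])
    show "norm (lead_coeff P) / 2 > 0" using n by auto
    fix x :: complex assume x: "norm x \<ge> max 1 (2 / e)"
    then have x0: "x \<noteq> 0" by auto
    have "norm (inverse x) < e" using x e(1) x0 by (simp add: norm_inverse norm_divide field_simps)
    from e(2)[OF this] have "norm (lead_coeff P) / 2 < norm (inverse x ^ degree P * poly P x)"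
      using x0 by (simp add: poly_reflect_poly_nz)
    also have "\<dots> = norm (poly P x) / norm x ^ degree P" by (simp add: norm_mult norm_power norm_inverse norm_divide field_simps)
    finally show "norm (lead_coeff P) / 2 * norm x ^ degree P \<le> norm (poly P x)"
      using x0 by (simp add: field_simps)
  qed simp
qed

text \<open>At infinity both sides of P(y) = P(x) grow with the same degree, so \<open>y\<close> is
  at most proportional to \<open>x\<close>.\<close>

lemma fibre_growth:
  fixes P :: "complex poly"
  assumes n: "degree P > 0"
  obtains C where "C \<ge> 1" "\<And>x y. poly P y = poly P x \<Longrightarrow> norm y \<le> C * max 1 (norm x)"
proof -
  obtain M where M: "M > 0" "\<And>x. norm (poly P x) \<le> M * max 1 (norm x) ^ degree P" using poly_growth_upper by blast
  obtain m r where m: "m > 0" "r \<ge> 1" "\<And>x. norm x \<ge> r \<Longrightarrow> m * norm x ^ degree P \<le> norm (poly P x)"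
    using poly_growth_lower[OF n] by blast
  define C where "C = max r (M / m)"
  have C: "C \<ge> 1" "C \<ge> M / m" "C \<ge> r" using m(2) by (auto simp: C_def)
  show ?thesis
  proof (rule that[OF C(1)])
    fix x y assume xy: "poly P y = poly P x"
    let ?X = "max 1 (norm x)"
    show "norm y \<le> C * ?X"
    proof (cases "norm y \<ge> r")
      case True
      have "m * norm y ^ degree P \<le> M * ?X ^ degree P" using m(3)[OF True] M(2)[of x] xy by simp
      then have "norm y ^ degree P \<le> (M / m) * ?X ^ degree P" using m(1) by (simp add: field_simps)
      also have "\<dots> \<le> C ^ degree P * ?X ^ degree P"
        using C n self_le_power[OF C(1) n] by (intro mult_right_mono) auto
      also have "\<dots> = (C * ?X) ^ degree P" by (simp add: power_mult_distrib)
      finally have "norm y ^ Suc (degree P - 1) \<le> (C * ?X) ^ Suc (degree P - 1)" using n by simp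
      then show ?thesis by (rule power_le_imp_le_base) (use C(1) in auto)
    next
      case False
      then have "norm y \<le> C * 1" using C(3) by simp
      also have "\<dots> \<le> C * ?X" using C(1) by (intro mult_left_mono) auto
      finally show ?thesis .
    qed
  qed
qed

lemma degree_le_of_growth:
  fixes W :: "complex poly"
  assumes S: "finite S" and W: "\<And>x. x \<notin> S \<Longrightarrow> norm (poly W x) \<le> B * max 1 (norm x) ^ D"
  shows "degree W \<le> D"
proof (rule ccontr)
  assume d: "\<not> ?thesis"
  then have d0: "degree W > 0" by simp
  obtain m r where m: "m > 0" "r \<ge> 1" "\<And>x. norm x \<ge> r \<Longrightarrow> m * norm x ^ degree W \<le> norm (poly W x)"
    using poly_growth_lower[OF d0] by blast
  obtain b where b: "\<And>s. s \<in> S \<Longrightarrow> norm s \<le> b" using finite_imp_bounded[OF S] by (auto simp: bounded_iff)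
  define R where "R = max r (max (b + 1) (\<bar>B\<bar> / m + 1))"
  have R: "R \<ge> r" "R \<ge> 1" "R > \<bar>B\<bar> / m" "R > b" using m by (auto simp: R_def)
  have "of_real R \<notin> S" using b[of "of_real R"] R by auto
  then have "m * R ^ degree W \<le> B * R ^ D"
    using m(3)[of "of_real R"] W[of "of_real R"] R by simp
  moreover have "R ^ Suc D \<le> R ^ degree W" using d R(2) by (intro power_increasing) auto
  ultimately have "m * R ^ Suc D \<le> B * R ^ D" using m(1) by (meson mult_left_mono order_trans less_imp_le)
  then have "(m * R) * R ^ D \<le> B * R ^ D" by (simp add: mult_ac)
  then have "m * R \<le> B" using R(2) by simp
  then show False using R(3) m(1) by (simp add: field_simps abs_if split: if_splits)
qed

lemma proots_subset_imp_dvd: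
  fixes A B :: "complex poly"
  assumes "A \<noteq> 0" "proots A \<subseteq># proots B"
  shows "A dvd B"
proof -
  from assms(2) have "(\<Prod>x\<in>#proots A. [:-x, 1:]) dvd (\<Prod>x\<in>#proots B. [:-x, 1:])"
    by (intro prod_mset_subset_imp_dvd image_mset_subseteq_mono)
  then have "smult (lead_coeff A) (\<Prod>x\<in>#proots A. [:-x, 1:]) dvd smult (lead_coeff B) (\<Prod>x\<in>#proots B. [:-x, 1:])"
    using assms(1) by (simp add: smult_dvd_iff dvd_smult)
  then show ?thesis by (simp only: complex_poly_decompose_multiset)
qed

text \<open>The inequality extends to the finite set \<open>S\<close> by continuity. At a zero of
  \<open>\<Lambda>\<close> of higher order than that of \<open>\<theta>\<close>, dividing out the
  common power would make the cofactor of \<open>\<theta>\<close> vanish there.\<close>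

lemma dvd_of_bounded_quotient:
  fixes \<theta> \<Lambda> :: "complex poly"
  assumes "\<Lambda> \<noteq> 0" and "finite S"
    and bd: "\<And>x. x \<notin> S \<Longrightarrow> norm (poly \<theta> x) \<le> B * max 1 (norm x) ^ D * norm (poly \<Lambda> x)"
  shows "\<Lambda> dvd \<theta>"
proof (cases "\<theta> = 0")
  case False
  have all: "norm (poly \<theta> x) \<le> B * max 1 (norm x) ^ D * norm (poly \<Lambda> x)" for x
  proof -
    let ?f = "\<lambda>x. B * max 1 (norm x) ^ D * norm (poly \<Lambda> x) - norm (poly \<theta> x)"
    have "isCont ?f x" by (intro continuous_intros)
    then have "(?f \<longlongrightarrow> ?f x) (at x)" by (simp add: isCont_def)
    moreover have "\<forall>\<^sub>F y in at x. 0 \<le> ?f y"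
    proof -
      have "\<forall>\<^sub>F y in at x. y \<notin> S"
        using islimpt_finite[OF assms(2), of x] by (simp add: islimpt_iff_eventually)
      then show ?thesis by eventually_elim (use bd in force)
    qed
    ultimately have "0 \<le> ?f x" by (rule tendsto_lowerbound) simp
    then show ?thesis by simp
  qed
  have "order z \<Lambda> \<le> order z \<theta>" for z
  proof (rule ccontr)
    assume less: "\<not> ?thesis"
    let ?k = "order z \<theta>"
    obtain \<theta>1 where t1: "\<theta> = [:-z, 1:] ^ ?k * \<theta>1" "\<not> [:-z, 1:] dvd \<theta>1" using order_decomp[OF False] by blast
    have "[:-z, 1:] ^ Suc ?k dvd \<Lambda>" using less unfolding order_divides by simp
    then obtain \<Lambda>1 where l1: "\<Lambda> = [:-z, 1:] ^ Suc ?k * \<Lambda>1" by blast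
    let ?f = "\<lambda>x. B * max 1 (norm x) ^ D * norm (x - z) * norm (poly \<Lambda>1 x) - norm (poly \<theta>1 x)"
    have "isCont ?f z" by (intro continuous_intros)
    then have "(?f \<longlongrightarrow> ?f z) (at z)" by (simp add: isCont_def)
    moreover have "\<forall>\<^sub>F y in at z. 0 \<le> ?f y"
      unfolding eventually_at_filter
    proof (rule always_eventually, intro allI impI)
      fix y assume "y \<noteq> z"
      then have p: "norm (y - z) ^ ?k > 0" by simp
      have "norm (y - z) ^ ?k * norm (poly \<theta>1 y) = norm (poly \<theta> y)"
        by (subst t1(1)) (simp add: norm_mult norm_power poly_power)
      also have "\<dots> \<le> B * max 1 (norm y) ^ D * norm (poly \<Lambda> y)" by (rule all)
      also have "norm (poly \<Lambda> y) = norm (y - z) ^ ?k * (norm (y - z) * norm (poly \<Lambda>1 y))"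
      proof -
        have "poly \<Lambda> y = (y - z) ^ Suc ?k * poly \<Lambda>1 y" by (subst l1) (simp del: power_Suc)
        then show ?thesis by (simp add: norm_mult norm_power mult_ac)
      qed
      finally have "norm (y - z) ^ ?k * norm (poly \<theta>1 y) \<le> norm (y - z) ^ ?k * (B * max 1 (norm y) ^ D * norm (y - z) * norm (poly \<Lambda>1 y))"
        by (simp add: mult_ac)
      then show "0 \<le> ?f y" using p by simp
    qed
    ultimately have "0 \<le> ?f z" by (rule tendsto_lowerbound) simp
    then have "poly \<theta>1 z = 0" by simp
    then show False using t1(2) by (simp add: poly_eq_0_iff_dvd)
  qed
  then have "proots \<Lambda> \<subseteq># proots \<theta>"
    using assms(1) False by (simp add: subseteq_mset_def)
  then show ?thesis by (rule proots_subset_imp_dvd[OF assms(1)])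
qed simp

text \<open>The greatest common divisor over the fraction field, without denominators: a nonzero
  element of least degree in the ideal of \<open>F\<close> and \<open>G\<close> divides both after
  scaling, since pseudo-remainders stay in the ideal.\<close>

lemma pseudo_divisor:
  fixes F G :: "'a::idom poly"
  assumes F: "F \<noteq> 0"
  obtains \<Theta> U V a b q1 q2 where "\<Theta> \<noteq> 0" "\<Theta> = U * F + V * G" "a \<noteq> 0" "b \<noteq> 0"
    "smult a F = \<Theta> * q1" "smult b G = \<Theta> * q2"
proof -
  let ?J = "\<lambda>\<Theta>. \<Theta> \<noteq> 0 \<and> (\<exists>U V. \<Theta> = U * F + V * G)"
  have "F = 1 * F + 0 * G" by simp
  then have "?J F" using F by blast
  then obtain \<Theta> where \<Theta>: "?J \<Theta>" "\<And>H. ?J H \<Longrightarrow> degree \<Theta> \<le> degree H"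
    using ex_has_least_nat[of ?J F degree] by blast
  obtain U V where UV: "\<Theta> = U * F + V * G" using \<Theta>(1) by blast
  have nz: "\<Theta> \<noteq> 0" using \<Theta>(1) by blast
  have div: "\<exists>a q. a \<noteq> 0 \<and> smult a H = \<Theta> * q" if H: "H = U' * F + V' * G" for H U' V'
  proof -
    obtain a q where aq: "a \<noteq> 0" "smult a H = \<Theta> * q + pseudo_mod H \<Theta>" using pseudo_mod(1)[OF nz] by blast
    have "pseudo_mod H \<Theta> = smult a H - \<Theta> * q" using aq(2) by simp
    also have "\<dots> = ([:a:] * U' - q * U) * F + ([:a:] * V' - q * V) * G"
      unfolding UV H by (simp add: algebra_simps smult_add_right)
    finally have "pseudo_mod H \<Theta> = 0"
      using \<Theta>(2)[of "pseudo_mod H \<Theta>"] pseudo_mod(2)[OF nz, of H] by (meson leD)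
    then show ?thesis using aq by auto
  qed
  from div[of F 1 0] div[of G 0 1] obtain a b q1 q2 where
    "a \<noteq> 0" "b \<noteq> 0" "smult a F = \<Theta> * q1" "smult b G = \<Theta> * q2" by auto
  then show ?thesis using that nz UV by blast
qed

lemma const_in_x_nonzero:
  assumes "degree F > 0"
  shows "const_in_x F \<noteq> 0"
proof
  assume "const_in_x F = 0"
  then have "coeff (const_in_x F) (degree F) = 0" by simp
  moreover have "coeff (const_in_x F) (degree F) = [:lead_coeff F:]"
    using assms by (cases "degree F") (auto simp: const_in_x_def coeff_map_poly)
  ultimately have "lead_coeff F = 0" by simp
  then show False using assms by auto
qed

text \<open>\<open>\<Theta>\<close> is the greatest common divisor of P(y) - P(x) and Q(y) - Q(x)
  over the field of rational functions in \<open>x\<close>; for all but finitely many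
  \<open>x\<close> its specialization has exactly the common fibre as roots.\<close>

lemma generic_fibre:
  fixes P Q :: "complex poly"
  assumes n: "degree P > 0"
  obtains \<Theta> S where "finite S" "\<Theta> \<noteq> 0" "\<And>x. x \<notin> S \<Longrightarrow> poly (lead_coeff \<Theta>) x \<noteq> 0"
    "\<And>x. x \<notin> S \<Longrightarrow> finite (common_fibre P Q x) \<and> card (common_fibre P Q x) = degree \<Theta>"
    "\<And>x. x \<notin> S \<Longrightarrow> slice \<Theta> x = smult (poly (lead_coeff \<Theta>) x) (\<Prod>y\<in>common_fibre P Q x. [:-y, 1:])"
proof -
  let ?F = "const_in_x P" and ?G = "const_in_x Q"
  obtain \<Theta> U V a b q1 q2 where \<Theta>: "\<Theta> \<noteq> 0" "\<Theta> = U * ?F + V * ?G" "a \<noteq> 0" "b \<noteq> 0"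
    "smult a ?F = \<Theta> * q1" "smult b ?G = \<Theta> * q2"
    using pseudo_divisor[OF const_in_x_nonzero[OF n]] by blast
  have P': "pderiv P \<noteq> 0" using n by (simp add: pderiv_eq_0_iff)
  \<comment> \<open>Excluded are the zeros of the scaling factors, where the divisibilities
    degenerate, those of the leading coefficient, where the degree drops, and the points over
    critical values of \<open>P\<close>, where roots in \<open>y\<close> may become
    multiple.\<close>
  define S where "S = {x. poly a x = 0} \<union> {x. poly b x = 0} \<union> {x. poly (lead_coeff \<Theta>) x = 0} \<union>
     {x. poly P x \<in> poly P ` {y. poly (pderiv P) y = 0}}"
  have fS: "finite S" unfolding S_def
    using \<Theta>(1,3,4) P' n by (intro finite_UnI poly_roots_finite finite_poly_in finite_imageI) auto
  show ?thesis
  proof (rule that[OF fS \<Theta>(1)])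
    show lc: "poly (lead_coeff \<Theta>) x \<noteq> 0" if "x \<notin> S" for x using that by (simp add: S_def)
    have main: "rsquarefree (slice \<Theta> x) \<and> {y. poly (slice \<Theta> x) y = 0} = common_fibre P Q x
       \<and> degree (slice \<Theta> x) = degree \<Theta>" if x: "x \<notin> S" for x
    proof (intro conjI)
      have nz: "poly a x \<noteq> 0" "poly b x \<noteq> 0" using x by (auto simp: S_def)
      have s: "slice \<Theta> x = slice U x * (P - [:poly P x:]) + slice V x * (Q - [:poly Q x:])"
        by (subst \<Theta>(2)) simp
      have s1: "smult (poly a x) (P - [:poly P x:]) = slice \<Theta> x * slice q1 x"
        using arg_cong[OF \<Theta>(5), of "\<lambda>p. slice p x"] by simp
      have s2: "smult (poly b x) (Q - [:poly Q x:]) = slice \<Theta> x * slice q2 x"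
        using arg_cong[OF \<Theta>(6), of "\<lambda>p. slice p x"] by simp
      show "{y. poly (slice \<Theta> x) y = 0} = common_fibre P Q x"
      proof (intro equalityI subsetI)
        fix y assume "y \<in> {y. poly (slice \<Theta> x) y = 0}"
        then show "y \<in> common_fibre P Q x"
          using arg_cong[OF s1, of "\<lambda>p. poly p y"] arg_cong[OF s2, of "\<lambda>p. poly p y"] nz
          by (simp add: common_fibre_def)
      qed (simp add: s common_fibre_def)
      show "degree (slice \<Theta> x) = degree \<Theta>"
      proof (rule antisym)
        show "degree (slice \<Theta> x) \<le> degree \<Theta>" by (rule degree_le) (simp add: coeff_eq_0)
        show "degree \<Theta> \<le> degree (slice \<Theta> x)" by (rule le_degree) (use lc[OF x] in simp)
      qed
      have sep: "poly (pderiv P) y \<noteq> 0" if "poly P y = poly P x" for y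
        using x that unfolding S_def by (metis (mono_tags, lifting) UnCI image_eqI mem_Collect_eq)
      show "rsquarefree (slice \<Theta> x)" unfolding rsquarefree_roots
      proof (intro allI notI)
        fix y assume y: "poly (slice \<Theta> x) y = 0 \<and> poly (pderiv (slice \<Theta> x)) y = 0"
        have "poly P y = poly P x" using arg_cong[OF s1, of "\<lambda>p. poly p y"] nz y by simp
        moreover have "poly a x * poly (pderiv P) y = 0"
          using arg_cong[OF s1, of "\<lambda>p. poly (pderiv p) y"] y
          by (simp add: pderiv_smult pderiv_diff pderiv_pCons pderiv_mult)
        ultimately show False using sep nz by simp
      qed
    qed
    fix x assume x: "x \<notin> S"
    note m = main[OF x]
    have lcs: "lead_coeff (slice \<Theta> x) = poly (lead_coeff \<Theta>) x" using m by simp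
    have "smult (lead_coeff (slice \<Theta> x)) (\<Prod>y | poly (slice \<Theta> x) y = 0. [:-y, 1:]) = slice \<Theta> x"
      using complex_poly_decompose_rsquarefree m by blast
    then show dec: "slice \<Theta> x = smult (poly (lead_coeff \<Theta>) x) (\<Prod>y\<in>common_fibre P Q x. [:-y, 1:])"
      using lcs m by simp
    have "slice \<Theta> x \<noteq> 0" using m by (auto simp: rsquarefree_def)
    then have fin: "finite (common_fibre P Q x)" using m poly_roots_finite by metis
    have "degree (slice \<Theta> x) = degree (\<Prod>y\<in>common_fibre P Q x. [:-y, 1:])"
      unfolding dec using lc[OF x] by simp
    also have "\<dots> = (\<Sum>y\<in>common_fibre P Q x. degree [:-y, 1:])"
      by (rule degree_prod_eq_sum_degree) auto
    finally show "finite (common_fibre P Q x) \<and> card (common_fibre P Q x) = degree \<Theta>"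
      using fin m by simp
  qed
qed

text \<open>\<open>F\<close> minus its value at a generic \<open>x0\<close> vanishes on the reduced
  fibre of \<open>W\<close> through \<open>x0\<close>, so W - W(x0) divides it. The quotient has
  lower degree and is constant on fibres away from that fibre, which is added to
  \<open>S\<close>.\<close>

lemma constant_on_fibres_imp_pcompose:
  fixes W F :: "complex poly"
  assumes d: "degree W > 0" and "finite S"
    and F: "\<And>x y. x \<notin> S \<Longrightarrow> poly W y = poly W x \<Longrightarrow> poly F y = poly F x"
  shows "\<exists>G. F = pcompose G W"
  using assms(2,3)
proof (induction "degree F" arbitrary: F S rule: less_induct)
  case less
  show ?case
  proof (cases "degree F = 0")
    case True
    then obtain c where "F = [:c:]" using degree_eq_zeroE by blast
    then have "F = pcompose [:c:] W" by (simp add: pcompose_pCons)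
    then show ?thesis by blast
  next
    case False
    have W': "pderiv W \<noteq> 0" using d by (simp add: pderiv_eq_0_iff)
    let ?B = "S \<union> {x. poly W x \<in> poly W ` {y. poly (pderiv W) y = 0}}"
    have "finite ?B" using less.prems(1) W' d by (intro finite_UnI finite_poly_in finite_imageI poly_roots_finite) auto
    then obtain x0 where x0: "x0 \<notin> ?B" using infinite_UNIV_char_0 by (metis UNIV_I finite_subset subsetI)
    let ?w = "poly W x0"
    have sep: "poly (pderiv W) y \<noteq> 0" if "poly W y = ?w" for y
      using x0 that by (metis (mono_tags, lifting) UnCI image_eqI mem_Collect_eq)
    let ?V = "W - [:?w:]" and ?H = "F - [:poly F x0:]"
    have rs: "rsquarefree ?V" unfolding rsquarefree_roots
      using sep by (auto simp: pderiv_diff pderiv_pCons)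
    then have V0: "?V \<noteq> 0" by (simp add: rsquarefree_def)
    have "?V dvd ?H"
    proof (cases "?H = 0")
      case False
      have "order z ?V \<le> order z ?H" for z
      proof (cases "poly ?V z = 0")
        case True
        then have "poly F z = poly F x0" using less.prems(2)[of x0 z] x0 by simp
        then have "order z ?H \<noteq> 0" using False order_root[of ?H z] by simp
        moreover have "order z ?V \<le> 1" using rs unfolding rsquarefree_def by (metis le_refl zero_le)
        ultimately show ?thesis by linarith
      qed (simp add: order_0I)
      then have "proots ?V \<subseteq># proots ?H" using V0 False by (simp add: subseteq_mset_def)
      then show ?thesis by (rule proots_subset_imp_dvd[OF V0])
    qed simp
    then obtain K where K: "?H = ?V * K" by blast
    have dV: "degree ?V = degree W"
      using degree_add_eq_left[of "[:-?w:]" W] d unfolding diff_conv_add_uminus by simp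
    have dH: "degree ?H = degree F"
      using degree_add_eq_left[of "[:-poly F x0:]" F] False unfolding diff_conv_add_uminus by simp
    have "?H \<noteq> 0" using dH False by auto
    then have "degree F = degree W + degree K" using K dH dV by (metis degree_mult_eq mult_eq_0_iff)
    then have lt: "degree K < degree F" using d by simp
    have "\<exists>G. K = pcompose G W"
    proof (rule less.hyps[OF lt])
      show "finite (S \<union> {x. poly W x = ?w})" using less.prems(1) finite_poly_eq[OF d] by simp
      fix x y assume xy: "x \<notin> S \<union> {x. poly W x = ?w}" "poly W y = poly W x"
      have "poly F y = poly F x" using less.prems(2) xy by blast
      moreover have "poly F z - poly F x0 = (poly W z - ?w) * poly K z" for z
        using arg_cong[OF K, of "\<lambda>p. poly p z"] by simp
      ultimately have "(poly W x - ?w) * poly K y = (poly W x - ?w) * poly K x" using xy(2) by metis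
      then show "poly K y = poly K x" using xy(1) by simp
    qed
    then obtain G where "K = pcompose G W" by blast
    then have "F = pcompose ([:poly F x0:] + [:-?w, 1:] * G) W"
      using K by (simp add: pcompose_add pcompose_mult pcompose_pCons pcompose_diff pcompose_smult algebra_simps eq_diff_eq)
    then show ?thesis by blast
  qed
qed

text \<open>A constructive Lueroth argument: the product of \<open>y0 - y\<close> over the common
  fibre of \<open>x\<close> depends only on that fibre and is, generically, a polynomial
  \<open>W\<close> in \<open>x\<close>. Its generic fibres turn out to be the common fibres, so
  \<open>P\<close> and \<open>Q\<close> are functions of \<open>W\<close>.\<close>

lemma common_right_factor:
  fixes P Q :: "complex poly"
  assumes n: "degree P > 0" and inf: "infinite {x. \<exists>y. y \<noteq> x \<and> poly P y = poly P x \<and> poly Q y = poly Q x}"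
  obtains W Pt Qt where "degree W \<ge> 2" "P = pcompose Pt W" "Q = pcompose Qt W"
proof -
  let ?E = "common_fibre P Q"
  obtain \<Theta> S where S: "finite S" "\<Theta> \<noteq> 0" "\<And>x. x \<notin> S \<Longrightarrow> poly (lead_coeff \<Theta>) x \<noteq> 0"
    "\<And>x. x \<notin> S \<Longrightarrow> finite (?E x) \<and> card (?E x) = degree \<Theta>"
    "\<And>x. x \<notin> S \<Longrightarrow> slice \<Theta> x = smult (poly (lead_coeff \<Theta>) x) (\<Prod>y\<in>?E x. [:-y, 1:])"
    by (rule generic_fibre[OF n, of Q], rule that)
  let ?D = "degree \<Theta>" and ?l = "lead_coeff \<Theta>"
  obtain x1 y1 where x1: "x1 \<notin> S" "y1 \<noteq> x1" "poly P y1 = poly P x1" "poly Q y1 = poly Q x1"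
    using infinite_imp_nonempty[OF Diff_infinite_finite[OF S(1) inf]] by blast
  have "card {x1, y1} \<le> card (?E x1)" using S(4)[OF x1(1)] x1 by (intro card_mono) (auto simp: common_fibre_def)
  then have D2: "?D \<ge> 2" using S(4)[OF x1(1)] x1(2) by simp
  obtain C where C: "C \<ge> 1" "\<And>x y. poly P y = poly P x \<Longrightarrow> norm y \<le> C * max 1 (norm x)" using fibre_growth[OF n] by blast
  obtain y0 where y0: "y0 \<notin> S" using S(1) infinite_UNIV_char_0 by (metis UNIV_I finite_subset subsetI)
  let ?\<theta> = "poly \<Theta> [:y0:]"
  define B where "B = (norm y0 + C) ^ ?D"
  have \<theta>: "poly ?\<theta> x = poly ?l x * (\<Prod>y\<in>?E x. y0 - y)" if "x \<notin> S" for x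
    using arg_cong[OF S(5)[OF that], of "\<lambda>p. poly p y0"] by (simp add: poly_slice poly_prod)
  have prod_bd: "norm (\<Prod>y\<in>?E x. y0 - y) \<le> B * max 1 (norm x) ^ ?D" if "x \<notin> S" for x
  proof -
    have "norm (\<Prod>y\<in>?E x. y0 - y) \<le> (\<Prod>y\<in>?E x. (norm y0 + C) * max 1 (norm x))"
      unfolding prod_norm[symmetric]
    proof (intro prod_mono conjI)
      fix y assume "y \<in> ?E x"
      then have "norm y \<le> C * max 1 (norm x)" using C(2) by (auto simp: common_fibre_def)
      moreover have "norm y0 * 1 \<le> norm y0 * max 1 (norm x)" by (intro mult_left_mono) auto
      ultimately show "norm (y0 - y) \<le> (norm y0 + C) * max 1 (norm x)"
        using norm_triangle_ineq4[of y0 y] by (simp add: distrib_right)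
    qed auto
    also have "\<dots> = B * max 1 (norm x) ^ ?D" using S(4)[OF that] by (simp add: B_def power_mult_distrib)
    finally show ?thesis .
  qed
  have l0: "?l \<noteq> 0" using S(2) by simp
  \<comment> \<open>The quotient is a priori rational. Points of a common fibre grow at most
    linearly in \<open>x\<close>, so the quotient is bounded near every finite point and has no
    pole.\<close>
  have "?l dvd ?\<theta>"
  proof (rule dvd_of_bounded_quotient[OF l0 S(1)])
    fix x assume x: "x \<notin> S"
    show "norm (poly ?\<theta> x) \<le> B * max 1 (norm x) ^ ?D * norm (poly ?l x)"
      unfolding \<theta>[OF x] norm_mult using mult_left_mono[OF prod_bd[OF x], of "norm (poly ?l x)"] by (simp add: mult_ac)
  qed
  then obtain W where W: "?\<theta> = ?l * W" by blast
  have Wx: "poly W x = (\<Prod>y\<in>?E x. y0 - y)" if "x \<notin> S" for x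
    using \<theta>[OF that] S(3)[OF that] unfolding W by simp
  have dW: "degree W \<le> ?D" by (rule degree_le_of_growth[OF S(1)]) (use Wx prod_bd in auto)
  \<comment> \<open>\<open>W\<close> vanishes at \<open>y0\<close>, which belongs to its own common
    fibre, and not at a generic \<open>x\<close> with a different value of \<open>P\<close>.\<close>
  have dW0: "degree W > 0"
  proof (rule ccontr)
    assume "\<not> ?thesis"
    then obtain c where c: "W = [:c:]" using degree_eq_zeroE by blast
    have "finite (S \<union> {x. poly P x = poly P y0})" using S(1) finite_poly_eq[OF n] by simp
    then obtain x where x: "x \<notin> S" "poly P x \<noteq> poly P y0"
      using infinite_UNIV_char_0 by (metis (mono_tags, lifting) UNIV_I UnCI finite_subset mem_Collect_eq subsetI)
    have "poly W y0 = 0" unfolding Wx[OF y0] using S(4)[OF y0] by (intro prod_zero) (auto simp: common_fibre_def)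
    moreover have "poly W x \<noteq> 0" unfolding Wx[OF x(1)] using S(4)[OF x(1)] x(2) by (auto simp: common_fibre_def)
    ultimately show False unfolding c by simp
  qed
  \<comment> \<open>The exceptional set saturated along the fibres of \<open>P\<close>, so that the
    formula for \<open>W\<close> holds at all points of the common fibre of an \<open>x\<close>
    outside it.\<close>
  define S2 where "S2 = {x. poly P x \<in> poly P ` S}"
  have S2: "finite S2" unfolding S2_def by (rule finite_poly_in[OF n]) (use S(1) in simp)
  have sub: "?E x \<subseteq> {y. poly W y = poly W x}" if "x \<notin> S2" for x
  proof
    fix y assume y: "y \<in> ?E x"
    have "poly P y = poly P x" using y by (simp add: common_fibre_def)
    then have "x \<notin> S" "y \<notin> S" using that unfolding S2_def by (metis image_eqI mem_Collect_eq)+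
    then show "y \<in> {y. poly W y = poly W x}" using Wx common_fibre_eq[OF y] by simp
  qed
  have card: "card {y. poly W y = c} \<le> degree W" for c
  proof -
    have "W - [:c:] \<noteq> 0"
    proof
      assume "W - [:c:] = 0"
      then have "W = [:c:]" by simp
      then show False using dW0 by (metis degree_pCons_0 less_irrefl)
    qed
    from card_poly_roots_bound[OF this] have "card {y. poly W y = c} \<le> degree (W - [:c:])" by simp
    also have "\<dots> \<le> degree W" by (rule order_trans[OF degree_diff_le_max]) simp
    finally show ?thesis .
  qed
  \<comment> \<open>The common fibre has \<open>degree \<Theta>\<close> points, lies in the fibre of
    \<open>W\<close>, and that fibre has at most \<open>degree W\<close>, hence at most
    \<open>degree \<Theta>\<close>, points.\<close>
  have fib: "?E x = {y. poly W y = poly W x}" if x: "x \<notin> S2" for x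
  proof (rule card_seteq[OF finite_poly_eq[OF dW0] sub[OF x]])
    have "x \<notin> S" using x by (auto simp: S2_def)
    then show "card {y. poly W y = poly W x} \<le> card (?E x)" using S(4) card dW by (metis le_trans)
  qed
  have "\<exists>G. P = pcompose G W" "\<exists>G. Q = pcompose G W"
    by (rule constant_on_fibres_imp_pcompose[OF dW0 S2]; use fib in \<open>auto simp: common_fibre_def\<close>)+
  moreover have "degree W \<ge> 2"
  proof -
    obtain x where x: "x \<notin> S2" using S2 infinite_UNIV_char_0 by (metis UNIV_I finite_subset subsetI)
    then have "x \<notin> S" by (auto simp: S2_def)
    then have "card {y. poly W y = poly W x} = ?D" using S(4) fib[OF x] by metis
    then show ?thesis using card[of "poly W x"] D2 by simp
  qed
  ultimately show ?thesis using that by blast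
qed

section \<open>Solutions of the Abel equation\<close>

definition antideriv :: "complex \<Rightarrow> complex poly \<Rightarrow> complex poly" where
  "antideriv a G = (THE F. pderiv F = G \<and> poly F a = 0)"

lemma antideriv: "pderiv (antideriv a G) = G" "poly (antideriv a G) a = 0"
  and antideriv_unique: "pderiv F = G \<Longrightarrow> poly F a = 0 \<Longrightarrow> antideriv a G = F"
proof -
  have uniq: "F = F'" if "pderiv F = G \<and> poly F a = 0" "pderiv F' = G \<and> poly F' a = 0" for F F'
  proof -
    have "pderiv (F - F') = 0" using that by (simp add: pderiv_diff)
    then have "degree (F - F') = 0" by (simp add: pderiv_eq_0_iff)
    then obtain c where c: "F - F' = [:c:]" using degree_eq_zeroE by blast
    have "c = 0" using arg_cong[OF c, of "\<lambda>p. poly p a"] that by simp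
    then show ?thesis using c by simp
  qed
  obtain F0 where F0: "pderiv F0 = G" using poly_antiderivative by blast
  have "pderiv (F0 - [:poly F0 a:]) = G \<and> poly (F0 - [:poly F0 a:]) a = 0"
    using F0 by (simp add: pderiv_diff pderiv_pCons)
  then have ex: "\<exists>!F. pderiv F = G \<and> poly F a = 0" using uniq by blast
  from theI'[OF this] show "pderiv (antideriv a G) = G" "poly (antideriv a G) a = 0"
    unfolding antideriv_def by auto
  show "pderiv F = G \<Longrightarrow> poly F a = 0 \<Longrightarrow> antideriv a G = F"
    unfolding antideriv_def using ex by (intro the1_equality) auto
qed

lemma antideriv_add: "antideriv a (F + G) = antideriv a F + antideriv a G"
  by (rule antideriv_unique) (simp_all add: pderiv_add antideriv)

lemma antideriv_smult: "antideriv a (smult c F) = smult c (antideriv a F)"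
  by (rule antideriv_unique) (simp_all add: pderiv_smult antideriv)

lemma antideriv_0 [simp]: "antideriv a 0 = 0"
  by (rule antideriv_unique) auto

text \<open>Coefficients of \<open>w = c / y\<close> as a power series in the initial value \<open>c = y a\<close>. The Abel equation
  becomes \<open>w^2 = 1 - 2 c^2 P - 2 c \<integral> Q' w\<close>, where \<open>P\<close> and \<open>Q\<close> are normalized at \<open>a\<close>.
  The guards under the sums only serve termination.\<close>
fun abel_coeff :: "complex \<Rightarrow> complex poly \<Rightarrow> complex poly \<Rightarrow> nat \<Rightarrow> complex poly" where
  "abel_coeff a P q n = (if n = 0 then 1 else
     - smult (1/2) (\<Sum>i\<in>{1..<n}. if i < n \<and> n - i < n then abel_coeff a P q i * abel_coeff a P q (n - i) else 0)
     - (if n = 2 then P else 0) - antideriv a (q * abel_coeff a P q (n - 1)))"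

declare abel_coeff.simps [simp del]

lemma abel_coeff_0 [simp]: "abel_coeff a P q 0 = 1"
  by (simp add: abel_coeff.simps)

lemma abel_coeff_rec:
  "n > 0 \<Longrightarrow> abel_coeff a P q n = - smult (1/2) (\<Sum>i\<in>{1..<n}. abel_coeff a P q i * abel_coeff a P q (n - i))
     - (if n = 2 then P else 0) - antideriv a (q * abel_coeff a P q (n - 1))"
  by (subst abel_coeff.simps) (auto intro!: sum.cong arg_cong[of _ _ "smult _"])

text \<open>The coefficient of \<open>c ^ n\<close> in the equation for \<open>w ^ 2\<close>; the
  recursion is this identity solved for the two extreme terms of the convolution.\<close>

lemma abel_coeff_convolution:
  assumes n: "n > 0"
  shows "(\<Sum>i\<le>n. abel_coeff a P q i * abel_coeff a P q (n - i)) =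
     - smult 2 (if n = 2 then P else 0) - smult 2 (antideriv a (q * abel_coeff a P q (n - 1)))"
proof -
  let ?w = "abel_coeff a P q"
  have two: "smult 2 F = F + F" for F :: "complex poly"
    by (metis one_add_one smult_1_left smult_add_left)
  have "{..n} = insert 0 (insert n {1..<n})" using n by auto
  then have "(\<Sum>i\<le>n. ?w i * ?w (n - i)) = smult 2 (?w n) + (\<Sum>i\<in>{1..<n}. ?w i * ?w (n - i))"
    using n by (simp only: two) simp
  also have "smult 2 (?w n) = - (\<Sum>i\<in>{1..<n}. ?w i * ?w (n - i)) - smult 2 (if n = 2 then P else 0)
      - smult 2 (antideriv a (q * ?w (n - 1)))"
    by (subst abel_coeff_rec[OF n]) (simp add: smult_diff_right)
  finally show ?thesis by simp
qed

lemma abel_coeff_at_base: "poly P a = 0 \<Longrightarrow> n > 0 \<Longrightarrow> poly (abel_coeff a P q n) a = 0"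
proof (induction n rule: less_induct)
  case (less n)
  have "(\<Sum>i\<in>{1..<n}. poly (abel_coeff a P q i) a * poly (abel_coeff a P q (n - i)) a) = 0"
    using less by (intro sum.neutral) auto
  then show ?case using less.prems by (subst abel_coeff_rec) (auto simp: poly_sum antideriv)
qed

text \<open>The same recursion with all signs positive, \<open>P\<close> replaced by a bound
  \<open>M\<close> and the operator \<open>antideriv a (q * _)\<close> by multiplication with
  \<open>K\<close>.\<close>

fun majorant :: "real \<Rightarrow> real \<Rightarrow> nat \<Rightarrow> real" where
  "majorant M K n = (if n = 0 then 1 else
     (\<Sum>i\<in>{1..<n}. if i < n \<and> n - i < n then majorant M K i * majorant M K (n - i) else 0) / 2
     + (if n = 2 then M else 0) + K * majorant M K (n - 1))"

declare majorant.simps [simp del]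

lemma majorant_0 [simp]: "majorant M K 0 = 1"
  by (simp add: majorant.simps)

lemma majorant_rec:
  "n > 0 \<Longrightarrow> majorant M K n = (\<Sum>i\<in>{1..<n}. majorant M K i * majorant M K (n - i)) / 2
     + (if n = 2 then M else 0) + K * majorant M K (n - 1)"
  by (subst majorant.simps) (auto intro!: sum.cong arg_cong[of _ _ "\<lambda>x. x / 2"])

lemma majorant_nonneg: "M \<ge> 0 \<Longrightarrow> K \<ge> 0 \<Longrightarrow> majorant M K n \<ge> 0"
proof (induction n rule: less_induct)
  case (less n)
  show ?case
  proof (cases "n = 0")
    case False
    then show ?thesis using less
      by (subst majorant_rec) (auto intro!: add_nonneg_nonneg sum_nonneg mult_nonneg_nonneg divide_nonneg_nonneg)
  qed simp
qed

lemma sum_convolution_le_square: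
  fixes u :: "nat \<Rightarrow> real"
  assumes "\<And>i. u i \<ge> 0"
  shows "(\<Sum>n=1..N. \<Sum>i\<in>{1..<n}. u i * u (n - i)) \<le> (\<Sum>n\<in>{1..<N}. u n) ^ 2"
proof -
  have "(\<Sum>n=1..N. \<Sum>i\<in>{1..<n}. u i * u (n - i)) = (\<Sum>(n,i)\<in>Sigma {1..N} (\<lambda>n. {1..<n}). u i * u (n - i))"
    by (rule sum.Sigma) auto
  also have "\<dots> = (\<Sum>(i,j)\<in>(\<lambda>(n,i). (i, n - i)) ` Sigma {1..N} (\<lambda>n. {1..<n}). u i * u j)"
    by (subst sum.reindex) (auto simp: inj_on_def intro!: sum.cong)
  also have "\<dots> \<le> (\<Sum>(i,j)\<in>{1..<N} \<times> {1..<N}. u i * u j)"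
    by (rule sum_mono2) (auto intro!: mult_nonneg_nonneg assms)
  also have "\<dots> = (\<Sum>n\<in>{1..<N}. u n) ^ 2"
    by (simp add: power2_eq_square sum_product sum.cartesian_product)
  finally show ?thesis .
qed

text \<open>The bound 1/4 reproduces itself: the convolution contributes half its square, the term
  with \<open>M\<close> at most 1/16, and the shifted sum at most (1/16)(1 + 1/4). Together this is
  11/64.\<close>

lemma majorant_partial_sums:
  assumes MK: "M \<ge> 0" "K \<ge> 0" and c: "0 \<le> c" "M * c ^ 2 \<le> 1/16" "K * c \<le> 1/16"
  shows "(\<Sum>n=1..N. majorant M K n * c ^ n) \<le> 1/4"
proof (induction N)
  case (Suc N)
  let ?u = "\<lambda>n. majorant M K n * c ^ n"
  have u0: "?u n \<ge> 0" for n using majorant_nonneg[OF MK] c(1) by simp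
  have E0: "(\<Sum>n=1..N. ?u n) \<ge> 0" using u0 by (intro sum_nonneg)
  have set: "{1..<Suc N} = {1..N}" by auto
  have "?u n = (\<Sum>i\<in>{1..<n}. ?u i * ?u (n - i)) / 2 + (if n = 2 then M * c ^ 2 else 0) + (K * c) * ?u (n - 1)"
    if "n \<in> {1..Suc N}" for n
  proof -
    have n: "n > 0" using that by simp
    have "(\<Sum>i\<in>{1..<n}. majorant M K i * majorant M K (n - i)) * c ^ n = (\<Sum>i\<in>{1..<n}. ?u i * ?u (n - i))"
      unfolding sum_distrib_right
    proof (rule sum.cong[OF refl])
      fix i assume "i \<in> {1..<n}"
      then have "c ^ n = c ^ i * c ^ (n - i)" by (simp flip: power_add)
      then show "majorant M K i * majorant M K (n - i) * c ^ n = ?u i * ?u (n - i)" by simp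
    qed
    moreover have "c ^ n = c * c ^ (n - 1)" using n by (simp flip: power_Suc)
    ultimately show ?thesis
      by (subst majorant_rec[OF n]) (auto simp: algebra_simps add_divide_distrib)
  qed
  then have "(\<Sum>n=1..Suc N. ?u n) = (\<Sum>n=1..Suc N. (\<Sum>i\<in>{1..<n}. ?u i * ?u (n - i)) / 2
      + (if n = 2 then M * c ^ 2 else 0) + (K * c) * ?u (n - 1))" by (rule sum.cong[OF refl])
  also have "\<dots> = (\<Sum>n=1..Suc N. \<Sum>i\<in>{1..<n}. ?u i * ?u (n - i)) / 2
      + (\<Sum>n=1..Suc N. if n = 2 then M * c ^ 2 else 0) + (K * c) * (\<Sum>n=1..Suc N. ?u (n - 1))"
    by (simp only: sum.distrib sum_divide_distrib sum_distrib_left)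
  also have "\<dots> \<le> (1/4) ^ 2 / 2 + 1/16 + 1/16 * (1 + 1/4)"
  proof (intro add_mono mult_mono divide_right_mono)
    have "(\<Sum>n=1..Suc N. \<Sum>i\<in>{1..<n}. ?u i * ?u (n - i)) \<le> (\<Sum>n=1..N. ?u n) ^ 2"
      using sum_convolution_le_square[of ?u "Suc N", OF u0] unfolding set .
    also have "\<dots> \<le> (1/4) ^ 2" using E0 Suc by (intro power_mono) auto
    finally show "(\<Sum>n=1..Suc N. \<Sum>i\<in>{1..<n}. ?u i * ?u (n - i)) \<le> (1/4) ^ 2" .
    have "(\<Sum>n=1..Suc N. if n = 2 then M * c ^ 2 else 0) = (if 2 \<in> {1..Suc N} then M * c ^ 2 else 0)"
      by (rule sum.delta) simp
    then show "(\<Sum>n=1..Suc N. if n = 2 then M * c ^ 2 else 0) \<le> 1/16" using c(2) MK by auto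
    have "(\<Sum>n=1..Suc N. ?u (n - 1)) = (\<Sum>n=0..N. ?u n)"
      by (rule sum.reindex_bij_witness[of _ Suc "\<lambda>n. n - 1"]) auto
    also have "\<dots> = 1 + (\<Sum>n=1..N. ?u n)" by (simp add: sum.atLeast_Suc_atMost)
    finally show "(\<Sum>n=1..Suc N. ?u (n - 1)) \<le> 1 + 1/4" using Suc by simp
    show "0 \<le> (\<Sum>n=1..Suc N. ?u (n - 1))" by (intro sum_nonneg u0)
  qed (use c in auto)
  also have "\<dots> \<le> 1/4" by (simp add: power2_eq_square)
  finally show ?case .
qed simp

lemma norm_antideriv_le:
  assumes "\<And>z. z \<in> ball a \<rho> \<Longrightarrow> norm (poly G z) \<le> B" and x: "x \<in> ball a \<rho>"
  shows "norm (poly (antideriv a G) x) \<le> B * \<rho>"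
proof -
  have a: "a \<in> ball a \<rho>" using x le_less_trans[OF zero_le_dist[of a x]] by simp
  have "norm (poly (antideriv a G) x - poly (antideriv a G) a) \<le> B * norm (x - a)"
  proof (rule field_differentiable_bound[where f' = "poly G"])
    show "(poly (antideriv a G) has_field_derivative poly G z) (at z within ball a \<rho>)" for z
      using poly_DERIV[of "antideriv a G" z] by (simp add: antideriv has_field_derivative_at_within)
  qed (use assms a in auto)
  also have "\<dots> \<le> B * \<rho>"
  proof (intro mult_left_mono)
    show "norm (x - a) \<le> \<rho>" using x by (simp add: dist_norm norm_minus_commute)
    show "0 \<le> B" using assms(1)[OF a] norm_ge_zero order_trans by blast
  qed
  finally show ?thesis by (simp add: antideriv)
qed

text \<open>Integration from the centre of the disc costs a factor \<open>\<rho>\<close>, whence the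
  parameter \<open>K * \<rho>\<close>.\<close>

lemma norm_abel_coeff_le_majorant:
  assumes M: "\<And>z. z \<in> ball a \<rho> \<Longrightarrow> norm (poly P z) \<le> M" and K: "\<And>z. z \<in> ball a \<rho> \<Longrightarrow> norm (poly q z) \<le> K"
    and M0: "M \<ge> 0" "K \<ge> 0" "\<rho> > 0" and x: "x \<in> ball a \<rho>"
  shows "norm (poly (abel_coeff a P q n) x) \<le> majorant M (K * \<rho>) n"
  using x
proof (induction n arbitrary: x rule: less_induct)
  case (less n)
  show ?case
  proof (cases "n = 0")
    case False
    then have n: "n > 0" by simp
    let ?w = "abel_coeff a P q" and ?m = "majorant M (K * \<rho>)"
    have m0: "?m i \<ge> 0" for i by (rule majorant_nonneg) (use M0 in auto)
    have "norm (poly (\<Sum>i\<in>{1..<n}. ?w i * ?w (n - i)) x) \<le> (\<Sum>i\<in>{1..<n}. norm (poly (?w i * ?w (n - i)) x))"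
      unfolding poly_sum by (rule norm_sum)
    also have "\<dots> \<le> (\<Sum>i\<in>{1..<n}. ?m i * ?m (n - i))"
      by (intro sum_mono) (auto simp: norm_mult intro!: mult_mono less m0)
    finally have 1: "norm (poly (\<Sum>i\<in>{1..<n}. ?w i * ?w (n - i)) x) / 2 \<le> (\<Sum>i\<in>{1..<n}. ?m i * ?m (n - i)) / 2" by simp
    have 2: "norm (poly (if n = 2 then P else 0) x) \<le> (if n = 2 then M else 0)" using M[OF less.prems] by auto
    have 3: "norm (poly (antideriv a (q * ?w (n - 1))) x) \<le> K * \<rho> * ?m (n - 1)"
    proof -
      have "norm (poly (antideriv a (q * ?w (n - 1))) x) \<le> (K * ?m (n - 1)) * \<rho>"
        by (rule norm_antideriv_le[OF _ less.prems])
           (use K less.IH[of "n - 1"] n M0 in \<open>auto simp: norm_mult intro!: mult_mono\<close>)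
      then show ?thesis by (simp add: mult_ac)
    qed
    have "norm (poly (?w n) x) \<le> norm (poly (\<Sum>i\<in>{1..<n}. ?w i * ?w (n - i)) x) / 2 +
       norm (poly (if n = 2 then P else 0) x) + norm (poly (antideriv a (q * ?w (n - 1))) x)"
    proof -
      have tri: "norm (- u - v - t) \<le> norm u + norm v + norm t" for u v t :: complex
        by (metis (no_types, lifting) add_mono_thms_linordered_semiring(3) norm_minus_cancel norm_triangle_ineq4 order_trans)
      have "poly (?w n) x = - (poly (\<Sum>i\<in>{1..<n}. ?w i * ?w (n - i)) x / 2) -
          poly (if n = 2 then P else 0) x - poly (antideriv a (q * ?w (n - 1))) x"
        by (subst abel_coeff_rec[OF n]) simp
      then show ?thesis
        using tri[of "poly (\<Sum>i\<in>{1..<n}. ?w i * ?w (n - i)) x / 2"] by (simp add: norm_divide)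
    qed
    also have "\<dots> \<le> ?m n" unfolding majorant_rec[OF n] using 1 2 3 by (intro add_mono)
    finally show ?thesis .
  qed simp
qed

text \<open>Only the series \<open>H\<close> of antiderivatives is differentiated term by term. The
  sum \<open>W\<close> satisfies an equation for its square in terms of \<open>P\<close> and
  \<open>H\<close>, and being close to 1 it is the principal square root; this gives its derivative,
  and then the equation for \<open>c / W\<close>.\<close>

lemma abel_solution:
  fixes a :: complex and P q :: "complex poly"
  assumes Pa: "poly P a = 0" and \<rho>: "\<rho> > 0"
  obtains \<delta> where "\<delta> > 0" "\<And>c x. norm c < \<delta> \<Longrightarrow> x \<in> ball a \<rho> \<Longrightarrow> summable (\<lambda>n. c ^ n * poly (abel_coeff a P q n) x)"
    "\<And>c x. norm c < \<delta> \<Longrightarrow> x \<in> ball a \<rho> \<Longrightarrow> (\<Sum>n. c ^ n * poly (abel_coeff a P q n) x) \<noteq> 0"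
    "\<And>c x. norm c < \<delta> \<Longrightarrow> x \<in> ball a \<rho> \<Longrightarrow>
       let y = (\<lambda>x. c / (\<Sum>n. c ^ n * poly (abel_coeff a P q n) x))
       in (y has_field_derivative poly (pderiv P) x * y x ^ 3 + poly q x * y x ^ 2) (at x)"
proof -
  let ?w = "abel_coeff a P q"
  have bd: "\<exists>B\<ge>0. \<forall>z\<in>ball a \<rho>. norm (poly F z) \<le> B" for F :: "complex poly"
  proof -
    have "compact (poly F ` cball a \<rho>)" by (intro compact_continuous_image continuous_intros) auto
    then obtain B where "\<And>z. z \<in> cball a \<rho> \<Longrightarrow> norm (poly F z) \<le> B"
      using compact_imp_bounded bounded_iff by (metis image_eqI)
    then show ?thesis by (intro exI[of _ "max B 0"]) (auto simp: le_max_iff_disj)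
  qed
  obtain M where M: "M \<ge> 0" "\<And>z. z \<in> ball a \<rho> \<Longrightarrow> norm (poly P z) \<le> M" using bd[of P] by blast
  obtain K0 where K0: "K0 \<ge> 0" "\<And>z. z \<in> ball a \<rho> \<Longrightarrow> norm (poly q z) \<le> K0" using bd[of q] by blast
  define K where "K = K0 * \<rho>"
  have K: "K \<ge> 0" using K0(1) \<rho> by (simp add: K_def)
  let ?m = "majorant M K"
  have m0: "?m n \<ge> 0" for n by (rule majorant_nonneg[OF M(1) K])
  have wm: "norm (poly (?w n) x) \<le> ?m n" if "x \<in> ball a \<rho>" for n x
    unfolding K_def by (rule norm_abel_coeff_le_majorant[OF M(2) K0(2) M(1) K0(1) \<rho> that])
  \<comment> \<open>The two fractions bound \<open>M * \<delta>\<close> and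
    \<open>K * \<delta>\<close> by 1/16; the bound by 1 passes from \<open>M * \<delta>\<close> to
    \<open>M * \<delta> ^ 2\<close>.\<close>
  define \<delta> where "\<delta> = min 1 (min (1 / (16 * (M + 1))) (1 / (16 * (K + 1))))"
  have \<delta>: "\<delta> > 0" "\<delta> \<le> 1" using M(1) K by (auto simp: \<delta>_def)
  have "M * \<delta> \<le> M * (1 / (16 * (M + 1)))" using M(1) by (intro mult_left_mono) (auto simp: \<delta>_def)
  also have "\<dots> \<le> 1/16" using M(1) by (simp add: field_simps)
  finally have "M * \<delta> \<le> 1/16" .
  moreover have "M * \<delta> ^ 2 \<le> M * \<delta>"
    using M(1) \<delta> by (intro mult_left_mono) (auto simp: power2_eq_square mult_left_le)
  ultimately have M16: "M * \<delta> ^ 2 \<le> 1/16" by simp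
  have "K * \<delta> \<le> K * (1 / (16 * (K + 1)))" using K by (intro mult_left_mono) (auto simp: \<delta>_def)
  also have "\<dots> \<le> 1/16" using K by (simp add: field_simps)
  finally have K16: "K * \<delta> \<le> 1/16" .
  have part: "(\<Sum>n=1..N. ?m n * \<delta> ^ n) \<le> 1/4" for N
    by (rule majorant_partial_sums[OF M(1) K _ M16 K16]) (use \<delta> in simp)
  have part': "(\<Sum>n<N. ?m (Suc n) * \<delta> ^ Suc n) \<le> 1/4" for N
  proof -
    have "(\<Sum>n<N. ?m (Suc n) * \<delta> ^ Suc n) = (\<Sum>n=1..N. ?m n * \<delta> ^ n)"
      by (rule sum.reindex_bij_witness[of _ "\<lambda>n. n - 1" Suc]) auto
    then show ?thesis using part by simp
  qed
  have sm1: "summable (\<lambda>n. ?m (Suc n) * \<delta> ^ Suc n)"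
    by (rule summableI_nonneg_bounded[OF _ part']) (use m0 \<delta> in auto)
  then have sm: "summable (\<lambda>n. ?m n * \<delta> ^ n)" by (subst (asm) summable_Suc_iff)
  have tail: "(\<Sum>n. ?m (Suc n) * \<delta> ^ Suc n) \<le> 1/4" by (rule suminf_le_const[OF sm1 part'])
  have trm: "norm (c ^ n * poly (?w n) x) \<le> ?m n * \<delta> ^ n" if "norm c < \<delta>" "x \<in> ball a \<rho>" for c :: complex and n x
    using mult_mono[OF wm[OF that(2), of n] power_mono[of "norm c" \<delta> n]] that(1) m0[of n]
    by (simp add: norm_mult norm_power mult.commute)
  have sumW: "summable (\<lambda>n. norm (c ^ n * poly (?w n) x))" if "norm c < \<delta>" "x \<in> ball a \<rho>" for c :: complex and x
    by (rule summable_comparison_test'[OF sm]) (use trm[OF that] in simp)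
  define W where "W = (\<lambda>c x. \<Sum>n. c ^ n * poly (?w n) x)"
  have W1: "norm (W c x - 1) \<le> 1/4" if "norm c < \<delta>" "x \<in> ball a \<rho>" for c :: complex and x
  proof -
    have s: "summable (\<lambda>n. norm (c ^ Suc n * poly (?w (Suc n)) x))"
      using sumW[OF that] by (subst summable_Suc_iff[of "\<lambda>n. norm (c ^ n * poly (?w n) x)"])
    have "W c x = (\<Sum>n. c ^ Suc n * poly (?w (Suc n)) x) + 1"
      unfolding W_def using suminf_split_head[OF summable_norm_cancel[OF sumW[OF that]]] by simp
    then have "norm (W c x - 1) = norm (\<Sum>n. c ^ Suc n * poly (?w (Suc n)) x)" by simp
    also have "\<dots> \<le> (\<Sum>n. norm (c ^ Suc n * poly (?w (Suc n)) x))" by (rule summable_norm[OF s])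
    also have "\<dots> \<le> (\<Sum>n. ?m (Suc n) * \<delta> ^ Suc n)" by (rule suminf_le[OF _ s sm1]) (rule trm[OF that])
    also have "\<dots> \<le> 1/4" by (rule tail)
    finally show ?thesis .
  qed
  have ReW: "Re (W c x) > 0" if "norm c < \<delta>" "x \<in> ball a \<rho>" for c :: complex and x
    using W1[OF that] abs_Re_le_cmod[of "W c x - 1"] by simp
  define H where "H = (\<lambda>c x. \<Sum>n. c ^ n * poly (antideriv a (q * ?w n)) x)"
  have H: "summable (\<lambda>n. c ^ n * poly (antideriv a (q * ?w n)) x)"
    "(H c has_field_derivative poly q x * W c x) (at x)" if c: "norm c < \<delta>" and x: "x \<in> ball a \<rho>" for c :: complex and x
  proof -
    have aB: "a \<in> ball a \<rho>" using \<rho> by simp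
    have der: "((\<lambda>x. c ^ n * poly (antideriv a (q * ?w n)) x) has_field_derivative c ^ n * poly (q * ?w n) z) (at z within ball a \<rho>)" for n z
      using DERIV_cmult[OF poly_DERIV[of "antideriv a (q * ?w n)" z], of "c ^ n"]
      by (simp add: antideriv has_field_derivative_at_within)
    have unif: "uniformly_convergent_on (ball a \<rho>) (\<lambda>N z. \<Sum>n<N. c ^ n * poly (q * ?w n) z)"
    proof (rule Weierstrass_m_test'[of _ _ "\<lambda>n. K0 * (?m n * \<delta> ^ n)"])
      show "norm (c ^ n * poly (q * ?w n) z) \<le> K0 * (?m n * \<delta> ^ n)" if "z \<in> ball a \<rho>" for n z
        using mult_mono[OF K0(2)[OF that] trm[OF c that, of n]] K0(1) by (simp add: norm_mult mult_ac)
      show "summable (\<lambda>n. K0 * (?m n * \<delta> ^ n))" using sm by (rule summable_mult)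
    qed
    have s0: "summable (\<lambda>n. c ^ n * poly (antideriv a (q * ?w n)) a)" by (simp add: antideriv)
    have int: "x \<in> interior (ball a \<rho>)" using x by (simp add: interior_open)
    from has_field_derivative_series'[OF convex_ball der unif aB s0 int]
    show "summable (\<lambda>n. c ^ n * poly (antideriv a (q * ?w n)) x)"
      and d: "(H c has_field_derivative poly q x * W c x) (at x)"
    proof -
      assume a1: "summable (\<lambda>n. c ^ n * poly (antideriv a (q * ?w n)) x)"
        and a2: "((\<lambda>x. \<Sum>n. c ^ n * poly (antideriv a (q * ?w n)) x) has_field_derivative (\<Sum>n. c ^ n * poly (q * ?w n) x)) (at x)"
      show "summable (\<lambda>n. c ^ n * poly (antideriv a (q * ?w n)) x)" by (rule a1)
      have "(\<Sum>n. c ^ n * poly (q * ?w n) x) = (\<Sum>n. poly q x * (c ^ n * poly (?w n) x))" by (simp add: mult_ac)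
      also have "\<dots> = poly q x * W c x" unfolding W_def
        by (rule suminf_mult[OF summable_norm_cancel[OF sumW[OF c x]]])
      finally show "(H c has_field_derivative poly q x * W c x) (at x)" using a2 by (simp add: H_def)
    qed
  qed
  have square: "W c x ^ 2 = 1 - 2 * c ^ 2 * poly P x - 2 * c * H c x" if c: "norm c < \<delta>" and x: "x \<in> ball a \<rho>" for c :: complex and x
  proof -
    let ?f = "\<lambda>n. c ^ n * poly (?w n) x"
    have 1: "(\<lambda>k. \<Sum>i\<le>k. ?f i * ?f (k - i)) sums (W c x * W c x)"
      unfolding W_def by (rule Cauchy_product_sums[OF sumW[OF c x] sumW[OF c x]])
    have term2: "(\<Sum>i\<le>k. ?f i * ?f (k - i)) = (if k = 0 then 1 else 0) + (if k = 2 then - 2 * c ^ 2 * poly P x else 0)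
      + (if k = 0 then 0 else - 2 * c * (c ^ (k - 1) * poly (antideriv a (q * ?w (k - 1))) x))" for k
    proof (cases "k = 0")
      case False
      then have k: "k > 0" by simp
      have "(\<Sum>i\<le>k. ?f i * ?f (k - i)) = c ^ k * poly (\<Sum>i\<le>k. ?w i * ?w (k - i)) x"
        unfolding poly_sum sum_distrib_left
      proof (rule sum.cong[OF refl])
        fix i assume "i \<in> {..k}"
        then have "c ^ k = c ^ i * c ^ (k - i)" by (simp flip: power_add)
        then show "?f i * ?f (k - i) = c ^ k * poly (?w i * ?w (k - i)) x" by simp
      qed
      also have "c ^ k = c * c ^ (k - 1)" using k by (simp flip: power_Suc)
      finally show ?thesis unfolding abel_coeff_convolution[OF k]
        using k by (auto simp: algebra_simps power2_eq_square)
    qed simp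
    have s1: "(\<lambda>k. if k = 0 then 1 else 0) sums (1::complex)" using sums_single[of 0 "\<lambda>_. 1::complex"] by simp
    have s2: "(\<lambda>k. if k = 2 then - 2 * c ^ 2 * poly P x else 0) sums (- 2 * c ^ 2 * poly P x)"
      using sums_single[of 2 "\<lambda>_. - 2 * c ^ 2 * poly P x"] by simp
    have "(\<lambda>k. - 2 * c * (c ^ k * poly (antideriv a (q * ?w k)) x)) sums (- 2 * c * H c x)"
      unfolding H_def by (intro sums_mult summable_sums H(1)[OF c x])
    then have s3: "(\<lambda>k. if k = 0 then 0 else - 2 * c * (c ^ (k - 1) * poly (antideriv a (q * ?w (k - 1))) x)) sums (- 2 * c * H c x)"
      using sums_Suc[of "\<lambda>k. if k = 0 then 0 else - 2 * c * (c ^ (k - 1) * poly (antideriv a (q * ?w (k - 1))) x)"] by simp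
    from sums_unique2[OF 1[unfolded term2] sums_add[OF sums_add[OF s1 s2] s3]]
    show ?thesis by (simp add: power2_eq_square)
  qed
  show ?thesis
  proof (rule that[OF \<delta>(1)])
    fix c x :: complex assume c: "norm c < \<delta>" and x: "x \<in> ball a \<rho>"
    show "summable (\<lambda>n. c ^ n * poly (?w n) x)" by (rule summable_norm_cancel[OF sumW[OF c x]])
    show nz: "(\<Sum>n. c ^ n * poly (?w n) x) \<noteq> 0" using ReW[OF c x] by (auto simp: W_def)
    have Wc: "W c z = csqrt (1 - 2 * c ^ 2 * poly P z - 2 * c * H c z)" if "z \<in> ball a \<rho>" for z
      unfolding square[OF c that, symmetric] using ReW[OF c that] by (simp add: csqrt_square)
    have W0: "W c x \<noteq> 0" using nz by (simp add: W_def)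
    have npos: "1 - 2 * c ^ 2 * poly P x - 2 * c * H c x \<notin> \<real>\<^sub>\<le>\<^sub>0"
    proof
      assume "1 - 2 * c ^ 2 * poly P x - 2 * c * H c x \<in> \<real>\<^sub>\<le>\<^sub>0"
      then obtain r where r: "r \<le> 0" "W c x ^ 2 = of_real r"
        unfolding square[OF c x, symmetric] by (auto elim: nonpos_Reals_cases)
      then have "Im (W c x ^ 2) = 0" "Re (W c x ^ 2) \<le> 0" by auto
      then have "Re (W c x) * Im (W c x) = 0" "Re (W c x) ^ 2 \<le> Im (W c x) ^ 2"
        by (auto simp: power2_eq_square)
      then show False using ReW[OF c x] by auto
    qed
    have "((\<lambda>z. csqrt (1 - 2 * c ^ 2 * poly P z - 2 * c * H c z)) has_field_derivative
       (- 2 * c ^ 2 * poly (pderiv P) x - 2 * c * (poly q x * W c x)) * inverse (2 * W c x)) (at x)"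
    proof -
      have "((\<lambda>z. 1 - 2 * c ^ 2 * poly P z - 2 * c * H c z) has_field_derivative
         (- 2 * c ^ 2 * poly (pderiv P) x - 2 * c * (poly q x * W c x))) (at x)"
        by (auto intro!: derivative_eq_intros poly_DERIV H(2)[OF c x])
      from DERIV_chain2[OF has_field_derivative_csqrt[OF npos] this] show ?thesis
        unfolding Wc[OF x, symmetric] by (simp add: mult.commute)
    qed
    then have dW: "(W c has_field_derivative (- 2 * c ^ 2 * poly (pderiv P) x - 2 * c * (poly q x * W c x)) * inverse (2 * W c x)) (at x)"
      by (rule has_field_derivative_transform_within_open[of _ _ _ "ball a \<rho>"]) (use x Wc in auto)
    let ?y = "\<lambda>x. c / W c x"
    have "(?y has_field_derivative poly (pderiv P) x * ?y x ^ 3 + poly q x * ?y x ^ 2) (at x)"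
    proof (rule DERIV_cong)
      show "(?y has_field_derivative (0 * W c x - c * ((- 2 * c ^ 2 * poly (pderiv P) x - 2 * c * (poly q x * W c x)) * inverse (2 * W c x))) / (W c x * W c x)) (at x)"
        by (rule DERIV_divide[OF DERIV_const dW W0])
      show "(0 * W c x - c * ((- 2 * c ^ 2 * poly (pderiv P) x - 2 * c * (poly q x * W c x)) * inverse (2 * W c x))) / (W c x * W c x)
        = poly (pderiv P) x * ?y x ^ 3 + poly q x * ?y x ^ 2"
        using W0 by (simp add: field_simps power2_eq_square power3_eq_cube)
    qed
    then show "let y = (\<lambda>x. c / (\<Sum>n. c ^ n * poly (?w n) x))
       in (y has_field_derivative poly (pderiv P) x * y x ^ 3 + poly q x * y x ^ 2) (at x)"
      by (simp add: W_def Let_def)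
  qed
qed

section \<open>Parametric centers and moments\<close>

text \<open>Polynomial dependence on the parameter: the outer variable of \<open>G\<close> stands
  for \<open>\<epsilon>\<close>, and its coefficients are polynomials in \<open>x\<close>.\<close>

definition poly_family :: "(complex \<Rightarrow> complex poly) \<Rightarrow> bool" where
  "poly_family F \<longleftrightarrow> (\<exists>G. \<forall>\<epsilon>. F \<epsilon> = poly G [:\<epsilon>:])"

lemma poly_family_const: "poly_family (\<lambda>_. c)"
  unfolding poly_family_def by (rule exI[of _ "[:c:]"]) simp

lemma poly_family_add: "poly_family F \<Longrightarrow> poly_family G \<Longrightarrow> poly_family (\<lambda>\<epsilon>. F \<epsilon> + G \<epsilon>)"
  unfolding poly_family_def by (metis poly_add)

lemma poly_family_mult: "poly_family F \<Longrightarrow> poly_family G \<Longrightarrow> poly_family (\<lambda>\<epsilon>. F \<epsilon> * G \<epsilon>)"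
  unfolding poly_family_def by (metis poly_mult)

lemma poly_family_smult: "poly_family F \<Longrightarrow> poly_family (\<lambda>\<epsilon>. smult c (F \<epsilon>))"
  using poly_family_mult[OF poly_family_const[of "[:c:]"]] by simp

lemma poly_family_smult_param: "poly_family F \<Longrightarrow> poly_family (\<lambda>\<epsilon>. smult \<epsilon> (F \<epsilon>))"
proof -
  assume F: "poly_family F"
  have "poly_family (\<lambda>\<epsilon>. [:\<epsilon>:])" unfolding poly_family_def by (rule exI[of _ "[:0, 1:]"]) simp
  from poly_family_mult[OF this F] show ?thesis by simp
qed

lemma poly_family_diff: "poly_family F \<Longrightarrow> poly_family G \<Longrightarrow> poly_family (\<lambda>\<epsilon>. F \<epsilon> - G \<epsilon>)"
  using poly_family_add[OF _ poly_family_smult[of G "-1"], of F] by simp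

lemma poly_family_sum: "(\<And>i. i \<in> S \<Longrightarrow> poly_family (F i)) \<Longrightarrow> poly_family (\<lambda>\<epsilon>. \<Sum>i\<in>S. F i \<epsilon>)"
  by (induction S rule: infinite_finite_induct) (auto intro: poly_family_add poly_family_const)

text \<open>\<open>antideriv a\<close> is linear over the complex numbers, so it acts on the
  coefficients of the powers of the parameter separately.\<close>

lemma poly_family_antideriv:
  assumes "poly_family F" shows "poly_family (\<lambda>\<epsilon>. antideriv a (F \<epsilon>))"
proof -
  obtain G where G: "\<And>\<epsilon>. F \<epsilon> = poly G [:\<epsilon>:]" using assms by (auto simp: poly_family_def)
  have "antideriv a (poly G [:\<epsilon>:]) = poly (map_poly (antideriv a) G) [:\<epsilon>:]" for \<epsilon>
    by (induction G) (auto simp: map_poly_pCons antideriv_add antideriv_smult)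
  then show ?thesis unfolding poly_family_def G by blast
qed

lemma poly_family_abel_coeff: "poly_family (\<lambda>\<epsilon>. abel_coeff a P (smult \<epsilon> q) n)"
proof (induction n rule: less_induct)
  case (less n)
  show ?case
  proof (cases "n = 0")
    case False
    then have n: "n > 0" by simp
    have "poly_family (\<lambda>\<epsilon>. smult (- 1 / 2) (\<Sum>i\<in>{1..<n}. abel_coeff a P (smult \<epsilon> q) i * abel_coeff a P (smult \<epsilon> q) (n - i))
      - (if n = 2 then P else 0) - antideriv a (smult \<epsilon> (q * abel_coeff a P (smult \<epsilon> q) (n - 1))))"
      by (intro poly_family_diff poly_family_smult poly_family_sum poly_family_mult poly_family_const
            poly_family_antideriv poly_family_smult_param less) (use n in auto)
    then show ?thesis by (subst abel_coeff_rec[OF n]) simp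
  qed (simp add: poly_family_const)
qed

text \<open>A polynomial in \<open>\<epsilon>\<close> with infinitely many zeros is zero. This
  reaches the value 0, at which a preceding division by \<open>\<epsilon>\<close> is
  impossible.\<close>

lemma poly_family_zero_at_0:
  assumes "poly_family F" and "\<And>\<epsilon>. \<epsilon> \<noteq> 0 \<Longrightarrow> poly (F \<epsilon>) b = 0"
  shows "poly (F 0) b = 0"
proof -
  obtain G where G: "\<And>\<epsilon>. F \<epsilon> = poly G [:\<epsilon>:]" using assms by (auto simp: poly_family_def)
  define h where "h = map_poly (\<lambda>c. poly c b) G"
  have h: "poly (F \<epsilon>) b = poly h \<epsilon>" for \<epsilon>
    unfolding G h_def by (induction G) (auto simp: map_poly_pCons)
  have "h = 0"
  proof (rule ccontr)
    assume "h \<noteq> 0"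
    then have "finite {x. poly h x = 0}" by (rule poly_roots_finite)
    moreover have "UNIV - {0} \<subseteq> {x. poly h x = 0}" using assms(2) h by auto
    moreover have "infinite (UNIV - {0::complex})" by (simp add: infinite_UNIV_char_0)
    ultimately show False using finite_subset by blast
  qed
  then show ?thesis using h by simp
qed

text \<open>Without the quadratic term the series is that of the square root of 1 - 2 c^2 P. The
  sign of its coefficients carries the induction: products of negative numbers are positive, so
  nothing cancels and each power of \<open>P\<close> occurs with a nonzero factor.\<close>

lemma abel_coeff_without_q:
  "(odd n \<longrightarrow> abel_coeff a P 0 n = 0) \<and>
   (\<forall>k\<ge>1. n = 2 * k \<longrightarrow> (\<exists>g::real. g < 0 \<and> abel_coeff a P 0 n = smult (of_real g) (P ^ k)))"
proof (induction n rule: less_induct)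
  case (less n)
  let ?w = "abel_coeff a P 0"
  have odd0: "?w i = 0" if "odd i" "i < n" for i using less that by blast
  show ?case
  proof (intro conjI impI allI)
    assume n: "odd n"
    have "?w i * ?w (n - i) = 0" if "i \<in> {1..<n}" for i
      using odd0[of i] odd0[of "n - i"] n that by (cases "odd i") auto
    then have "(\<Sum>i\<in>{1..<n}. ?w i * ?w (n - i)) = 0" by (intro sum.neutral) auto
    moreover have "n > 0" "n \<noteq> 2" using n by (auto intro: Nat.gr0I)
    ultimately show "?w n = 0" by (subst abel_coeff_rec) auto
  next
    fix k assume k: "1 \<le> k" "n = 2 * k"
    have "\<exists>g. \<forall>j. 1 \<le> j \<and> j < k \<longrightarrow> g j < 0 \<and> ?w (2 * j) = smult (of_real (g j)) (P ^ j)"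
    proof (intro choice allI)
      fix j
      have "2 * j < n" if "j < k" using that k(2) by simp
      then show "\<exists>g. 1 \<le> j \<and> j < k \<longrightarrow> g < 0 \<and> ?w (2 * j) = smult (of_real g) (P ^ j)"
        using less.IH[of "2 * j"] by blast
    qed
    then obtain g :: "nat \<Rightarrow> real" where g: "\<And>j. 1 \<le> j \<Longrightarrow> j < k \<Longrightarrow> g j < 0 \<and> ?w (2 * j) = smult (of_real (g j)) (P ^ j)"
      by blast
    have "(\<Sum>i\<in>{1..<n}. ?w i * ?w (n - i)) = (\<Sum>i\<in>(\<lambda>j. 2 * j) ` {1..<k}. ?w i * ?w (n - i))"
    proof (rule sum.mono_neutral_right)
      show "\<forall>i\<in>{1..<n} - (\<lambda>j. 2 * j) ` {1..<k}. ?w i * ?w (n - i) = 0"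
      proof
        fix i assume i: "i \<in> {1..<n} - (\<lambda>j. 2 * j) ` {1..<k}"
        have "odd i"
        proof
          assume "even i"
          then obtain j where "i = 2 * j" by blast
          then show False using i k(2) by auto
        qed
        then show "?w i * ?w (n - i) = 0" using odd0[of i] i by simp
      qed
    qed (use k in auto)
    also have "\<dots> = (\<Sum>j\<in>{1..<k}. ?w (2 * j) * ?w (2 * (k - j)))"
      by (subst sum.reindex) (auto simp: inj_on_def k(2) diff_mult_distrib2)
    also have "\<dots> = (\<Sum>j\<in>{1..<k}. smult (of_real (g j * g (k - j))) (P ^ k))"
    proof (rule sum.cong[OF refl])
      fix j assume j: "j \<in> {1..<k}"
      have "P ^ j * P ^ (k - j) = P ^ k" using j by (simp flip: power_add)
      moreover have "?w (2 * j) = smult (of_real (g j)) (P ^ j)"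
        "?w (2 * (k - j)) = smult (of_real (g (k - j))) (P ^ (k - j))"
        using g[of j] g[of "k - j"] j by auto
      ultimately show "?w (2 * j) * ?w (2 * (k - j)) = smult (of_real (g j * g (k - j))) (P ^ k)"
        by (simp only: mult_smult_left mult_smult_right smult_smult of_real_mult) (simp add: mult.commute)
    qed
    also have "\<dots> = smult (of_real (\<Sum>j\<in>{1..<k}. g j * g (k - j))) (P ^ k)" by (simp add: smult_sum)
    finally have s: "(\<Sum>i\<in>{1..<n}. ?w i * ?w (n - i)) = smult (of_real (\<Sum>j\<in>{1..<k}. g j * g (k - j))) (P ^ k)" .
    have n0: "n > 0" using k by simp
    show "\<exists>g<0. ?w n = smult (of_real g) (P ^ k)"
    proof (cases "k = 1")
      case True
      then have "?w n = smult (of_real (-1)) (P ^ k)" using s k by (subst abel_coeff_rec[OF n0]) simp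
      then show ?thesis by (intro exI[of _ "-1"]) simp
    next
      case False
      then have "(\<Sum>j\<in>{1..<k}. g j * g (k - j)) > 0"
        using g k by (intro sum_pos) (auto intro!: mult_neg_neg)
      moreover have "?w n = smult (of_real (- (\<Sum>j\<in>{1..<k}. g j * g (k - j)) / 2)) (P ^ k)"
        using False k by (subst abel_coeff_rec[OF n0], subst s) simp
      ultimately show ?thesis by (intro exI[of _ "- (\<Sum>j\<in>{1..<k}. g j * g (k - j)) / 2"]) simp
    qed
  qed
qed

section \<open>From parametric centers to vanishing moments\<close>

lemma closed_segment_subset_ball: "closed_segment a b \<subseteq> ball a (norm (b - a) + 1)"
proof
  fix x assume "x \<in> closed_segment a b"
  from segment_bound(1)[OF this] show "x \<in> ball a (norm (b - a) + 1)" by (simp add: dist_norm norm_minus_commute)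
qed

lemma suminf_abel_coeff_at_base:
  assumes "poly P a = 0"
  shows "(\<Sum>n. c ^ n * poly (abel_coeff a P q n) a) = 1"
proof -
  have "(\<lambda>n. c ^ n * poly (abel_coeff a P q n) a) = (\<lambda>n. if n = 0 then 1 else 0)"
    using abel_coeff_at_base[OF assms] by (auto simp: fun_eq_iff)
  then show ?thesis using sums_single[of 0 "\<lambda>_. 1::complex"] sums_unique by force
qed

text \<open>The solution given by the series starts at \<open>c\<close>, and its value at
  \<open>b\<close> is \<open>c\<close> divided by the sum of the series there. The center property
  makes that sum 1 for all small nonzero \<open>c\<close>, and a power series that vanishes near 0
  has zero coefficients.\<close>

lemma parametric_center_abel_coeff:
  assumes Pa: "poly P a = 0" and pc: "parametric_center (pderiv P) q a b" and m: "m > 0"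
  shows "poly (abel_coeff a P (smult \<epsilon> q) m) b = 0"
proof (rule ccontr)
  assume ne: "poly (abel_coeff a P (smult \<epsilon> q) m) b \<noteq> 0"
  let ?w = "abel_coeff a P (smult \<epsilon> q)" and ?\<rho> = "norm (b - a) + 1"
  have \<rho>: "?\<rho> > 0" by (simp add: add_nonneg_pos)
  obtain \<delta> where \<delta>: "\<delta> > 0" "\<And>c x. norm c < \<delta> \<Longrightarrow> x \<in> ball a ?\<rho> \<Longrightarrow> summable (\<lambda>n. c ^ n * poly (?w n) x)"
    "\<And>c x. norm c < \<delta> \<Longrightarrow> x \<in> ball a ?\<rho> \<Longrightarrow> (\<Sum>n. c ^ n * poly (?w n) x) \<noteq> 0"
    "\<And>c x. norm c < \<delta> \<Longrightarrow> x \<in> ball a ?\<rho> \<Longrightarrow>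
       let y = (\<lambda>x. c / (\<Sum>n. c ^ n * poly (?w n) x))
       in (y has_field_derivative poly (pderiv P) x * y x ^ 3 + poly (smult \<epsilon> q) x * y x ^ 2) (at x)"
    by (rule abel_solution[OF Pa \<rho>, of "smult \<epsilon> q"], rule that)
  obtain \<delta>0 where \<delta>0: "\<delta>0 > 0" "\<And>y::complex \<Rightarrow> complex.
        (\<And>x. x \<in> closed_segment a b \<Longrightarrow>
            (y has_field_derivative (poly (pderiv P) x * (y x)^3 + \<epsilon> * poly q x * (y x)^2))
              (at x within closed_segment a b)) \<Longrightarrow> norm (y a) < \<delta>0 \<Longrightarrow> y b = y a"
    using pc unfolding parametric_center_def by meson
  have sub: "closed_segment a b \<subseteq> ball a ?\<rho>" by (rule closed_segment_subset_ball)
  have b: "b \<in> ball a ?\<rho>" using sub by auto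
  have W1: "(\<Sum>n. c ^ n * poly (?w n) b) = 1" if c: "norm c < min \<delta> \<delta>0" "c \<noteq> 0" for c
  proof -
    have c\<delta>: "norm c < \<delta>" using c by simp
    define y where "y = (\<lambda>x. c / (\<Sum>n. c ^ n * poly (?w n) x))"
    have ya: "y a = c" unfolding y_def suminf_abel_coeff_at_base[OF Pa] by simp
    have "y b = y a"
    proof (rule \<delta>0(2))
      fix x assume x: "x \<in> closed_segment a b"
      have "(y has_field_derivative poly (pderiv P) x * y x ^ 3 + poly (smult \<epsilon> q) x * y x ^ 2) (at x)"
        using \<delta>(4)[OF c\<delta>, of x] x sub by (auto simp: y_def Let_def)
      then show "(y has_field_derivative (poly (pderiv P) x * (y x)^3 + \<epsilon> * poly q x * (y x)^2))
              (at x within closed_segment a b)" by (simp add: has_field_derivative_at_within)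
    qed (use ya c in simp)
    then show ?thesis using ya c(2) \<delta>(3)[OF c\<delta> b] by (simp add: y_def field_simps)
  qed
  define d where "d = (\<lambda>n. if n = 0 then 0 else poly (?w n) b)"
  have "(\<lambda>n. d n * (c - 0) ^ n) sums 0" if "norm (c - 0) < min \<delta> \<delta>0" for c
  proof (cases "c = 0")
    case True
    have "(\<lambda>n. d n * (c - 0) ^ n) = (\<lambda>n. 0)" using True by (auto simp: d_def fun_eq_iff)
    then show ?thesis by simp
  next
    case False
    have "(\<lambda>n. c ^ n * poly (?w n) b) sums 1"
      using summable_sums[OF \<delta>(2)[OF _ b, of c]] W1[of c] that False by simp
    moreover have "(\<lambda>n. if n = 0 then 1 else 0) sums (1::complex)" using sums_single[of 0 "\<lambda>_. 1::complex"] by simp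
    ultimately have "(\<lambda>n. c ^ n * poly (?w n) b - (if n = 0 then 1 else 0)) sums (1 - 1)" by (rule sums_diff)
    moreover have "(\<lambda>n. c ^ n * poly (?w n) b - (if n = 0 then 1 else 0)) = (\<lambda>n. d n * (c - 0) ^ n)"
      by (auto simp: d_def fun_eq_iff)
    ultimately show ?thesis by simp
  qed
  moreover have "d m \<noteq> 0" using ne m by (simp add: d_def)
  moreover have "min \<delta> \<delta>0 > 0" using \<delta>(1) \<delta>0(1) by simp
  ultimately obtain s where "s > 0" "\<And>z::complex. z \<in> cball 0 s - {0} \<Longrightarrow> (0::complex) \<noteq> 0"
    using powser_0_nonzero[of "min \<delta> \<delta>0" 0 d "\<lambda>_. 0" m] m by metis
  from this(2)[of "of_real s"] \<open>s > 0\<close> show False by simp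
qed

text \<open>At \<open>b\<close> the convolution identity of order \<open>k + 1\<close> reduces to
  \<open>\<epsilon>\<close> times the integral of \<open>pderiv Q\<close> against the
  \<open>k\<close>-th coefficient. After division by \<open>\<epsilon>\<close>, polynomial
  dependence gives the case of parameter 0, where the coefficient of index \<open>2 * k\<close> is a
  nonzero multiple of \<open>P ^ k\<close>.\<close>

lemma parametric_center_imp_moments_vanish:
  assumes Pab: "poly P a = 0" "poly P b = 0" and pc: "parametric_center (pderiv P) (pderiv Q) a b"
  shows "moments_vanish P Q a b"
proof -
  let ?q = "pderiv Q" and ?w = "\<lambda>\<epsilon>. abel_coeff a P (smult \<epsilon> (pderiv Q))"
  have wb: "poly (?w \<epsilon> n) b = 0" if "n > 0" for \<epsilon> n
    by (rule parametric_center_abel_coeff[OF Pab(1) pc that])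
  have ne0: "poly (antideriv a (?q * ?w \<epsilon> k)) b = 0" if "\<epsilon> \<noteq> 0" for \<epsilon> k
  proof -
    have "(\<Sum>i\<le>Suc k. poly (?w \<epsilon> i * ?w \<epsilon> (Suc k - i)) b) = 0"
    proof (rule sum.neutral, rule ballI)
      fix i assume "i \<in> {..Suc k}"
      show "poly (?w \<epsilon> i * ?w \<epsilon> (Suc k - i)) b = 0" using wb[of i \<epsilon>] wb[of "Suc k" \<epsilon>] by (cases "i = 0") auto
    qed
    then have "poly (\<Sum>i\<le>Suc k. ?w \<epsilon> i * ?w \<epsilon> (Suc k - i)) b = 0" by (simp only: poly_sum)
    then have "poly (antideriv a (smult \<epsilon> ?q * ?w \<epsilon> k)) b = 0"
      unfolding abel_coeff_convolution[OF zero_less_Suc] using Pab by (auto split: if_splits)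
    then show ?thesis using that by (simp add: antideriv_smult)
  qed
  have "poly_family (\<lambda>\<epsilon>. antideriv a (?q * ?w \<epsilon> k))" for k
    by (intro poly_family_antideriv poly_family_mult poly_family_const poly_family_abel_coeff)
  from poly_family_zero_at_0[OF this ne0] have at0: "poly (antideriv a (?q * abel_coeff a P 0 k)) b = 0" for k by simp
  have van: "poly (antideriv a (P ^ k * ?q)) b = 0" for k
  proof (cases "k = 0")
    case True
    then show ?thesis using at0[of 0] by simp
  next
    case False
    then obtain g :: real where g: "g < 0" "abel_coeff a P 0 (2 * k) = smult (of_real g) (P ^ k)"
      using abel_coeff_without_q[of "2 * k" a P] by auto
    then show ?thesis using at0[of "2 * k"] by (simp add: antideriv_smult mult.commute)
  qed
  show ?thesis unfolding moments_vanish_def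
  proof (intro allI impI)
    fix k F assume F: "pderiv F = P ^ k * ?q"
    have "antideriv a (P ^ k * ?q) = F - [:poly F a:]"
      by (rule antideriv_unique) (simp_all add: pderiv_diff pderiv_pCons F)
    then show "poly F a = poly F b" using van[of k] by simp
  qed
qed

text \<open>Along the parametrized segment, \<open>D\<close> times the exponential of minus the
  integral of the coefficient is constant; derivatives within the segment suffice for this.\<close>

lemma linear_ode_zero:
  fixes D A :: "complex \<Rightarrow> complex"
  assumes der: "\<And>x. x \<in> closed_segment a b \<Longrightarrow> (D has_field_derivative A x * D x) (at x within closed_segment a b)"
    and A: "continuous_on (closed_segment a b) A" and Da: "D a = 0"
  shows "D b = 0"
proof -
  define g where "g = linepath a b"
  have gim: "g ` {0..1} = closed_segment a b" by (simp add: g_def linepath_image_01)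
  have gd: "(g has_vector_derivative (b - a)) (at t within {0..1})" for t
    unfolding g_def by (rule has_vector_derivative_linepath_within)
  define h where "h = (\<lambda>t. (b - a) * A (g t))"
  have "continuous_on {0..1} g" by (simp add: g_def continuous_on_linepath)
  then have hc: "continuous_on {0..1} h" unfolding h_def
    by (intro continuous_intros continuous_on_compose2[OF A]) (use gim in auto)
  define B where "B = (\<lambda>t. integral {0..t} h)"
  define e where "e = (\<lambda>t. D (g t) * exp (- B t))"
  have "(e has_vector_derivative 0) (at t within {0..1})" if t: "t \<in> {0..1}" for t
  proof -
    have gt: "g t \<in> closed_segment a b" using gim t by blast
    have "((D \<circ> g) has_vector_derivative (b - a) * (A (g t) * D (g t))) (at t within {0..1})"
      by (rule field_vector_diff_chain_within[OF gd]) (use der[OF gt] gim in simp)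
    then have 1: "((\<lambda>t. D (g t)) has_vector_derivative h t * D (g t)) (at t within {0..1})"
      by (simp add: h_def o_def mult.assoc)
    have "(B has_vector_derivative h t) (at t within {0..1})" unfolding B_def
      by (rule integral_has_vector_derivative[OF hc t])
    then have "((\<lambda>t. - B t) has_vector_derivative - h t) (at t within {0..1})"
      by (rule has_vector_derivative_minus)
    from field_vector_diff_chain_within[OF this, of exp "exp (- B t)"]
    have 2: "((\<lambda>t. exp (- B t)) has_vector_derivative - h t * exp (- B t)) (at t within {0..1})"
      by (simp add: o_def DERIV_exp has_field_derivative_at_within)
    from has_vector_derivative_mult[OF 1 2] show ?thesis unfolding e_def
      by (simp add: algebra_simps)
  qed
  then obtain k where k: "\<And>t. t \<in> {0..1} \<Longrightarrow> e t = k"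
    using has_vector_derivative_zero_constant[of "{0..1::real}" e] by (metis convex_real_interval(5))
  have "e 1 = e 0" using k[of 0] k[of 1] by simp
  then show ?thesis using Da by (simp add: e_def g_def linepath_def)
qed

text \<open>The differences of cubes and of squares contain the factor \<open>y - z\<close>, so the
  difference of two solutions satisfies a homogeneous linear equation with continuous
  coefficient.\<close>

lemma abel_unique:
  fixes y z :: "complex \<Rightarrow> complex" and p q :: "complex poly"
  assumes y: "\<And>x. x \<in> closed_segment a b \<Longrightarrow>
      (y has_field_derivative poly p x * y x ^ 3 + poly q x * y x ^ 2) (at x within closed_segment a b)"
    and z: "\<And>x. x \<in> closed_segment a b \<Longrightarrow>
      (z has_field_derivative poly p x * z x ^ 3 + poly q x * z x ^ 2) (at x within closed_segment a b)"
    and eq: "y a = z a"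
  shows "y b = z b"
proof -
  let ?A = "\<lambda>x. poly p x * (y x ^ 2 + y x * z x + z x ^ 2) + poly q x * (y x + z x)"
  have cont: "continuous_on (closed_segment a b) y" "continuous_on (closed_segment a b) z"
    using y z by (auto intro!: DERIV_continuous_on)
  have "(\<lambda>x. y x - z x) b = 0"
  proof (rule linear_ode_zero[of a b _ ?A])
    show "continuous_on (closed_segment a b) ?A" using cont by (intro continuous_intros)
    fix x assume x: "x \<in> closed_segment a b"
    show "((\<lambda>x. y x - z x) has_field_derivative ?A x * (y x - z x)) (at x within closed_segment a b)"
      by (rule DERIV_cong[OF DERIV_diff[OF y[OF x] z[OF x]]]) (simp add: algebra_simps power2_eq_square power3_eq_cube)
  qed (use eq in simp)
  then show ?thesis by simp
qed

text \<open>The equation for the outer polynomials has a solution \<open>u\<close> on a disc around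
  W(a) that contains the image of the segment. Its pullback under \<open>W\<close> solves the given
  equation, so it is the given solution, and it takes equal values at the endpoints because
  \<open>W\<close> does.\<close>

lemma composition_condition_imp_parametric_center:
  assumes "composition_condition P Q a b"
  shows "parametric_center (pderiv P) (pderiv Q) a b"
proof -
  obtain Pt Qt W where W: "poly W a = poly W b" and P: "P = pcompose Pt W" and Q: "Q = pcompose Qt W"
    using assms by (auto simp: composition_condition_def)
  show ?thesis unfolding parametric_center_def
  proof
    fix \<epsilon> :: complex
    let ?S = "closed_segment a b" and ?A = "poly W a"
    have "compact (poly W ` ?S)" by (intro compact_continuous_image continuous_intros) auto
    then obtain \<rho> where \<rho>: "\<rho> > 0" "poly W ` ?S \<subseteq> ball ?A \<rho>"
      using bounded_subset_ballD compact_imp_bounded by metis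
    \<comment> \<open>The series construction requires the polynomial to vanish at its base point;
      subtracting a constant leaves the equation unchanged.\<close>
    define P0 where "P0 = Pt - [:poly Pt ?A:]"
    have P0: "poly P0 ?A = 0" "pderiv P0 = pderiv Pt" by (simp_all add: P0_def pderiv_diff pderiv_pCons)
    let ?w = "abel_coeff ?A P0 (smult \<epsilon> (pderiv Qt))"
    obtain \<delta> where \<delta>: "\<delta> > 0" "\<And>c x. norm c < \<delta> \<Longrightarrow> x \<in> ball ?A \<rho> \<Longrightarrow> summable (\<lambda>n. c ^ n * poly (?w n) x)"
      "\<And>c x. norm c < \<delta> \<Longrightarrow> x \<in> ball ?A \<rho> \<Longrightarrow> (\<Sum>n. c ^ n * poly (?w n) x) \<noteq> 0"
      "\<And>c x. norm c < \<delta> \<Longrightarrow> x \<in> ball ?A \<rho> \<Longrightarrow>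
         let y = (\<lambda>x. c / (\<Sum>n. c ^ n * poly (?w n) x))
         in (y has_field_derivative poly (pderiv P0) x * y x ^ 3 + poly (smult \<epsilon> (pderiv Qt)) x * y x ^ 2) (at x)"
      by (rule abel_solution[OF P0(1) \<rho>(1), of "smult \<epsilon> (pderiv Qt)"], rule that)
    show "\<exists>\<delta>>0. \<forall>y. (\<forall>x\<in>?S. (y has_field_derivative poly (pderiv P) x * y x ^ 3 + \<epsilon> * poly (pderiv Q) x * y x ^ 2)
        (at x within ?S)) \<and> norm (y a) < \<delta> \<longrightarrow> y b = y a"
    proof (intro exI[of _ \<delta>] conjI allI impI \<delta>(1))
      fix y assume y: "(\<forall>x\<in>?S. (y has_field_derivative poly (pderiv P) x * y x ^ 3 + \<epsilon> * poly (pderiv Q) x * y x ^ 2)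
        (at x within ?S)) \<and> norm (y a) < \<delta>"
      let ?c = "y a"
      define u where "u = (\<lambda>x. ?c / (\<Sum>n. ?c ^ n * poly (?w n) x))"
      have ud: "(u has_field_derivative poly (pderiv Pt) x * u x ^ 3 + \<epsilon> * poly (pderiv Qt) x * u x ^ 2) (at x)"
        if "x \<in> ball ?A \<rho>" for x
        using \<delta>(4)[of ?c x] y that by (simp add: u_def Let_def P0(2))
      have uA: "u ?A = ?c"
      proof -
        have "(\<lambda>n. ?c ^ n * poly (?w n) ?A) = (\<lambda>n. if n = 0 then 1 else 0)"
          using abel_coeff_at_base[OF P0(1)] by (auto simp: fun_eq_iff)
        then have "(\<Sum>n. ?c ^ n * poly (?w n) ?A) = 1"
          using sums_single[of 0 "\<lambda>_. 1::complex"] sums_unique by force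
        then show ?thesis by (simp add: u_def)
      qed
      have "y b = u (poly W b)"
      proof (rule abel_unique[where z = "\<lambda>x. u (poly W x)" and p = "pderiv P" and q = "smult \<epsilon> (pderiv Q)"])
        fix x assume x: "x \<in> ?S"
        show "(y has_field_derivative poly (pderiv P) x * y x ^ 3 + poly (smult \<epsilon> (pderiv Q)) x * y x ^ 2) (at x within ?S)"
          using y x by simp
        have "poly W x \<in> ball ?A \<rho>" using \<rho>(2) x by blast
        from DERIV_chain2[OF ud[OF this] poly_DERIV]
        have "((\<lambda>x. u (poly W x)) has_field_derivative (poly (pderiv P) x * u (poly W x) ^ 3
            + poly (smult \<epsilon> (pderiv Q)) x * u (poly W x) ^ 2)) (at x)"
          unfolding P Q by (simp add: pderiv_pcompose poly_pcompose algebra_simps)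
        then show "((\<lambda>x. u (poly W x)) has_field_derivative (poly (pderiv P) x * u (poly W x) ^ 3
            + poly (smult \<epsilon> (pderiv Q)) x * u (poly W x) ^ 2)) (at x within ?S)"
          by (rule has_field_derivative_at_within)
      qed (use uA in simp)
      then show "y b = y a" using W uA by simp
    qed
  qed
qed

section \<open>The main theorem\<close>

lemma sum_powers_root_of_unity:
  fixes z :: complex
  assumes "z ^ n = 1"
  shows "(\<Sum>j<n. z ^ j) = (if z = 1 then of_nat n else 0)"
  using assms geometric_sum[of z n] by auto

text \<open>The leading term of \<open>Q\<close> along \<open>\<psi>\<close> is a nonzero multiple
  of w^(-m), with m the degree of \<open>Q\<close>. The component of exponent m, multiplied by w^m,
  therefore has a nonzero limit, whereas it vanishes identically when m is coprime to the degree of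
  \<open>P\<close>.\<close>

lemma moments_vanish_degrees_not_coprime:
  fixes P Q :: "complex poly"
  assumes n: "degree P > 0" and m: "degree Q > 0" and Pab: "poly P a = 0" "poly P b = 0" "a \<noteq> b"
    and mom: "moments_vanish P Q a b"
  shows "\<not> coprime (degree Q) (degree P)"
proof
  assume cop: "coprime (degree Q) (degree P)"
  let ?n = "degree P" and ?m = "degree Q"
  let ?Z = "{z::complex. z ^ ?n = 1}"
  obtain r \<psi> \<kappa> \<gamma> where \<psi>: "r > 0" "\<psi> holomorphic_on ball 0 r - {0}" "inj_on \<psi> (ball 0 r - {0})"
    "\<kappa> \<noteq> 0" "((\<lambda>w. w * \<psi> w) \<longlongrightarrow> \<kappa>) (at 0)"
    "\<And>w. w \<in> ball 0 r - {0} \<Longrightarrow> poly P (\<psi> w) = \<gamma> / w ^ ?n"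
    "\<And>Q j w. moments_vanish P Q a b \<Longrightarrow> coprime j ?n \<Longrightarrow> w \<in> ball 0 r - {0} \<Longrightarrow>
        (\<Sum>z\<in>?Z. z ^ j * poly Q (\<psi> (z * w))) = 0"
    by (rule root_of_unity_component_vanishes[OF refl n Pab], rule that)
  have ev: "\<forall>\<^sub>F u in at 0. u * \<psi> u \<noteq> 0" by (rule tendsto_imp_eventually_ne[OF \<psi>(5,4)])
  have "((\<lambda>u. u / (u * \<psi> u)) \<longlongrightarrow> 0 / \<kappa>) (at 0)" by (intro tendsto_intros \<psi>(5,4))
  moreover have "\<forall>\<^sub>F u in at 0. u / (u * \<psi> u) = inverse (\<psi> u)"
    using ev by eventually_elim (simp add: field_simps)
  ultimately have "((\<lambda>u. inverse (\<psi> u)) \<longlongrightarrow> 0 / \<kappa>) (at 0)" by (rule Lim_transform_eventually)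
  then have inv: "((\<lambda>u. inverse (\<psi> u)) \<longlongrightarrow> 0) (at 0)" by simp
  have "((\<lambda>u. (u * \<psi> u) ^ ?m * poly (reflect_poly Q) (inverse (\<psi> u))) \<longlongrightarrow> \<kappa> ^ ?m * poly (reflect_poly Q) 0) (at 0)"
    by (intro tendsto_intros \<psi>(5) inv)
  moreover have "\<forall>\<^sub>F u in at 0. (u * \<psi> u) ^ ?m * poly (reflect_poly Q) (inverse (\<psi> u)) = u ^ ?m * poly Q (\<psi> u)"
    using ev by eventually_elim (simp add: poly_reflect_poly_nz power_mult_distrib power_inverse)
  ultimately have "((\<lambda>u. u ^ ?m * poly Q (\<psi> u)) \<longlongrightarrow> \<kappa> ^ ?m * poly (reflect_poly Q) 0) (at 0)"
    by (rule Lim_transform_eventually)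
  then have L: "((\<lambda>u. u ^ ?m * poly Q (\<psi> u)) \<longlongrightarrow> \<kappa> ^ ?m * lead_coeff Q) (at 0)" by simp
  have "((\<lambda>w. \<Sum>z\<in>?Z. (z * w) ^ ?m * poly Q (\<psi> (z * w))) \<longlongrightarrow> (\<Sum>z\<in>?Z. \<kappa> ^ ?m * lead_coeff Q)) (at 0)"
  proof (rule tendsto_sum)
    fix z assume "z \<in> ?Z"
    then have z: "z \<noteq> 0" using n by (auto simp: power_0_left)
    have "((\<lambda>w. z * w) \<longlongrightarrow> z * 0) (at 0)" by (intro tendsto_intros)
    then have "filterlim (\<lambda>w. z * w) (at 0) (at 0)"
      using z by (auto simp: filterlim_at eventually_at_filter)
    from filterlim_compose[OF L this]
    show "((\<lambda>w. (z * w) ^ ?m * poly Q (\<psi> (z * w))) \<longlongrightarrow> \<kappa> ^ ?m * lead_coeff Q) (at 0)" .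
  qed
  moreover have "\<forall>\<^sub>F w in at 0. (\<Sum>z\<in>?Z. (z * w) ^ ?m * poly Q (\<psi> (z * w))) = 0"
  proof -
    have "\<forall>\<^sub>F w in at 0. w \<in> ball 0 r - {0}" using eventually_at_ball'[OF \<psi>(1), of 0 UNIV] by (auto elim: eventually_mono)
    then show ?thesis
    proof eventually_elim
      case (elim w)
      have "(\<Sum>z\<in>?Z. (z * w) ^ ?m * poly Q (\<psi> (z * w))) = w ^ ?m * (\<Sum>z\<in>?Z. z ^ ?m * poly Q (\<psi> (z * w)))"
        by (simp add: sum_distrib_left power_mult_distrib mult_ac)
      then show ?case using \<psi>(7)[OF mom cop elim] by simp
    qed
  qed
  ultimately have "((\<lambda>w::complex. 0) \<longlongrightarrow> (\<Sum>z\<in>?Z. \<kappa> ^ ?m * lead_coeff Q)) (at 0)"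
    by (rule Lim_transform_eventually)
  then have "(\<Sum>z\<in>?Z. \<kappa> ^ ?m * lead_coeff Q) = 0" by (rule tendsto_unique[OF at_neq_bot _ tendsto_const])
  moreover have "card ?Z > 0"
  proof -
    have "finite ?Z" using n by (intro finite_roots_unity) simp
    moreover have "1 \<in> ?Z" by simp
    ultimately show ?thesis by (metis card_gt_0_iff empty_iff)
  qed
  ultimately show False using \<psi>(4) m by auto
qed

text \<open>The components with exponent not divisible by \<open>p\<close> vanish, so
  \<open>Q\<close> along \<open>\<psi>\<close> is invariant under rotation by a primitive
  \<open>p\<close>-th root of unity, as \<open>P\<close> is. Then \<open>\<psi> w\<close> and
  \<open>\<psi> (\<zeta> * w)\<close> are different points with the same values.\<close>

lemma moments_vanish_prime_power_common_values:
  fixes P Q :: "complex poly"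
  assumes p: "prime p" and n: "degree P = p ^ Suc k" and Pab: "poly P a = 0" "poly P b = 0" "a \<noteq> b"
    and mom: "moments_vanish P Q a b"
  shows "infinite {x. \<exists>y. y \<noteq> x \<and> poly P y = poly P x \<and> poly Q y = poly Q x}"
proof -
  let ?n = "degree P"
  let ?Z = "{z::complex. z ^ ?n = 1}"
  have p0: "p > 1" using p prime_gt_1_nat by blast
  have n0: "?n > 0" using n p0 by simp
  obtain r \<psi> \<kappa> \<gamma> where \<psi>: "r > 0" "\<psi> holomorphic_on ball 0 r - {0}" "inj_on \<psi> (ball 0 r - {0})"
    "\<kappa> \<noteq> 0" "((\<lambda>w. w * \<psi> w) \<longlongrightarrow> \<kappa>) (at 0)"
    "\<And>w. w \<in> ball 0 r - {0} \<Longrightarrow> poly P (\<psi> w) = \<gamma> / w ^ ?n"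
    "\<And>Q j w. moments_vanish P Q a b \<Longrightarrow> coprime j ?n \<Longrightarrow> w \<in> ball 0 r - {0} \<Longrightarrow>
        (\<Sum>z\<in>?Z. z ^ j * poly Q (\<psi> (z * w))) = 0"
    by (rule root_of_unity_component_vanishes[OF refl n0 Pab], rule that)
  define \<zeta> where "\<zeta> = cis (2 * pi / p)"
  have \<zeta>p: "\<zeta> ^ p = 1" using p0 by (simp add: \<zeta>_def Complex.DeMoivre)
  have \<zeta>n: "\<zeta> ^ ?n = 1" unfolding n power_Suc power_mult \<zeta>p by simp
  have \<zeta>1: "\<zeta> \<noteq> 1"
    using inj_onD[OF bij_betw_imp_inj_on[OF Complex.bij_betw_roots_unity[of p]], of 1 0] p0 by (auto simp: \<zeta>_def)
  have \<zeta>norm: "norm \<zeta> = 1" by (simp add: \<zeta>_def)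
  then have \<zeta>0: "\<zeta> \<noteq> 0" by auto
  have finZ: "finite ?Z" using n0 by (intro finite_roots_unity) simp
  let ?G = "\<lambda>j w. \<Sum>z\<in>?Z. z ^ j * poly Q (\<psi> (z * w))"
  \<comment> \<open>Fourier inversion on the group of roots of unity: \<open>Q\<close> along
    \<open>\<psi>\<close> is recovered from its components, so their invariance under
    \<open>\<zeta>\<close> passes to it.\<close>
  have inv: "(\<Sum>j<?n. ?G j w) = of_nat ?n * poly Q (\<psi> w)" for w
  proof -
    have "(\<Sum>j<?n. ?G j w) = (\<Sum>z\<in>?Z. (\<Sum>j<?n. z ^ j) * poly Q (\<psi> (z * w)))"
      by (subst sum.swap) (simp add: sum_distrib_right)
    also have "\<dots> = (\<Sum>z\<in>?Z. if z = 1 then of_nat ?n * poly Q (\<psi> w) else 0)"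
      by (intro sum.cong refl) (auto simp: sum_powers_root_of_unity)
    also have "\<dots> = of_nat ?n * poly Q (\<psi> w)" using finZ by (subst sum.delta) auto
    finally show ?thesis .
  qed
  have inb: "\<zeta> * w \<in> ball 0 r - {0}" if "w \<in> ball 0 r - {0}" for w
    using that \<zeta>0 by (auto simp: norm_mult \<zeta>norm)
  have Geq: "?G j (\<zeta> * w) = ?G j w" if w: "w \<in> ball 0 r - {0}" for j w
  proof (cases "p dvd j")
    case True
    then have \<zeta>j: "\<zeta> ^ j = 1" by (elim dvdE) (simp add: power_mult \<zeta>p)
    show ?thesis
      by (rule sum.reindex_bij_witness[of _ "\<lambda>z. z / \<zeta>" "\<lambda>z. z * \<zeta>"])
         (use \<zeta>0 \<zeta>n \<zeta>j in \<open>auto simp: power_mult_distrib power_divide mult.assoc\<close>)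
  next
    case False
    then have "coprime j ?n" unfolding n using p by (metis coprime_commute coprime_power_right_iff prime_imp_coprime)
    then show ?thesis using \<psi>(7)[OF mom _ w] \<psi>(7)[OF mom _ inb[OF w]] by simp
  qed
  have Qeq: "poly Q (\<psi> (\<zeta> * w)) = poly Q (\<psi> w)" if w: "w \<in> ball 0 r - {0}" for w
  proof -
    have "of_nat ?n * poly Q (\<psi> (\<zeta> * w)) = of_nat ?n * poly Q (\<psi> w)"
      unfolding inv[symmetric] using Geq[OF w] by simp
    then show ?thesis using n0 by simp
  qed
  have "\<psi> ` (ball 0 r - {0}) \<subseteq> {x. \<exists>y. y \<noteq> x \<and> poly P y = poly P x \<and> poly Q y = poly Q x}"
  proof
    fix x assume "x \<in> \<psi> ` (ball 0 r - {0})"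
    then obtain w where w: "x = \<psi> w" "w \<in> ball 0 r - {0}" by blast
    have "\<zeta> * w \<noteq> w" using w(2) \<zeta>1 by auto
    then have "\<psi> (\<zeta> * w) \<noteq> \<psi> w" using inj_onD[OF \<psi>(3) _ inb[OF w(2)] w(2)] by blast
    moreover have "poly P (\<psi> (\<zeta> * w)) = poly P (\<psi> w)"
      unfolding \<psi>(6)[OF inb[OF w(2)]] \<psi>(6)[OF w(2)] by (simp add: power_mult_distrib \<zeta>n)
    ultimately show "x \<in> {x. \<exists>y. y \<noteq> x \<and> poly P y = poly P x \<and> poly Q y = poly Q x}"
      using Qeq[OF w(2)] w(1) by blast
  qed
  moreover have "infinite (\<psi> ` (ball 0 r - {0}))"
  proof -
    have "infinite (ball (0::complex) r)" using uncountable_ball[OF \<psi>(1)] countable_finite by blast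
    then show ?thesis using \<psi>(3) by (simp add: finite_image_iff)
  qed
  ultimately show ?thesis using finite_subset by blast
qed

lemma pcompose_power: "pcompose (P ^ k) W = pcompose P W ^ k"
  for P :: "'a::comm_ring_1 poly"
  by (induction k) (simp_all add: pcompose_mult pcompose_1)

text \<open>Substituting \<open>W\<close> into a primitive gives a primitive. No path is
  transported, so it does not matter that \<open>W\<close> may bend the segment.\<close>

lemma moments_vanish_pcompose:
  assumes mom: "moments_vanish (pcompose P W) (pcompose Q W) a b"
  shows "moments_vanish P Q (poly W a) (poly W b)"
  unfolding moments_vanish_def
proof (intro allI impI)
  fix k F assume F: "pderiv F = P ^ k * pderiv Q"
  have "pderiv (pcompose F W) = (pcompose P W) ^ k * pderiv (pcompose Q W)"
    by (simp add: pderiv_pcompose F pcompose_mult pcompose_power mult.assoc)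
  then show "poly F (poly W a) = poly F (poly W b)"
    using mom unfolding moments_vanish_def by (metis poly_pcompose)
qed

text \<open>A common right factor either takes equal values at the endpoints, and then is the
  required \<open>W\<close>, or it is split off. The outer polynomials then satisfy the same
  hypotheses at its two distinct endpoint values, with \<open>P\<close> of smaller degree.\<close>

lemma moments_vanish_prime_power_imp_composition:
  fixes P Q :: "complex poly"
  assumes "prime p" and "degree P = p ^ k" and "poly P a = 0" "poly P b = 0" "a \<noteq> b"
    and "moments_vanish P Q a b"
  shows "composition_condition P Q a b"
  using assms(2-)
proof (induction "degree P" arbitrary: P Q a b k rule: less_induct)
  case less
  have p1: "p > 1" using assms(1) prime_gt_1_nat by blast
  have n0: "degree P > 0" using less.prems(1) p1 by simp
  \<comment> \<open>A polynomial of degree 1 cannot vanish at two distinct points; this is where the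
    descent has to stop.\<close>
  have "k \<noteq> 0"
  proof
    assume "k = 0"
    then have d1: "degree P = 1" using less.prems(1) by simp
    have P0: "P \<noteq> 0" using n0 by auto
    have "card {a, b} \<le> card {x. poly P x = 0}"
      by (rule card_mono[OF poly_roots_finite[OF P0]]) (use less.prems in auto)
    also have "\<dots> \<le> degree P" by (rule card_poly_roots_bound[OF P0])
    finally have "card {a, b} \<le> degree P" .
    then show False using d1 less.prems(4) by simp
  qed
  then obtain k' where k: "k = Suc k'" by (cases k) auto
  have inf: "infinite {x. \<exists>y. y \<noteq> x \<and> poly P y = poly P x \<and> poly Q y = poly Q x}"
    using moments_vanish_prime_power_common_values[OF assms(1) less.prems(1)[unfolded k] less.prems(2-5)] .
  obtain W Pt Qt where W: "degree W \<ge> 2" "P = pcompose Pt W" "Q = pcompose Qt W"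
    by (rule common_right_factor[OF n0 inf])
  show ?case
  proof (cases "poly W a = poly W b")
    case True
    then show ?thesis using W unfolding composition_condition_def by blast
  next
    case False
    have deg: "degree P = degree Pt * degree W" unfolding W(2) by (rule degree_pcompose)
    then have "degree Pt dvd p ^ k" using less.prems(1) by simp
    then obtain l where l: "degree Pt = p ^ l" using assms(1) by (auto simp: divides_primepow_nat)
    have "degree Pt > 0" using deg n0 by (intro Nat.gr0I) simp
    then have "degree Pt < degree P" using deg W(1) by simp
    moreover have "moments_vanish Pt Qt (poly W a) (poly W b)"
      by (rule moments_vanish_pcompose) (use less.prems(5) W in simp)
    moreover have "poly Pt (poly W a) = 0" "poly Pt (poly W b) = 0"
      using less.prems(2,3) W(2) by (simp_all add: poly_pcompose)
    ultimately have "composition_condition Pt Qt (poly W a) (poly W b)"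
      using less.hyps[OF _ l _ _ False] by blast
    then obtain V P2 Q2 where V: "poly V (poly W a) = poly V (poly W b)" "Pt = pcompose P2 V" "Qt = pcompose Q2 V"
      unfolding composition_condition_def by blast
    have "poly (pcompose V W) a = poly (pcompose V W) b" "P = pcompose P2 (pcompose V W)" "Q = pcompose Q2 (pcompose V W)"
      using V W by (simp_all add: poly_pcompose pcompose_assoc)
    then show ?thesis unfolding composition_condition_def by blast
  qed
qed

theorem theorem4p5:
  fixes a b :: complex and R :: "nat set" and P Q :: "complex poly"
  assumes "a \<noteq> b"
    and "\<forall>r\<in>R. prime r"
    and "P \<in> U_set a b R"
    and "Q \<in> U1_set a b R"
  shows "parametric_center (pderiv P) (pderiv Q) a b \<longleftrightarrow> composition_condition P Q a b"
proof
  assume pc: "parametric_center (pderiv P) (pderiv Q) a b"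
  have P: "poly P a = 0" "poly P b = 0" and Q: "poly Q a = 0" "poly Q b = 0"
    using assms(3,4) by (auto simp: U_set_def U1_set_def vanish_space_def)
  have mom: "moments_vanish P Q a b" by (rule parametric_center_imp_moments_vanish[OF P pc])
  \<comment> \<open>If one of the polynomials is zero, the other serves as \<open>W\<close> itself,
    since it vanishes at both endpoints.\<close>
  consider "P = 0" | "Q = 0" | "P \<noteq> 0" "Q \<noteq> 0" by blast
  then show "composition_condition P Q a b"
  proof cases
    case 1
    have "Q = pcompose [:0, 1:] Q" by (simp add: pcompose_pCons)
    then show ?thesis unfolding composition_condition_def using 1 Q by (metis pcompose_0)
  next
    case 2
    have "P = pcompose [:0, 1:] P" by (simp add: pcompose_pCons)
    then show ?thesis unfolding composition_condition_def using 2 P by (metis pcompose_0)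
  next
    case 3
    have pos: "degree F > 0" if "F \<noteq> 0" "poly F a = 0" for F :: "complex poly"
    proof (rule Nat.gr0I)
      assume "degree F = 0"
      then obtain c where "F = [:c:]" using degree_eq_zeroE by blast
      then show False using that by simp
    qed
    have n: "degree P > 0" and m: "degree Q > 0" using pos 3 P Q by auto
    have "(\<forall>r\<in>R. coprime (degree P) r) \<or> (\<exists>r\<in>R. \<exists>k. degree P = r ^ k)"
      using assms(3) 3(1) leading_coeff_0_iff unfolding U_set_def by blast
    then show ?thesis
    proof
      assume cop: "\<forall>r\<in>R. coprime (degree P) r"
      have sub: "prime_factors (degree Q) \<subseteq> R"
        using assms(4) 3(2) leading_coeff_0_iff unfolding U1_set_def by blast
      have "coprime (degree Q) (degree P)"
      proof (rule ccontr)
        assume "\<not> ?thesis"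
        then obtain q where q: "prime q" "q dvd degree Q" "q dvd degree P"
          by (metis gcd_greatest_iff gcd_nat.bounded_iff coprime_iff_gcd_eq_1 prime_factor_nat)
        then have "q \<in> R" using sub m by (auto simp: prime_factors_dvd)
        then have "coprime (degree P) q" using cop by blast
        then show False using q by (metis coprime_absorb_right not_prime_unit)
      qed
      then show ?thesis using moments_vanish_degrees_not_coprime[OF n m P assms(1) mom] by blast
    next
      assume "\<exists>r\<in>R. \<exists>k. degree P = r ^ k"
      then obtain r k where "prime r" "degree P = r ^ k" using assms(2) by blast
      then show ?thesis by (rule moments_vanish_prime_power_imp_composition[OF _ _ P assms(1) mom])
    qed
  qed
next
  assume "composition_condition P Q a b"
  then show "parametric_center (pderiv P) (pderiv Q) a b" by (rule composition_condition_imp_parametric_center)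
qed

end
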